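(* Let $1<p<\infty$, let $\mathbb M$ be a closed Riemannian manifold of dimension $n$ with $\operatorname{Ric}\ge0$, let $\varepsilon>0$, and let $v$ be a smooth solution of $$v_t=L_\varepsilon v+h_\varepsilon(|\nabla v|^2)$$ on $\mathbb M\times[0,T]$. Then $$F_\varepsilon\le0\qquad\text{on }\mathbb M\times[0,T].$$ In particular, with $u=e^v$, $$(p-1)\frac{|\nabla u|^2}{u^2}-\frac{u_t}{u}\le\frac{n+p-2}{2(p-1)\,t}\qquad\text{on }\mathbb M\times(0,T].$$
   Context: Closed means compact without boundary. Notation: $s=|\nabla v|^2$, $\sigma=s+\varepsilon^2$, $$a^{ij}_\varepsilon=g^{ij}+(p-2)\frac{\nabla^iv\,\nabla^jv}{\sigma},\qquad L_\varepsilon\phi=a^{ij}_\varepsilon\nabla_{ij}\phi,$$ so that $L_\varepsilon v=\Delta v+(p-2)\frac{\nabla^2v(\nabla v,\nabla v)}{|\nabla v|^2+\varepsilon^2}$. Let $$\delta=\frac{p-1}{4},\qquad K=\frac{2(p-1)(2-p)_+}{n+p-2},\qquad h_\varepsilon(s)=(p-1)s+K\int_0^s\left(\frac{\varepsilon^2}{\tau+\varepsilon^2}\right)^{\delta}d\tau,\quad s\ge0$$ (so $K=0$ and $h_\varepsilon(s)=(p-1)s$ when $p\ge2$). Finally $$w_\varepsilon=h_\varepsilon(|\nabla v|^2)-v_t=-L_\varepsilon v,\qquad F_\varepsilon=t\,w_\varepsilon-a,\qquad a=\frac{n+p-2}{2(p-1)}.$$ *)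

theory Defs
  imports "HOL-Analysis.Analysis"
begin

section \<open>Smooth maps\<close>

primrec Ck_on :: "nat \<Rightarrow> 'a::real_normed_vector set \<Rightarrow> ('a \<Rightarrow> 'b::real_normed_vector) \<Rightarrow> bool" where
  "Ck_on 0 S f \<longleftrightarrow> continuous_on S f"
| "Ck_on (Suc k) S f \<longleftrightarrow> (\<forall>x\<in>S. f differentiable (at x)) \<and>
     (\<forall>w. Ck_on k S (\<lambda>x. frechet_derivative f (at x) w))"

text \<open>\<^const>\<open>Ck_on\<close> is meant for open sets. On an arbitrary set, smoothness means the existence of
  local smooth extensions; this is what smoothness up to the times \<open>0\<close> and \<open>T\<close> refers to.\<close>

definition smooth_map_on :: "'a::real_normed_vector set \<Rightarrow> ('a \<Rightarrow> 'b::real_normed_vector) \<Rightarrow> bool" where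
  "smooth_map_on S f \<longleftrightarrow> (\<forall>x\<in>S. \<exists>U f'. open U \<and> x \<in> U \<and> (\<forall>k. Ck_on k U f') \<and> (\<forall>y\<in>S \<inter> U. f' y = f y))"

section \<open>Riemannian manifolds\<close>

text \<open>A chart is a pair of its domain and its coordinate map; the dimension of the manifold
  is \<open>CARD('n)\<close>.\<close>

type_synonym ('m, 'n) chart = "'m set \<times> ('m \<Rightarrow> real^'n)"

definition chart_dom :: "('m, 'n::finite) chart \<Rightarrow> 'm set" where "chart_dom c = fst c"

definition coord :: "('m, 'n::finite) chart \<Rightarrow> 'm \<Rightarrow> real^'n" where "coord c = snd c"

definition param :: "('m, 'n::finite) chart \<Rightarrow> real^'n \<Rightarrow> 'm" where
  "param c = inv_into (chart_dom c) (coord c)"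

definition transition :: "('m, 'n::finite) chart \<Rightarrow> ('m, 'n) chart \<Rightarrow> real^'n \<Rightarrow> real^'n" where
  "transition c d = coord d \<circ> param c"

locale smooth_manifold =
  fixes M :: "'m::t2_space set" and A :: "('m, 'n::finite) chart set"
  assumes chart_open: "c \<in> A \<Longrightarrow> openin (top_of_set M) (chart_dom c)"
    and chart_image_open: "c \<in> A \<Longrightarrow> open (coord c ` chart_dom c)"
    and chart_homeomorphism: "c \<in> A \<Longrightarrow> homeomorphism (chart_dom c) (coord c ` chart_dom c) (coord c) (param c)"
    and charts_cover: "(\<Union>c\<in>A. chart_dom c) = M"
    and transition_smooth: "c \<in> A \<Longrightarrow> d \<in> A \<Longrightarrow>
      smooth_map_on (coord c ` (chart_dom c \<inter> chart_dom d)) (transition c d)"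

text \<open>The metric is given by its coefficient matrices: \<open>g c x\<close> is the matrix \<open>(g\<^sub>i\<^sub>j)\<close> in the chart \<open>c\<close>
  at the coordinate point \<open>x\<close>. The last assumption is the transformation law of covariant 2-tensors.
  Second countability is not required, as it is automatic on the compact manifolds considered here.
  There is no boundary because chart images are open in \<open>real^'n\<close>.\<close>

locale riemannian_manifold = smooth_manifold M A
  for M :: "'m::t2_space set" and A :: "('m, 'n::finite) chart set" +
  fixes g :: "('m, 'n) chart \<Rightarrow> real^'n \<Rightarrow> real^'n^'n"
  assumes metric_smooth: "c \<in> A \<Longrightarrow> smooth_map_on (coord c ` chart_dom c) (g c)"
    and metric_sym: "c \<in> A \<Longrightarrow> x \<in> coord c ` chart_dom c \<Longrightarrow> transpose (g c x) = g c x"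
    and metric_pos: "c \<in> A \<Longrightarrow> x \<in> coord c ` chart_dom c \<Longrightarrow> \<xi> \<noteq> 0 \<Longrightarrow> \<xi> \<bullet> (g c x *v \<xi>) > 0"
    and metric_transform: "c \<in> A \<Longrightarrow> d \<in> A \<Longrightarrow> x \<in> coord c ` (chart_dom c \<inter> chart_dom d) \<Longrightarrow>
      g c x = transpose (jacobian (transition c d) (at x)) ** g d (transition c d x)
                ** jacobian (transition c d) (at x)"

locale closed_riemannian_manifold = riemannian_manifold +
  assumes compact_manifold: "compact M"

section \<open>Differential geometry in coordinates\<close>

text \<open>In this section \<open>G\<close> is a metric and \<open>f\<close>, \<open>\<phi>\<close> are functions on an open subset of \<open>real^'n\<close>.\<close>

definition partial :: "'n::finite \<Rightarrow> (real^'n \<Rightarrow> real) \<Rightarrow> real^'n \<Rightarrow> real" where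
  "partial i f x = frechet_derivative f (at x) (axis i 1)"

definition christoffel :: "(real^'n \<Rightarrow> real^'n^'n) \<Rightarrow> 'n::finite \<Rightarrow> 'n \<Rightarrow> 'n \<Rightarrow> real^'n \<Rightarrow> real" where
  "christoffel G k i j x = (1/2) * (\<Sum>l\<in>UNIV. matrix_inv (G x) $ k $ l *
     (partial i (\<lambda>y. G y $ j $ l) x + partial j (\<lambda>y. G y $ i $ l) x - partial l (\<lambda>y. G y $ i $ j) x))"

text \<open>\<open>riemann G l k i j\<close> is the \<open>l\<close>-th component of \<open>R(\<partial>\<^sub>i, \<partial>\<^sub>j) \<partial>\<^sub>k\<close>, where
  \<open>R(X, Y) Z = \<nabla>\<^sub>X \<nabla>\<^sub>Y Z - \<nabla>\<^sub>Y \<nabla>\<^sub>X Z - \<nabla>\<^bsub>[X,Y]\<^esub> Z\<close>,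
  and \<open>Ric(Y, Z)\<close> is the trace of \<open>X \<mapsto> R(X, Y) Z\<close>, so that round spheres have positive
  Ricci curvature.\<close>

definition riemann :: "(real^'n \<Rightarrow> real^'n^'n) \<Rightarrow> 'n::finite \<Rightarrow> 'n \<Rightarrow> 'n \<Rightarrow> 'n \<Rightarrow> real^'n \<Rightarrow> real" where
  "riemann G l k i j x =
     partial i (christoffel G l j k) x - partial j (christoffel G l i k) x
     + (\<Sum>m\<in>UNIV. christoffel G l i m x * christoffel G m j k x - christoffel G l j m x * christoffel G m i k x)"

definition ricci :: "(real^'n \<Rightarrow> real^'n^'n) \<Rightarrow> 'n::finite \<Rightarrow> 'n \<Rightarrow> real^'n \<Rightarrow> real" where
  "ricci G j k x = (\<Sum>i\<in>UNIV. riemann G i k i j x)"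

definition grad :: "(real^'n \<Rightarrow> real^'n^'n) \<Rightarrow> (real^'n::finite \<Rightarrow> real) \<Rightarrow> real^'n \<Rightarrow> real^'n" where
  "grad G f x = (\<chi> i. \<Sum>j\<in>UNIV. matrix_inv (G x) $ i $ j * partial j f x)"

definition grad_sq :: "(real^'n \<Rightarrow> real^'n^'n) \<Rightarrow> (real^'n::finite \<Rightarrow> real) \<Rightarrow> real^'n \<Rightarrow> real" where
  "grad_sq G f x = grad G f x \<bullet> (G x *v grad G f x)"

definition hess :: "(real^'n \<Rightarrow> real^'n^'n) \<Rightarrow> 'n::finite \<Rightarrow> 'n \<Rightarrow> (real^'n \<Rightarrow> real) \<Rightarrow> real^'n \<Rightarrow> real" where
  "hess G i j f x = partial i (partial j f) x - (\<Sum>k\<in>UNIV. christoffel G k i j x * partial k f x)"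

text \<open>The operator \<open>L\<^sub>\<epsilon>\<close> with coefficients \<open>a\<^sup>i\<^sup>j\<close> built from \<open>f\<close>, applied to \<open>\<phi>\<close>.\<close>

definition a_coeff :: "real \<Rightarrow> real \<Rightarrow> (real^'n \<Rightarrow> real^'n^'n) \<Rightarrow> (real^'n \<Rightarrow> real) \<Rightarrow> 'n::finite \<Rightarrow> 'n \<Rightarrow> real^'n \<Rightarrow> real" where
  "a_coeff p \<epsilon> G f i j x = matrix_inv (G x) $ i $ j
     + (p - 2) * (grad G f x $ i * grad G f x $ j) / (grad_sq G f x + \<epsilon>\<^sup>2)"

definition L_op :: "real \<Rightarrow> real \<Rightarrow> (real^'n::finite \<Rightarrow> real^'n^'n) \<Rightarrow> (real^'n \<Rightarrow> real) \<Rightarrow> (real^'n \<Rightarrow> real) \<Rightarrow> real^'n \<Rightarrow> real" where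
  "L_op p \<epsilon> G f \<phi> x = (\<Sum>i\<in>UNIV. \<Sum>j\<in>UNIV. a_coeff p \<epsilon> G f i j x * hess G i j \<phi> x)"

section \<open>Differential geometry on the manifold\<close>

text \<open>The scalars below are expressed in a chart \<open>c\<close> around the point \<open>m\<close>. By tensoriality they do not
  depend on the choice of \<open>c\<close>; statements about them are made in all charts of the atlas.\<close>

definition nonneg_ricci :: "('m, 'n::finite) chart set \<Rightarrow> (('m, 'n) chart \<Rightarrow> real^'n \<Rightarrow> real^'n^'n) \<Rightarrow> bool" where
  "nonneg_ricci A g \<longleftrightarrow> (\<forall>c\<in>A. \<forall>x\<in>coord c ` chart_dom c. \<forall>\<xi>.
     (\<Sum>i\<in>UNIV. \<Sum>j\<in>UNIV. ricci (g c) i j x * \<xi> $ i * \<xi> $ j) \<ge> 0)"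

definition grad_sq_at :: "(('m, 'n::finite) chart \<Rightarrow> real^'n \<Rightarrow> real^'n^'n) \<Rightarrow> ('m, 'n) chart \<Rightarrow> ('m \<Rightarrow> real) \<Rightarrow> 'm \<Rightarrow> real" where
  "grad_sq_at g c f m = grad_sq (g c) (f \<circ> param c) (coord c m)"

definition L_at :: "real \<Rightarrow> real \<Rightarrow> (('m, 'n::finite) chart \<Rightarrow> real^'n \<Rightarrow> real^'n^'n) \<Rightarrow> ('m, 'n) chart \<Rightarrow>
    ('m \<Rightarrow> real) \<Rightarrow> ('m \<Rightarrow> real) \<Rightarrow> 'm \<Rightarrow> real" where
  "L_at p \<epsilon> g c f \<phi> m = L_op p \<epsilon> (g c) (f \<circ> param c) (\<phi> \<circ> param c) (coord c m)"

section \<open>The equation on \<open>M \<times> [0, T]\<close>\<close>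

text \<open>One-sided at the end points of \<open>[0, T]\<close>.\<close>

definition time_deriv :: "real \<Rightarrow> (real \<Rightarrow> 'm \<Rightarrow> real) \<Rightarrow> real \<Rightarrow> 'm \<Rightarrow> real" where
  "time_deriv T v t m = vector_derivative (\<lambda>\<tau>. v \<tau> m) (at t within {0..T})"

definition K_const :: "nat \<Rightarrow> real \<Rightarrow> real" where
  "K_const n p = 2 * (p - 1) * max 0 (2 - p) / (real n + p - 2)"

definition h_fun :: "nat \<Rightarrow> real \<Rightarrow> real \<Rightarrow> real \<Rightarrow> real" where
  "h_fun n p \<epsilon> s = (p - 1) * s
     + K_const n p * integral {0..s} (\<lambda>\<tau>. (\<epsilon>\<^sup>2 / (\<tau> + \<epsilon>\<^sup>2)) powr ((p - 1) / 4))"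

definition smooth_on_spacetime :: "('m, 'n::finite) chart set \<Rightarrow> real \<Rightarrow> (real \<Rightarrow> 'm \<Rightarrow> real) \<Rightarrow> bool" where
  "smooth_on_spacetime A T v \<longleftrightarrow>
     (\<forall>c\<in>A. smooth_map_on ({0..T} \<times> coord c ` chart_dom c) (\<lambda>(t, x). v t (param c x)))"

definition smooth_solution ::
  "real \<Rightarrow> real \<Rightarrow> ('m, 'n::finite) chart set \<Rightarrow> (('m, 'n) chart \<Rightarrow> real^'n \<Rightarrow> real^'n^'n) \<Rightarrow> real \<Rightarrow> (real \<Rightarrow> 'm \<Rightarrow> real) \<Rightarrow> bool" where
  "smooth_solution p \<epsilon> A g T v \<longleftrightarrow> smooth_on_spacetime A T v \<and>
     (\<forall>c\<in>A. \<forall>m\<in>chart_dom c. \<forall>t\<in>{0..T}.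
        time_deriv T v t m = L_at p \<epsilon> g c (v t) (v t) m + h_fun CARD('n) p \<epsilon> (grad_sq_at g c (v t) m))"

definition w_fun :: "real \<Rightarrow> real \<Rightarrow> (('m, 'n::finite) chart \<Rightarrow> real^'n \<Rightarrow> real^'n^'n) \<Rightarrow> real \<Rightarrow>
    (real \<Rightarrow> 'm \<Rightarrow> real) \<Rightarrow> ('m, 'n) chart \<Rightarrow> real \<Rightarrow> 'm \<Rightarrow> real" where
  "w_fun p \<epsilon> g T v c t m = h_fun CARD('n) p \<epsilon> (grad_sq_at g c (v t) m) - time_deriv T v t m"

definition a_const :: "nat \<Rightarrow> real \<Rightarrow> real" where
  "a_const n p = (real n + p - 2) / (2 * (p - 1))"

definition F_fun :: "real \<Rightarrow> real \<Rightarrow> (('m, 'n::finite) chart \<Rightarrow> real^'n \<Rightarrow> real^'n^'n) \<Rightarrow> real \<Rightarrow>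
    (real \<Rightarrow> 'm \<Rightarrow> real) \<Rightarrow> ('m, 'n) chart \<Rightarrow> real \<Rightarrow> 'm \<Rightarrow> real" where
  "F_fun p \<epsilon> g T v c t m = t * w_fun p \<epsilon> g T v c t m - a_const CARD('n) p"

end

theory Submission
  imports Defs
begin

text \<open>Differentiating \<open>w = - L\<^sub>\<epsilon> v\<close> in time and using \<open>v\<^sub>t = h(s) - w\<close>, Bochner's formula for
  \<open>s = |\<nabla>v|\<^sup>2\<close> and \<open>Ric \<ge> 0\<close> give, up to terms that are linear in \<open>\<nabla>w\<close>,
  \<open>w\<^sub>t - L\<^sub>\<epsilon> w \<le> - h'(s) (2 |\<nabla>\<^sup>2v|\<^sup>2 + (p - 2) |\<nabla>s|\<^sup>2 / (2 \<sigma>)) - h''(s) (|\<nabla>s|\<^sup>2 + (p - 2) \<langle>\<nabla>s, \<nabla>v\<rangle>\<^sup>2 / \<sigma>)\<close>.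
  In an orthonormal frame adapted to \<open>\<nabla>v\<close> a weighted Cauchy-Schwarz inequality bounds the right-hand side
  by \<open>- w\<^sup>2 / a\<close>. At a positive maximum of \<open>F = t w - a\<close> over the compact space \<open>[0, T] \<times> M\<close> one has
  \<open>t > 0\<close>, \<open>\<nabla>w = 0\<close>, \<open>L\<^sub>\<epsilon> w \<le> 0\<close> and \<open>w + t w\<^sub>t \<ge> 0\<close>, hence \<open>t w \<le> a\<close>, a contradiction. The tensor
  calculus at the maximum takes place in an arbitrary chart. Only \<open>|\<nabla>v|\<^sup>2\<close> has to be shown independent of
  the chart, because \<open>w = h(|\<nabla>v|\<^sup>2) - v\<^sub>t\<close> contains no second derivatives in space.\<close>

section \<open>Calculus of smooth functions\<close>

text \<open>With (p-1) s alone in place of h, the Cauchy-Schwarz step would ask for n + (p-2)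
  \<theta> \<le> n + p - 2, where \<theta> = s/\<sigma> < 1. For p < 2 this fails by the deficit
  (2-p)(1-\<theta>). The integral in h repairs it: it raises h' by K q with q = (1-\<theta>) powr
  \<delta>, but it is concave, and 2 s h'' takes a part of the gain back. As \<delta> \<le> 1, q
  dominates 1-\<theta>; as 2 \<delta> \<le> 1/2 for p < 2, at least half of the gain survives; the
  factor 2 in K makes up for the other half. Because K \<ge> 0, h stays above (p-1) s, so the bound
  for w still gives the one for u.

  The other obstacle is the third derivatives of v, which enter through \<nabla>\<Delta>v in
  Bochner's formula and through the Hessian of s in the direction \<nabla>v. The condition
  \<nabla>(L v) = 0 at the maximum expresses the former by the latter, and they cancel. What is left
  of |\<nabla>s|^2 has the wrong sign until the time derivative of the coefficients of L is
  added.\<close>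

definition smooth_on :: "'a::real_normed_vector set \<Rightarrow> ('a \<Rightarrow> 'b::real_normed_vector) \<Rightarrow> bool" where
  "smooth_on S f \<longleftrightarrow> (\<forall>k. Ck_on k S f)"

text \<open>The point is the last argument, so \<open>dir w f\<close> is again a function and can be
  differentiated further.\<close>

definition dir :: "'a::real_normed_vector \<Rightarrow> ('a \<Rightarrow> 'b::real_normed_vector) \<Rightarrow> 'a \<Rightarrow> 'b" where
  "dir w f x = frechet_derivative f (at x) w"

lemma dir_eqI: "(f has_derivative f') (at x) \<Longrightarrow> dir w f x = f' w"
  unfolding dir_def using frechet_derivative_at by metis

lemma has_derivative_dir: "f differentiable (at x) \<Longrightarrow> (f has_derivative (\<lambda>w. dir w f x)) (at x)"
  unfolding dir_def using frechet_derivative_works by blast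

lemma linear_dir: "f differentiable (at x) \<Longrightarrow> linear (\<lambda>w. dir w f x)"
  using has_derivative_dir has_derivative_linear by blast

lemma dir_cong_open:
  assumes "open S" "x \<in> S" "\<And>y. y \<in> S \<Longrightarrow> f y = g y"
  shows "dir w f x = dir w g x"
proof -
  \<comment> \<open>\<open>frechet_derivative\<close> is a choice. Equality of the whole sets of
    derivatives makes the chosen values agree even where no derivative exists.\<close>
  have "(f has_derivative D) (at x) \<longleftrightarrow> (g has_derivative D) (at x)" for D
    using has_derivative_transform_within_open[of f D x UNIV S g]
      has_derivative_transform_within_open[of g D x UNIV S f] assms by metis
  then show ?thesis by (simp add: dir_def frechet_derivative_def)
qed

lemma differentiable_cong_open:
  assumes "open S" "x \<in> S" "\<And>y. y \<in> S \<Longrightarrow> f y = g y" "f differentiable (at x)"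
  shows "g differentiable (at x)"
  using assms unfolding differentiable_def
  by (metis has_derivative_transform_within_open)

lemma Ck_on_cong:
  assumes "open S" "\<And>x. x \<in> S \<Longrightarrow> f x = g x" "Ck_on k S f"
  shows "Ck_on k S g"
  using assms(2,3)
proof (induction k arbitrary: f g)
  case 0
  then show ?case using continuous_on_cong[of S S f g] by simp
next
  case (Suc k)
  have "Ck_on k S (\<lambda>x. frechet_derivative g (at x) w)" for w
    by (rule Suc.IH[of "\<lambda>x. frechet_derivative f (at x) w"])
      (use Suc.prems dir_cong_open[OF \<open>open S\<close>, of _ f g w] in \<open>auto simp: dir_def\<close>)
  then show ?case using Suc.prems differentiable_cong_open[OF \<open>open S\<close>, of _ f g] by auto
qed

lemma smooth_on_cong:
  assumes "open S" "\<And>x. x \<in> S \<Longrightarrow> f x = g x" "smooth_on S f"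
  shows "smooth_on S g"
  using assms Ck_on_cong unfolding smooth_on_def by metis

lemma Ck_on_subset: "Ck_on k S f \<Longrightarrow> S' \<subseteq> S \<Longrightarrow> Ck_on k S' f"
  by (induction k arbitrary: f) (auto intro: continuous_on_subset)

lemma smooth_on_subset: "smooth_on S f \<Longrightarrow> S' \<subseteq> S \<Longrightarrow> smooth_on S' f"
  unfolding smooth_on_def using Ck_on_subset by blast

lemma smooth_on_continuous: "smooth_on S f \<Longrightarrow> continuous_on S f"
  unfolding smooth_on_def using Ck_on.simps(1) by blast

lemma smooth_on_differentiable: "smooth_on S f \<Longrightarrow> x \<in> S \<Longrightarrow> f differentiable (at x)"
  unfolding smooth_on_def using Ck_on.simps(2) by blast

lemma smooth_on_dir: "smooth_on S f \<Longrightarrow> smooth_on S (dir w f)"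
  unfolding smooth_on_def dir_def using Ck_on.simps(2) by blast

text \<open>Replaces the chosen \<open>frechet_derivative\<close> in \<open>Ck_on\<close> by an
  explicit formula; every closure property below supplies its own.\<close>

lemma Ck_on_SucI:
  assumes "open S" "\<And>x. x \<in> S \<Longrightarrow> (f has_derivative (\<lambda>w. f' w x)) (at x)"
    "\<And>w. Ck_on k S (f' w)"
  shows "Ck_on (Suc k) S f"
proof -
  have "f' w x = frechet_derivative f (at x) w" if "x \<in> S" for x w
    using dir_eqI[OF assms(2)[OF that], of w] by (simp add: dir_def)
  then have "Ck_on k S (\<lambda>x. frechet_derivative f (at x) w)" for w
    by (rule Ck_on_cong[OF assms(1) _ assms(3)])
  then show ?thesis using assms(2) by (auto simp: differentiable_def)
qed

lemma Ck_on_const [simp]: "Ck_on k S (\<lambda>x. c)"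
  by (induction k arbitrary: c) auto

lemma smooth_on_const [simp]: "smooth_on S (\<lambda>x. c)"
  by (simp add: smooth_on_def)

lemma Ck_on_add:
  assumes "open S"
  shows "Ck_on k S f \<Longrightarrow> Ck_on k S g \<Longrightarrow> Ck_on k S (\<lambda>x. f x + g x)"
proof (induction k arbitrary: f g)
  case 0 then show ?case by (auto intro: continuous_intros)
next
  case (Suc k)
  show ?case
  proof (rule Ck_on_SucI[OF \<open>open S\<close>, where f' = "\<lambda>w x. dir w f x + dir w g x"])
    show "((\<lambda>x. f x + g x) has_derivative (\<lambda>w. dir w f x + dir w g x)) (at x)" if "x \<in> S" for x
      by (rule has_derivative_add; rule has_derivative_dir) (use Suc.prems that in auto)
    show "Ck_on k S (\<lambda>x. dir w f x + dir w g x)" for w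
      by (rule Suc.IH) (use Suc.prems in \<open>auto simp: dir_def\<close>)
  qed
qed

lemma smooth_on_add: "open S \<Longrightarrow> smooth_on S f \<Longrightarrow> smooth_on S g \<Longrightarrow> smooth_on S (\<lambda>x. f x + g x)"
  using Ck_on_add unfolding smooth_on_def by blast

lemma smooth_on_bounded_linear:
  assumes "open S" "bounded_linear L" "smooth_on S f"
  shows "smooth_on S (\<lambda>x. L (f x))"
proof -
  have "Ck_on k S f \<Longrightarrow> Ck_on k S (\<lambda>x. L (f x))" for k
  proof (induction k arbitrary: f)
    case 0
    then show ?case by (simp add: bounded_linear.continuous_on[OF assms(2)])
  next
    case (Suc k)
    have d: "((\<lambda>x. L (f x)) has_derivative (\<lambda>w. L (dir w f x))) (at x)" if "x \<in> S" for x
      by (rule bounded_linear.has_derivative[OF assms(2)], rule has_derivative_dir)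
        (use Suc.prems that in auto)
    show ?case
      by (rule Ck_on_SucI[OF \<open>open S\<close>, where f' = "\<lambda>w x. L (dir w f x)"])
        (use d Suc in \<open>auto simp: dir_def[abs_def]\<close>)
  qed
  then show ?thesis using assms(3) by (simp add: smooth_on_def)
qed

lemma smooth_on_mult:
  fixes f g :: "'a::real_normed_vector \<Rightarrow> real"
  assumes "open S" "smooth_on S f" "smooth_on S g"
  shows "smooth_on S (\<lambda>x. f x * g x)"
proof -
  \<comment> \<open>The induction is over products of smooth functions, whose order does not drop:
    both summands of the product rule are covered by the hypothesis for k.\<close>
  have "smooth_on S f \<Longrightarrow> smooth_on S g \<Longrightarrow> Ck_on k S (\<lambda>x. f x * g x)" for k
  proof (induction k arbitrary: f g)
    case 0
    then show ?case using continuous_on_mult[OF smooth_on_continuous smooth_on_continuous] by auto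
  next
    case (Suc k)
    have d: "((\<lambda>x. f x * g x) has_derivative (\<lambda>w. f x * dir w g x + dir w f x * g x)) (at x)"
      if "x \<in> S" for x
      by (rule has_derivative_mult; rule has_derivative_dir)
        (use Suc.prems that smooth_on_differentiable in auto)
    show ?case
      by (rule Ck_on_SucI[OF \<open>open S\<close>, where f' = "\<lambda>w x. f x * dir w g x + dir w f x * g x"])
        (use d Ck_on_add[OF assms(1) Suc.IH Suc.IH] smooth_on_dir[OF Suc.prems(1)]
          smooth_on_dir[OF Suc.prems(2)] Suc.prems in auto)
  qed
  then show ?thesis using assms by (simp add: smooth_on_def)
qed

lemma smooth_on_sum:
  assumes "open S" "\<And>i. i \<in> I \<Longrightarrow> smooth_on S (f i)"
  shows "smooth_on S (\<lambda>x. \<Sum>i\<in>I. f i x)"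
  using assms(2) by (induction I rule: infinite_finite_induct) (auto intro: smooth_on_add assms(1))

lemma smooth_on_prod:
  fixes f :: "'i \<Rightarrow> 'a::real_normed_vector \<Rightarrow> real"
  assumes "open S" "\<And>i. i \<in> I \<Longrightarrow> smooth_on S (f i)"
  shows "smooth_on S (\<lambda>x. \<Prod>i\<in>I. f i x)"
  using assms(2) by (induction I rule: infinite_finite_induct) (auto intro: smooth_on_mult assms(1))

lemma smooth_on_diff:
  assumes "open S" "smooth_on S f" "smooth_on S g"
  shows "smooth_on S (\<lambda>x. f x - g x)"
  using smooth_on_add[OF assms(1,2) smooth_on_bounded_linear[OF assms(1) bounded_linear_minus[OF bounded_linear_ident] assms(3)]]
  by simp

text \<open>The outer function is handled through a family \<open>H k\<close> of its iterated derivatives, so that no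
  chain rule of higher order is needed.\<close>

lemma smooth_on_compose_real:
  fixes f :: "'a::real_normed_vector \<Rightarrow> real" and H :: "nat \<Rightarrow> real \<Rightarrow> real"
  assumes "open S" "smooth_on S f"
    and H: "\<And>k x. x \<in> S \<Longrightarrow> (H k has_real_derivative H (Suc k) (f x)) (at (f x))"
  shows "smooth_on S (\<lambda>x. H m (f x))"
proof -
  have d: "((\<lambda>x. H m (f x)) has_derivative (\<lambda>w. H (Suc m) (f x) * dir w f x)) (at x)"
    if "x \<in> S" for x m
    using has_derivative_compose[OF has_derivative_dir[OF smooth_on_differentiable[OF assms(2) that]]
        has_field_derivative_imp_has_derivative[OF H[OF that]]] .
  \<comment> \<open>The smooth factor g closes the claim under differentiation: the derivative is a
    sum of two products of the same shape, with m or m + 1.\<close>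
  have "Ck_on k S (\<lambda>x. g x * H m (f x))" if "smooth_on S g" for g k m
    using that
  proof (induction k arbitrary: g m)
    case 0
    have "continuous_on S (\<lambda>x. H m (f x))"
      using d has_derivative_continuous continuous_at_imp_continuous_on by metis
    then show ?case using continuous_on_mult[OF smooth_on_continuous[OF 0]] by simp
  next
    case (Suc k)
    have d2: "((\<lambda>x. g x * H m (f x)) has_derivative
        (\<lambda>w. g x * (H (Suc m) (f x) * dir w f x) + dir w g x * H m (f x))) (at x)" if "x \<in> S" for x
      by (rule has_derivative_mult[OF has_derivative_dir d[OF that]])
        (use Suc.prems that smooth_on_differentiable in auto)
    have "Ck_on k S (\<lambda>x. g x * (H (Suc m) (f x) * dir w f x) + dir w g x * H m (f x))" for w
      using Ck_on_add[OF \<open>open S\<close> Suc.IH[of "\<lambda>x. g x * dir w f x" "Suc m"] Suc.IH[of "dir w g" m]]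
        smooth_on_mult[OF \<open>open S\<close> Suc.prems smooth_on_dir[OF assms(2)]] smooth_on_dir[OF Suc.prems]
      by (simp add: mult_ac)
    with d2 show ?case
      by (intro Ck_on_SucI[OF \<open>open S\<close>,
          where f' = "\<lambda>w x. g x * (H (Suc m) (f x) * dir w f x) + dir w g x * H m (f x)"])
        auto
  qed
  from this[of "\<lambda>x. 1"] show ?thesis by (simp add: smooth_on_def)
qed

lemma smooth_on_powr:
  fixes f :: "'a::real_normed_vector \<Rightarrow> real"
  assumes "open S" "smooth_on S f" "\<And>x. x \<in> S \<Longrightarrow> f x > 0"
  shows "smooth_on S (\<lambda>x. f x powr r)"
proof -
  define H where "H k y = (\<Prod>j<k. r - real j) * y powr (r - real k)" for k and y :: real
  have "smooth_on S (\<lambda>x. H 0 (f x))"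
  proof (rule smooth_on_compose_real[OF assms(1,2)])
    show "(H k has_real_derivative H (Suc k) (f x)) (at (f x))" if "x \<in> S" for k x
      unfolding H_def using assms(3)[OF that]
      by (auto intro!: derivative_eq_intros simp: algebra_simps)
  qed
  then show ?thesis by (simp add: H_def)
qed

lemma smooth_on_inverse:
  fixes f :: "'a::real_normed_vector \<Rightarrow> real"
  assumes "open S" "smooth_on S f" "\<And>x. x \<in> S \<Longrightarrow> f x \<noteq> 0"
  shows "smooth_on S (\<lambda>x. inverse (f x))"
proof -
  \<comment> \<open>The k-th derivative of 1/y, with an integer power because \<open>f\<close> may
    be negative.\<close>
  define H where "H k y = (-1) ^ k * fact k * y powi (- int k - 1)" for k and y :: real
  have "smooth_on S (\<lambda>x. H 0 (f x))"
  proof (rule smooth_on_compose_real[OF assms(1,2)])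
    show "(H k has_real_derivative H (Suc k) (f x)) (at (f x))" if "x \<in> S" for k x
      unfolding H_def using assms(3)[OF that]
      by (auto intro!: derivative_eq_intros simp: algebra_simps)
  qed
  then show ?thesis by (simp add: H_def power_int_minus)
qed

lemma smooth_on_divide:
  fixes f g :: "'a::real_normed_vector \<Rightarrow> real"
  assumes "open S" "smooth_on S f" "smooth_on S g" "\<And>x. x \<in> S \<Longrightarrow> g x \<noteq> 0"
  shows "smooth_on S (\<lambda>x. f x / g x)"
  using smooth_on_mult[OF assms(1,2) smooth_on_inverse[OF assms(1,3,4)]] by (simp add: divide_inverse)

text \<open>The inner derivative is the constant L, so the induction needs no products. The intended
  inner map is the time slice that sends x to (t, x).\<close>

lemma smooth_on_affine_compose:
  fixes L :: "'a::real_normed_vector \<Rightarrow> 'b::real_normed_vector" and f :: "'b \<Rightarrow> 'c::real_normed_vector"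
  assumes "open S'" "bounded_linear L" "smooth_on S f" "\<And>x. x \<in> S' \<Longrightarrow> c + L x \<in> S"
  shows "smooth_on S' (\<lambda>x. f (c + L x))"
    and "x \<in> S' \<Longrightarrow> dir w (\<lambda>x. f (c + L x)) x = dir (L w) f (c + L x)"
proof -
  have dL: "((\<lambda>x. c + L x) has_derivative L) (at x)" for x
    using bounded_linear_imp_has_derivative[OF assms(2), of "at x"] by (auto intro!: derivative_eq_intros)
  have d: "((\<lambda>x. f (c + L x)) has_derivative (\<lambda>w. dir (L w) f (c + L x))) (at x)"
    if "x \<in> S'" "\<And>x. x \<in> S \<Longrightarrow> f differentiable (at x)" for x and f :: "'b \<Rightarrow> 'c"
    by (rule has_derivative_compose[OF dL has_derivative_dir]) (use that assms(4) in blast)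
  then show "x \<in> S' \<Longrightarrow> dir w (\<lambda>x. f (c + L x)) x = dir (L w) f (c + L x)"
    using dir_eqI[OF d, of x f w] smooth_on_differentiable[OF assms(3)] by simp
  have "Ck_on k S f \<Longrightarrow> Ck_on k S' (\<lambda>x. f (c + L x))" for k
  proof (induction k arbitrary: f)
    case 0
    then have f: "continuous_on S f" by simp
    have "continuous_on S' (\<lambda>x. c + L x)"
      by (intro continuous_intros linear_continuous_on assms(2))
    from continuous_on_compose2[OF f this] show ?case using assms(4) by auto
  next
    case (Suc k)
    then have "\<forall>x\<in>S. f differentiable (at x)" "\<And>w. Ck_on k S (dir w f)"
      by (auto simp: dir_def[abs_def])
    with d[of _ f] Suc.IH show ?case
      by (intro Ck_on_SucI[OF assms(1), where f' = "\<lambda>w x. dir (L w) f (c + L x)"])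
        auto
  qed
  then show "smooth_on S' (\<lambda>x. f (c + L x))" using assms(3) by (simp add: smooth_on_def)
qed

section \<open>Symmetry of second directional derivatives\<close>

lemma has_real_derivative_along_line:
  fixes f :: "'a::real_normed_vector \<Rightarrow> real"
  assumes "f differentiable (at (x + a *\<^sub>R w))"
  shows "((\<lambda>\<tau>. f (x + \<tau> *\<^sub>R w)) has_real_derivative dir w f (x + a *\<^sub>R w)) (at a)"
proof -
  have "((\<lambda>\<tau>. x + \<tau> *\<^sub>R w) has_derivative (\<lambda>\<tau>. \<tau> *\<^sub>R w)) (at a)"
    by (auto intro!: derivative_eq_intros)
  from has_derivative_compose[OF this has_derivative_dir[OF assms]]
  have "((\<lambda>\<tau>. f (x + \<tau> *\<^sub>R w)) has_derivative (\<lambda>\<tau>. dir (\<tau> *\<^sub>R w) f (x + a *\<^sub>R w))) (at a)" .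
  moreover have "(\<lambda>\<tau>. dir (\<tau> *\<^sub>R w) f (x + a *\<^sub>R w)) = (*) (dir w f (x + a *\<^sub>R w))"
    by (rule ext) (use linear_scale[OF linear_dir[OF assms]] in simp)
  ultimately show ?thesis by (simp add: has_field_derivative_def)
qed

text \<open>The mean value theorem is applied twice: along u to the increment in direction h w, then
  along w to \<open>dir u f\<close>. The bound on \<open>y\<close> lets h tend to 0
  afterwards.\<close>

lemma second_difference_mvt:
  fixes f :: "'a::real_normed_vector \<Rightarrow> real"
  assumes "smooth_on (ball x r) f" "0 < h" "h * (norm u + norm w) < r"
  obtains y where "dist x y \<le> h * (norm u + norm w)"
    "f (x + h *\<^sub>R u + h *\<^sub>R w) - f (x + h *\<^sub>R u) - f (x + h *\<^sub>R w) + f x = h\<^sup>2 * dir w (dir u f) y"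
proof -
  have b: "dist x (x + a *\<^sub>R u + b *\<^sub>R w) \<le> h * (norm u + norm w)" if "\<bar>a\<bar> \<le> h" "\<bar>b\<bar> \<le> h" for a b
  proof -
    have "norm (a *\<^sub>R u + b *\<^sub>R w) \<le> \<bar>a\<bar> * norm u + \<bar>b\<bar> * norm w"
      by (metis norm_scaleR norm_triangle_ineq)
    also have "\<dots> \<le> h * norm u + h * norm w"
      using that by (intro add_mono mult_right_mono) auto
    finally show ?thesis
      by (metis add.assoc add_diff_cancel_left' distrib_left dist_commute dist_norm)
  qed
  then have in_ball: "x + a *\<^sub>R u + b *\<^sub>R w \<in> ball x r" if "\<bar>a\<bar> \<le> h" "\<bar>b\<bar> \<le> h" for a b
    using that assms(3) by (meson le_less_trans mem_ball)
  define g where "g a = f (x + a *\<^sub>R u + h *\<^sub>R w) - f (x + a *\<^sub>R u)" for a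
  have dg: "(g has_real_derivative
      dir u f (x + a *\<^sub>R u + h *\<^sub>R w) - dir u f (x + a *\<^sub>R u)) (at a)" if "\<bar>a\<bar> \<le> h" for a
  proof -
    have sh: "x + h *\<^sub>R w + b *\<^sub>R u = x + b *\<^sub>R u + h *\<^sub>R w" for b by (simp add: add_ac)
    have "f differentiable (at (x + a *\<^sub>R u + h *\<^sub>R w))" "f differentiable (at (x + a *\<^sub>R u))"
      using smooth_on_differentiable[OF assms(1) in_ball[of a h]]
        smooth_on_differentiable[OF assms(1) in_ball[of a 0]] that assms(2) by simp_all
    then show ?thesis unfolding g_def
      using has_real_derivative_along_line[of f "x + h *\<^sub>R w" a u, unfolded sh]
        has_real_derivative_along_line[of f x a u] by (intro DERIV_diff) auto
  qed
  obtain \<xi> where \<xi>: "0 < \<xi>" "\<xi> < h"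
    "g h - g 0 = h * (dir u f (x + \<xi> *\<^sub>R u + h *\<^sub>R w) - dir u f (x + \<xi> *\<^sub>R u))"
    using MVT2[of 0 h g "\<lambda>a. dir u f (x + a *\<^sub>R u + h *\<^sub>R w) - dir u f (x + a *\<^sub>R u)"] dg assms(2) by auto
  have dk: "((\<lambda>b. dir u f (x + \<xi> *\<^sub>R u + b *\<^sub>R w)) has_real_derivative
      dir w (dir u f) (x + \<xi> *\<^sub>R u + b *\<^sub>R w)) (at b)" if "\<bar>b\<bar> \<le> h" for b
    by (rule has_real_derivative_along_line, rule smooth_on_differentiable[OF smooth_on_dir[OF assms(1)]])
      (use in_ball \<xi> that in auto)
  obtain \<eta> where \<eta>: "0 < \<eta>" "\<eta> < h"
    "dir u f (x + \<xi> *\<^sub>R u + h *\<^sub>R w) - dir u f (x + \<xi> *\<^sub>R u + 0 *\<^sub>R w)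
       = (h - 0) * dir w (dir u f) (x + \<xi> *\<^sub>R u + \<eta> *\<^sub>R w)"
    using MVT2[of 0 h "\<lambda>b. dir u f (x + \<xi> *\<^sub>R u + b *\<^sub>R w)"
        "\<lambda>b. dir w (dir u f) (x + \<xi> *\<^sub>R u + b *\<^sub>R w)"] dk assms(2) by auto
  show thesis
  proof (rule that)
    show "dist x (x + \<xi> *\<^sub>R u + \<eta> *\<^sub>R w) \<le> h * (norm u + norm w)" using b \<xi> \<eta> by simp
    show "f (x + h *\<^sub>R u + h *\<^sub>R w) - f (x + h *\<^sub>R u) - f (x + h *\<^sub>R w) + f x
      = h\<^sup>2 * dir w (dir u f) (x + \<xi> *\<^sub>R u + \<eta> *\<^sub>R w)"
      using \<xi>(3) \<eta>(3) unfolding g_def by (simp add: power2_eq_square)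
  qed
qed

text \<open>The second difference is symmetric in u and w, so the two mixed derivatives share a
  value at points arbitrarily near x; continuity carries this to x.\<close>

lemma dir_commute:
  fixes f :: "'a::real_normed_vector \<Rightarrow> real"
  assumes "open S" "smooth_on S f" "x \<in> S"
  shows "dir u (dir w f) x = dir w (dir u f) x"
proof -
  obtain r where r: "r > 0" "ball x r \<subseteq> S" using assms openE by blast
  have sm: "smooth_on (ball x r) f" using smooth_on_subset[OF assms(2) r(2)] .
  have cont: "isCont (dir u (dir w f)) x" for u w
    using smooth_on_continuous[OF smooth_on_dir[OF smooth_on_dir[OF assms(2)]]] assms(1,3)
      continuous_on_eq_continuous_at by blast
  have "\<bar>dir u (dir w f) x - dir w (dir u f) x\<bar> \<le> e" if "e > 0" for e
  proof -
    obtain d1 where d1: "d1 > 0" "\<And>y. dist y x < d1 \<Longrightarrow> dist (dir u (dir w f) y) (dir u (dir w f) x) < e/2"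
      using cont[of u w] \<open>e > 0\<close> unfolding continuous_at_eps_delta by (meson half_gt_zero)
    obtain d2 where d2: "d2 > 0" "\<And>y. dist y x < d2 \<Longrightarrow> dist (dir w (dir u f) y) (dir w (dir u f) x) < e/2"
      using cont[of w u] \<open>e > 0\<close> unfolding continuous_at_eps_delta by (meson half_gt_zero)
    \<comment> \<open>The summand 1 keeps N positive when u = w = 0.\<close>
    define N where "N = norm u + norm w + 1"
    define d where "d = min r (min d1 d2)"
    define h where "h = d / (2 * N)"
    have N: "N > 0" by (simp add: N_def add_nonneg_pos)
    have h: "h > 0" using N d1 d2 r by (simp add: h_def d_def)
    have "h * (norm u + norm w) \<le> h * N" using h by (simp add: N_def)
    also have "\<dots> = d / 2" using N by (simp add: h_def)
    also have "\<dots> < d" using d1(1) d2(1) r(1) by (auto simp: d_def)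
    finally have hd: "h * (norm u + norm w) < d" .
    then have hr: "h * (norm u + norm w) < r" by (simp add: d_def)
    obtain y where y: "dist x y \<le> h * (norm u + norm w)"
      "f (x + h *\<^sub>R u + h *\<^sub>R w) - f (x + h *\<^sub>R u) - f (x + h *\<^sub>R w) + f x = h\<^sup>2 * dir w (dir u f) y"
      using second_difference_mvt[OF sm h hr] .
    have hr': "h * (norm w + norm u) < r" using hr by (simp add: add.commute)
    obtain z where z: "dist x z \<le> h * (norm w + norm u)"
      "f (x + h *\<^sub>R w + h *\<^sub>R u) - f (x + h *\<^sub>R w) - f (x + h *\<^sub>R u) + f x = h\<^sup>2 * dir u (dir w f) z"
      using second_difference_mvt[OF sm h hr'] .
    have "x + h *\<^sub>R u + h *\<^sub>R w = x + h *\<^sub>R w + h *\<^sub>R u" by (simp add: add_ac)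
    from arg_cong[OF this, of f] have "h\<^sup>2 * dir w (dir u f) y = h\<^sup>2 * dir u (dir w f) z"
      using y(2) z(2) by linarith
    then have "dir w (dir u f) y = dir u (dir w f) z" using h by simp
    moreover have "dist (dir u (dir w f) z) (dir u (dir w f) x) < e/2"
      using z(1) hd by (intro d1(2)) (simp add: d_def dist_commute add.commute)
    moreover have "dist (dir w (dir u f) y) (dir w (dir u f) x) < e/2"
      using y(1) hd by (intro d2(2)) (simp add: d_def dist_commute)
    ultimately show ?thesis unfolding dist_real_def by linarith
  qed
  then have "\<bar>dir u (dir w f) x - dir w (dir u f) x\<bar> \<le> 0" 
    using field_le_epsilon[of "\<bar>dir u (dir w f) x - dir w (dir u f) x\<bar>" 0] by simp
  then show ?thesis by simp
qed

section \<open>Riemannian geometry on an open subset of coordinate space\<close>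

lemma partial_eq_dir: "partial i f = dir (axis i 1) f"
  by (rule ext) (simp add: partial_def dir_def)

lemma dir_sum:
  assumes "\<And>i. i \<in> I \<Longrightarrow> f i differentiable (at x)"
  shows "dir w (\<lambda>x. \<Sum>i\<in>I. f i x) x = (\<Sum>i\<in>I. dir w (f i) x)"
  by (rule dir_eqI, rule has_derivative_sum, rule has_derivative_dir) (use assms in auto)

lemma dir_add:
  assumes "f differentiable (at x)" "g differentiable (at x)"
  shows "dir w (\<lambda>x. f x + g x) x = dir w f x + dir w g x"
  by (rule dir_eqI, rule has_derivative_add; rule has_derivative_dir) (use assms in auto)

lemma dir_diff:
  assumes "f differentiable (at x)" "g differentiable (at x)"
  shows "dir w (\<lambda>x. f x - g x) x = dir w f x - dir w g x"
  by (rule dir_eqI, rule has_derivative_diff; rule has_derivative_dir) (use assms in auto)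

lemma dir_mult:
  fixes f g :: "'a::real_normed_vector \<Rightarrow> real"
  assumes "f differentiable (at x)" "g differentiable (at x)"
  shows "dir w (\<lambda>x. f x * g x) x = dir w f x * g x + f x * dir w g x"
proof -
  have "dir w (\<lambda>x. f x * g x) x = f x * dir w g x + dir w f x * g x"
    by (rule dir_eqI, rule has_derivative_mult; rule has_derivative_dir) (use assms in auto)
  then show ?thesis by simp
qed

lemma dir_cmult:
  fixes f :: "'a::real_normed_vector \<Rightarrow> real"
  assumes "f differentiable (at x)"
  shows "dir w (\<lambda>x. c * f x) x = c * dir w f x"
  using dir_mult[of "\<lambda>x. c" x f w] assms by (simp add: dir_def)

lemma dir_compose_real:
  fixes f :: "'a::real_normed_vector \<Rightarrow> real"
  assumes "f differentiable (at x)" "(h has_real_derivative h') (at (f x))"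
  shows "dir w (\<lambda>x. h (f x)) x = h' * dir w f x"
  using dir_eqI[OF has_derivative_compose[OF has_derivative_dir[OF assms(1)]
        has_field_derivative_imp_has_derivative[OF assms(2)]]] .

lemma dir_eq_sum_partial:
  fixes f :: "real^'n::finite \<Rightarrow> real"
  assumes "f differentiable (at x)"
  shows "dir w f x = (\<Sum>i\<in>UNIV. w $ i * partial i f x)"
proof -
  have "w = (\<Sum>i\<in>UNIV. w $ i *\<^sub>R axis i 1)"
    by (metis basis_expansion scalar_mult_eq_scaleR)
  then have "dir w f x = (\<Sum>i\<in>UNIV. dir (w $ i *\<^sub>R axis i 1) f x)"
    using linear_sum[OF linear_dir[OF assms]] by metis
  also have "\<dots> = (\<Sum>i\<in>UNIV. w $ i * partial i f x)"
    using linear_scale[OF linear_dir[OF assms]] by (simp add: partial_eq_dir)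
  finally show ?thesis .
qed

section \<open>Smooth dependence of the inverse matrix\<close>

lemma smooth_on_det:
  fixes B :: "'a::real_normed_vector \<Rightarrow> real^'n::finite^'n"
  assumes "open S" "\<And>i j. smooth_on S (\<lambda>x. B x $ i $ j)"
  shows "smooth_on S (\<lambda>x. det (B x))"
  unfolding det_def
  by (intro smooth_on_sum smooth_on_mult smooth_on_prod smooth_on_const assms)

lemma matrix_inv_inverse:
  fixes B :: "real^'n::finite^'n"
  assumes "invertible B"
  shows "B ** matrix_inv B = mat 1" and "matrix_inv B ** B = mat 1"
  using someI_ex[OF assms[unfolded invertible_def]] unfolding matrix_inv_def by auto

text \<open>Column l of the inverse solves B y = \<open>axis l 1\<close>. As a quotient of
  determinants it depends smoothly on the entries of B.\<close>

lemma matrix_inv_cramer: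
  fixes B :: "real^'n::finite^'n"
  assumes "det B \<noteq> 0"
  shows "matrix_inv B $ k $ l = det (\<chi> i j. if j = k then axis l 1 $ i else B $ i $ j) / det B"
proof -
  have "invertible B" using assms invertible_det_nz by blast
  then have "B ** matrix_inv B = mat 1" by (rule matrix_inv_inverse)
  then have "B *v (matrix_inv B *v axis l 1) = axis l 1"
    by (metis matrix_vector_mul_assoc matrix_vector_mul_lid)
  then have "matrix_inv B *v axis l 1 = (\<chi> k. det (\<chi> i j. if j = k then axis l 1 $ i else B $ i $ j) / det B)"
    using cramer[OF assms] by blast
  then have "(matrix_inv B *v axis l 1) $ k = det (\<chi> i j. if j = k then axis l 1 $ i else B $ i $ j) / det B"
    by (simp only: vec_lambda_beta)
  then show ?thesis by (simp add: matrix_vector_mult_basis column_def)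
qed

lemma smooth_on_matrix_inv:
  fixes B :: "'a::real_normed_vector \<Rightarrow> real^'n::finite^'n"
  assumes "open S" "\<And>i j. smooth_on S (\<lambda>x. B x $ i $ j)" "\<And>x. x \<in> S \<Longrightarrow> det (B x) \<noteq> 0"
  shows "smooth_on S (\<lambda>x. matrix_inv (B x) $ k $ l)"
proof -
  have "smooth_on S (\<lambda>x. det (\<chi> i j. if j = k then axis l 1 $ i else B x $ i $ j) / det (B x))"
  proof (intro smooth_on_divide smooth_on_det assms(1,3))
    fix i j show "smooth_on S (\<lambda>x. (\<chi> i j. if j = k then axis l 1 $ i else B x $ i $ j) $ i $ j)"
      using assms(2) by (cases "j = k") auto
  qed (use assms in auto)
  then show ?thesis
    by (rule smooth_on_cong[OF assms(1), rotated]) (simp only: matrix_inv_cramer assms(3) not_False_eq_True)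
qed

locale local_metric =
  fixes U :: "(real^'n::finite) set" and G :: "real^'n \<Rightarrow> real^'n^'n"
  assumes open_U: "open U" and smooth_G: "smooth_on U G"
    and sym: "x \<in> U \<Longrightarrow> transpose (G x) = G x"
    and pos: "x \<in> U \<Longrightarrow> \<xi> \<noteq> 0 \<Longrightarrow> \<xi> \<bullet> (G x *v \<xi>) > 0"
begin

abbreviation ginv :: "'n \<Rightarrow> 'n \<Rightarrow> real^'n \<Rightarrow> real" where
  "ginv k l x \<equiv> matrix_inv (G x) $ k $ l"

abbreviation Gam :: "'n \<Rightarrow> 'n \<Rightarrow> 'n \<Rightarrow> real^'n \<Rightarrow> real" where
  "Gam \<equiv> christoffel G"

text \<open>In index notation, \<open>shape f k j\<close> is \<open>\<nabla>\<^sub>j \<nabla>\<^sup>k f\<close>.\<close>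

definition shape :: "(real^'n \<Rightarrow> real) \<Rightarrow> 'n \<Rightarrow> 'n \<Rightarrow> real^'n \<Rightarrow> real" where
  "shape f k j x = (\<Sum>l\<in>UNIV. ginv k l x * hess G l j f x)"

definition lap :: "(real^'n \<Rightarrow> real) \<Rightarrow> real^'n \<Rightarrow> real" where
  "lap f x = (\<Sum>k\<in>UNIV. shape f k k x)"

lemma sm_diff: "smooth_on U f \<Longrightarrow> x \<in> U \<Longrightarrow> f differentiable (at x)"
  using smooth_on_differentiable .

lemma smooth_G_entry: "smooth_on U (\<lambda>x. G x $ i $ j)"
  using smooth_on_bounded_linear[OF open_U bounded_linear_compose[OF bounded_linear_vec_nth bounded_linear_vec_nth] smooth_G] .

lemma invertible_G: "x \<in> U \<Longrightarrow> invertible (G x)"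
  unfolding invertible_left_inverse matrix_left_invertible_ker
  using pos by (metis inner_zero_right less_irrefl)

lemma smooth_ginv: "smooth_on U (ginv k l)"
  using smooth_on_matrix_inv[OF open_U smooth_G_entry] invertible_G invertible_det_nz by blast

lemma ginv_G: "x \<in> U \<Longrightarrow> matrix_inv (G x) ** G x = mat 1"
  and G_ginv: "x \<in> U \<Longrightarrow> G x ** matrix_inv (G x) = mat 1"
  using invertible_G matrix_inv_inverse by blast+

lemma transpose_ginv: "x \<in> U \<Longrightarrow> transpose (matrix_inv (G x)) = matrix_inv (G x)"
proof -
  assume x: "x \<in> U"
  let ?I = "matrix_inv (G x)"
  have "transpose ?I = transpose ?I ** (G x ** ?I)" by (simp add: G_ginv[OF x])
  also have "\<dots> = transpose (G x ** ?I) ** ?I" using sym[OF x] by (simp add: matrix_transpose_mul matrix_mul_assoc)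
  also have "\<dots> = ?I" by (simp add: G_ginv[OF x] transpose_mat)
  finally show ?thesis .
qed

lemma ginv_commute: "x \<in> U \<Longrightarrow> ginv k l x = ginv l k x"
  using arg_cong[OF transpose_ginv[of x], of "\<lambda>B. B $ l $ k"] by (simp add: transpose_def)

lemma G_commute: "x \<in> U \<Longrightarrow> G x $ k $ l = G x $ l $ k"
  using arg_cong[OF sym[of x], of "\<lambda>B. B $ l $ k"] by (simp add: transpose_def)

lemma smooth_partial: "smooth_on U f \<Longrightarrow> smooth_on U (partial i f)"
  by (simp add: partial_eq_dir smooth_on_dir)

lemma smooth_Gam: "smooth_on U (Gam k i j)"
  unfolding christoffel_def[abs_def]
  by (intro smooth_on_mult[OF open_U] smooth_on_sum[OF open_U] smooth_on_add[OF open_U]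
      smooth_on_diff[OF open_U] smooth_on_const smooth_ginv smooth_partial smooth_G_entry)

lemma smooth_hess: "smooth_on U f \<Longrightarrow> smooth_on U (hess G i j f)"
  unfolding hess_def[abs_def]
  by (intro smooth_on_mult[OF open_U] smooth_on_sum[OF open_U]
      smooth_on_diff[OF open_U] smooth_Gam smooth_partial)

lemma smooth_shape: "smooth_on U f \<Longrightarrow> smooth_on U (shape f i j)"
  unfolding shape_def[abs_def]
  by (intro smooth_on_mult[OF open_U] smooth_on_sum[OF open_U] smooth_hess smooth_ginv)

lemma smooth_lap: "smooth_on U f \<Longrightarrow> smooth_on U (lap f)"
  unfolding lap_def[abs_def] by (intro smooth_on_sum[OF open_U] smooth_shape)

lemma grad_nth: "grad G f x $ k = (\<Sum>l\<in>UNIV. ginv k l x * partial l f x)"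
  by (simp add: grad_def)

lemma smooth_grad: "smooth_on U f \<Longrightarrow> smooth_on U (\<lambda>x. grad G f x $ k)"
  unfolding grad_nth by (intro smooth_on_mult[OF open_U] smooth_on_sum[OF open_U] smooth_partial smooth_ginv)

section \<open>The Levi-Civita connection in coordinates\<close>

lemma Gam_commute: "x \<in> U \<Longrightarrow> Gam k i j x = Gam k j i x"
proof -
  assume x: "x \<in> U"
  have "partial l (\<lambda>y. G y $ i $ j) x = partial l (\<lambda>y. G y $ j $ i) x" for l
    unfolding partial_eq_dir by (rule dir_cong_open[OF open_U x]) (rule G_commute)
  then show ?thesis unfolding christoffel_def by (simp add: algebra_simps)
qed

lemma partial_commute: "smooth_on U f \<Longrightarrow> x \<in> U \<Longrightarrow> partial i (partial j f) x = partial j (partial i f) x"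
  unfolding partial_eq_dir by (rule dir_commute[OF open_U])

lemma hess_commute: "smooth_on U f \<Longrightarrow> x \<in> U \<Longrightarrow> hess G i j f x = hess G j i f x"
  using partial_commute[of f x i j] Gam_commute[of x _ i j] by (simp add: hess_def)

text \<open>Contraction with G undoes the inverse matrix in the definition and leaves the
  Christoffel symbols of the first kind.\<close>

lemma lower_Gam:
  assumes "x \<in> U"
  shows "(\<Sum>k\<in>UNIV. G x $ m $ k * Gam k i j x) =
    (partial i (\<lambda>y. G y $ j $ m) x + partial j (\<lambda>y. G y $ i $ m) x - partial m (\<lambda>y. G y $ i $ j) x) / 2"
proof -
  define T where "T = (\<chi> l. partial i (\<lambda>y. G y $ j $ l) x + partial j (\<lambda>y. G y $ i $ l) x - partial l (\<lambda>y. G y $ i $ j) x)"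
  have "(\<chi> k. Gam k i j x) = (1/2) *\<^sub>R (matrix_inv (G x) *v T)"
    by (simp add: vec_eq_iff christoffel_def matrix_vector_mult_def T_def)
  then have "G x *v (\<chi> k. Gam k i j x) = (1/2) *\<^sub>R (G x *v (matrix_inv (G x) *v T))"
    by (simp add: matrix_vector_mult_scaleR)
  also have "\<dots> = (1/2) *\<^sub>R T"
    using G_ginv[OF assms] by (simp add: matrix_vector_mul_assoc)
  finally have "(G x *v (\<chi> k. Gam k i j x)) $ m = ((1/2) *\<^sub>R T) $ m" by simp
  then show ?thesis by (simp add: matrix_vector_mult_def T_def)
qed

text \<open>Metric compatibility, \<nabla>G = 0: in the sum of two symbols of the first kind all but
  one derivative of G cancel.\<close>

lemma partial_G:
  assumes "x \<in> U"
  shows "partial m (\<lambda>y. G y $ i $ j) x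
    = (\<Sum>k\<in>UNIV. Gam k m i x * G x $ k $ j) + (\<Sum>k\<in>UNIV. G x $ i $ k * Gam k m j x)"
proof -
  have *: "partial l (\<lambda>y. G y $ a $ b) x = partial l (\<lambda>y. G y $ b $ a) x" for a b l
    unfolding partial_eq_dir by (rule dir_cong_open[OF open_U assms]) (rule G_commute)
  have "(\<Sum>k\<in>UNIV. Gam k m i x * G x $ k $ j) = (\<Sum>k\<in>UNIV. G x $ j $ k * Gam k m i x)"
    using G_commute[OF assms] by (simp add: mult.commute)
  then show ?thesis unfolding lower_Gam[OF assms]
    using *[of m i j] *[of i m j] *[of j m i] by (simp add: field_simps)
qed

text \<open>Compatibility for the inverse metric, from differentiating
  \<open>matrix_inv (G x) ** G x = mat 1\<close>. With P and N the derivatives of the inverse and of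
  G, this gives P = - inverse * N * inverse, and \<open>partial_G\<close> supplies N.\<close>

lemma partial_ginv:
  assumes x: "x \<in> U"
  shows "partial m (ginv k l) x
    = - (\<Sum>b\<in>UNIV. ginv k b x * Gam l m b x) - (\<Sum>b\<in>UNIV. Gam k m b x * ginv b l x)"
proof -
  define P where "P = (\<chi> k l. partial m (ginv k l) x)"
  define N where "N = (\<chi> k l. partial m (\<lambda>y. G y $ k $ l) x)"
  define \<Theta> where "\<Theta> = (\<chi> k i. Gam k m i x)"
  let ?I = "matrix_inv (G x)"
  have N: "N = transpose \<Theta> ** G x + G x ** \<Theta>"
    using partial_G[OF x, of m] by (simp add: vec_eq_iff N_def \<Theta>_def matrix_matrix_mult_def transpose_def)
  have "(P ** G x + ?I ** N) $ a $ c = 0" for a c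
  proof -
    have "(P ** G x + ?I ** N) $ a $ c
      = (\<Sum>b\<in>UNIV. dir (axis m 1) (ginv a b) x * G x $ b $ c + ginv a b x * dir (axis m 1) (\<lambda>y. G y $ b $ c) x)"
      by (simp add: matrix_matrix_mult_def P_def N_def sum.distrib partial_eq_dir)
    also have "\<dots> = dir (axis m 1) (\<lambda>y. \<Sum>b\<in>UNIV. ginv a b y * G y $ b $ c) x"
      by (subst dir_sum)
        (auto intro!: sm_diff[OF _ x] smooth_on_mult[OF open_U] smooth_ginv smooth_G_entry
          simp: dir_mult sm_diff[OF smooth_ginv x] sm_diff[OF smooth_G_entry x])
    also have "\<dots> = dir (axis m 1) (\<lambda>y. (mat 1 :: real^'n^'n) $ a $ c) x"
    proof (rule dir_cong_open[OF open_U x])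
      fix y assume "y \<in> U"
      then have "(matrix_inv (G y) ** G y) $ a $ c = (mat 1 :: real^'n^'n) $ a $ c"
        by (simp add: ginv_G)
      then show "(\<Sum>b\<in>UNIV. ginv a b y * G y $ b $ c) = (mat 1 :: real^'n^'n) $ a $ c"
        by (simp add: matrix_matrix_mult_def)
    qed
    finally show ?thesis by (simp add: dir_def)
  qed
  then have "P ** G x + ?I ** N = 0" by (simp add: vec_eq_iff)
  then have "P ** G x = - (?I ** N)" by (simp add: eq_neg_iff_add_eq_0)
  then have "P ** G x ** ?I = - (?I ** N ** ?I)"
    by (simp add: vec_eq_iff matrix_matrix_mult_def sum_negf)
  moreover have "P ** G x ** ?I = P"
    by (simp add: matrix_mul_assoc[symmetric] G_ginv[OF x])
  moreover have "?I ** N ** ?I = ?I ** transpose \<Theta> ** (G x ** ?I) + (?I ** G x) ** \<Theta> ** ?I"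
    by (simp add: N matrix_add_ldistrib matrix_mul_assoc)
      (simp add: vec_eq_iff matrix_matrix_mult_def distrib_right sum.distrib)
  ultimately have "P = - (?I ** transpose \<Theta> + \<Theta> ** ?I)"
    using G_ginv[OF x] ginv_G[OF x] by simp
  then have "P $ k $ l = (- (?I ** transpose \<Theta> + \<Theta> ** ?I)) $ k $ l" by simp
  then show ?thesis by (simp add: P_def \<Theta>_def matrix_matrix_mult_def transpose_def)
qed

lemma partial_partial: "partial j (partial l f) x = hess G j l f x + (\<Sum>m\<in>UNIV. Gam m j l x * partial m f x)"
  by (simp add: hess_def)

text \<open>The covariant derivative of the vector field \<nabla>f is the Hessian with one index
  raised. The Christoffel term of the Hessian cancels against one of the two terms of
  \<open>partial_ginv\<close>; the other one remains.\<close>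

lemma partial_grad:
  assumes f: "smooth_on U f" and x: "x \<in> U"
  shows "partial j (\<lambda>x. grad G f x $ k) x = shape f k j x - (\<Sum>m\<in>UNIV. Gam k j m x * grad G f x $ m)"
proof -
  note d = sm_diff[OF smooth_ginv x] sm_diff[OF smooth_partial[OF f] x]
    sm_diff[OF smooth_on_mult[OF open_U smooth_ginv smooth_partial[OF f]] x]
  have "partial j (\<lambda>x. grad G f x $ k) x
    = (\<Sum>l\<in>UNIV. partial j (ginv k l) x * partial l f x + ginv k l x * partial j (partial l f) x)"
    unfolding grad_nth partial_eq_dir[of j] by (simp add: dir_sum dir_mult d)
  also have "\<dots> = (\<Sum>l\<in>UNIV. - (\<Sum>b\<in>UNIV. ginv k b x * Gam l j b x * partial l f x)
      - (\<Sum>b\<in>UNIV. Gam k j b x * (ginv b l x * partial l f x))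
      + ginv k l x * hess G l j f x + (\<Sum>m\<in>UNIV. ginv k l x * Gam m j l x * partial m f x))"
    unfolding partial_ginv[OF x] partial_partial hess_commute[OF f x, of j]
    by (rule sum.cong) (simp_all add: algebra_simps sum_distrib_left)
  also have "\<dots> = - (\<Sum>l\<in>UNIV. \<Sum>b\<in>UNIV. ginv k b x * Gam l j b x * partial l f x)
      - (\<Sum>l\<in>UNIV. \<Sum>b\<in>UNIV. Gam k j b x * (ginv b l x * partial l f x))
      + shape f k j x + (\<Sum>l\<in>UNIV. \<Sum>m\<in>UNIV. ginv k l x * Gam m j l x * partial m f x)"
    by (simp add: sum.distrib sum_subtractf sum_negf shape_def)
  also have "(\<Sum>l\<in>UNIV. \<Sum>b\<in>UNIV. ginv k b x * Gam l j b x * partial l f x)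
      = (\<Sum>l\<in>UNIV. \<Sum>m\<in>UNIV. ginv k l x * Gam m j l x * partial m f x)"
    by (rule sum.swap)
  also have "(\<Sum>l\<in>UNIV. \<Sum>b\<in>UNIV. Gam k j b x * (ginv b l x * partial l f x))
      = (\<Sum>m\<in>UNIV. Gam k j m x * grad G f x $ m)"
    by (subst sum.swap) (simp add: grad_nth sum_distrib_left)
  finally show ?thesis by simp
qed

lemma shape_eq:
  assumes f: "smooth_on U f" and x: "x \<in> U"
  shows "shape f k j x = partial j (\<lambda>x. grad G f x $ k) x + (\<Sum>m\<in>UNIV. Gam k j m x * grad G f x $ m)"
  using partial_grad[OF assms] by simp

lemma lap_eq_div:
  assumes f: "smooth_on U f" and x: "x \<in> U"
  shows "lap f x = (\<Sum>k\<in>UNIV. partial k (\<lambda>x. grad G f x $ k) x) + (\<Sum>k\<in>UNIV. \<Sum>m\<in>UNIV. Gam k k m x * grad G f x $ m)"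
  by (simp add: lap_def shape_eq[OF assms] sum.distrib)

lemma G_grad: "x \<in> U \<Longrightarrow> G x *v grad G f x = (\<chi> i. partial i f x)"
proof -
  assume x: "x \<in> U"
  have "grad G f x = matrix_inv (G x) *v (\<chi> i. partial i f x)"
    by (simp add: grad_def matrix_vector_mult_def)
  then show ?thesis using G_ginv[OF x] by (simp add: matrix_vector_mul_assoc)
qed

lemma grad_sq_eq: "x \<in> U \<Longrightarrow> grad_sq G f x = (\<Sum>k\<in>UNIV. grad G f x $ k * partial k f x)"
  by (simp add: grad_sq_def G_grad inner_vec_def)

lemma smooth_grad_sq: "smooth_on U f \<Longrightarrow> smooth_on U (grad_sq G f)"
  by (rule smooth_on_cong[OF open_U, of "\<lambda>x. \<Sum>k\<in>UNIV. grad G f x $ k * partial k f x"])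
    (auto simp: grad_sq_eq intro!: smooth_on_sum[OF open_U] smooth_on_mult[OF open_U] smooth_grad smooth_partial)

text \<open>Symmetry of the inverse metric: the covector a is raised on one side, df on the
  other.\<close>

lemma sum_grad_mult_swap:
  assumes x: "x \<in> U"
  shows "(\<Sum>k\<in>UNIV. (\<Sum>l\<in>UNIV. ginv k l x * a l) * partial k f x) = (\<Sum>l\<in>UNIV. grad G f x $ l * a l)"
proof -
  have "(\<Sum>k\<in>UNIV. (\<Sum>l\<in>UNIV. ginv k l x * a l) * partial k f x)
      = (\<Sum>k\<in>UNIV. \<Sum>l\<in>UNIV. ginv l k x * partial k f x * a l)"
    by (simp add: sum_distrib_left ginv_commute[OF x, of _ k for k] mult_ac)
  also have "\<dots> = (\<Sum>l\<in>UNIV. grad G f x $ l * a l)"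
    by (subst sum.swap) (simp add: grad_nth sum_distrib_right)
  finally show ?thesis .
qed

text \<open>The product rule gives two equal Hessian terms; the Christoffel terms of the vector and
  of the covector cancel, as they must for a scalar.\<close>

lemma partial_grad_sq:
  assumes f: "smooth_on U f" and x: "x \<in> U"
  shows "partial j (grad_sq G f) x = 2 * (\<Sum>k\<in>UNIV. grad G f x $ k * hess G k j f x)"
proof -
  note d = sm_diff[OF smooth_grad[OF f] x] sm_diff[OF smooth_partial[OF f] x]
    sm_diff[OF smooth_on_mult[OF open_U smooth_grad[OF f] smooth_partial[OF f]] x]
  have "partial j (grad_sq G f) x = dir (axis j 1) (\<lambda>x. \<Sum>k\<in>UNIV. grad G f x $ k * partial k f x) x"
    unfolding partial_eq_dir by (rule dir_cong_open[OF open_U x]) (simp add: grad_sq_eq partial_eq_dir)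
  also have "\<dots> = (\<Sum>k\<in>UNIV. partial j (\<lambda>x. grad G f x $ k) x * partial k f x + grad G f x $ k * partial j (partial k f) x)"
    by (simp add: dir_sum dir_mult d partial_eq_dir[of j])
  also have "\<dots> = (\<Sum>k\<in>UNIV. shape f k j x * partial k f x)
      - (\<Sum>k\<in>UNIV. \<Sum>m\<in>UNIV. Gam k j m x * grad G f x $ m * partial k f x)
      + (\<Sum>k\<in>UNIV. grad G f x $ k * hess G k j f x)
      + (\<Sum>k\<in>UNIV. \<Sum>m\<in>UNIV. Gam m j k x * grad G f x $ k * partial m f x)"
    unfolding partial_grad[OF assms] partial_partial hess_commute[OF f x, of j]
    by (simp add: algebra_simps sum_distrib_left sum_distrib_right sum.distrib sum_subtractf)
  also have "(\<Sum>k\<in>UNIV. \<Sum>m\<in>UNIV. Gam k j m x * grad G f x $ m * partial k f x)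
      = (\<Sum>k\<in>UNIV. \<Sum>m\<in>UNIV. Gam m j k x * grad G f x $ k * partial m f x)"
    by (rule sum.swap)
  also have "(\<Sum>k\<in>UNIV. shape f k j x * partial k f x) = (\<Sum>k\<in>UNIV. grad G f x $ k * hess G k j f x)"
    unfolding shape_def by (rule sum_grad_mult_swap[OF x])
  finally show ?thesis by simp
qed

lemma grad_grad_sq:
  assumes f: "smooth_on U f" and x: "x \<in> U"
  shows "grad G (grad_sq G f) x $ k = 2 * (\<Sum>j\<in>UNIV. shape f k j x * grad G f x $ j)"
proof -
  have "grad G (grad_sq G f) x $ k = 2 * (\<Sum>l\<in>UNIV. \<Sum>j\<in>UNIV. ginv k l x * hess G l j f x * grad G f x $ j)"
    unfolding grad_nth[of "grad_sq G f"] partial_grad_sq[OF assms] hess_commute[OF f x, of _ l for l]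
    by (simp add: sum_distrib_left mult_ac)
  also have "(\<Sum>l\<in>UNIV. \<Sum>j\<in>UNIV. ginv k l x * hess G l j f x * grad G f x $ j)
      = (\<Sum>j\<in>UNIV. shape f k j x * grad G f x $ j)"
    by (subst sum.swap) (simp add: shape_def sum_distrib_right)
  finally show ?thesis .
qed

text \<open>In index notation, \<open>cov_shape f i j k\<close> is \<open>\<nabla>\<^sub>i \<nabla>\<^sub>j \<nabla>\<^sup>k f\<close>.\<close>

definition cov_shape :: "(real^'n \<Rightarrow> real) \<Rightarrow> 'n \<Rightarrow> 'n \<Rightarrow> 'n \<Rightarrow> real^'n \<Rightarrow> real" where
  "cov_shape f i j k x = partial i (shape f k j) x + (\<Sum>m\<in>UNIV. Gam k i m x * shape f m j x)
     - (\<Sum>m\<in>UNIV. Gam m i j x * shape f k m x)"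

section \<open>The Ricci identity and Bochner's formula\<close>

lemma cov_shape_expand:
  assumes f: "smooth_on U f" and x: "x \<in> U"
  shows "cov_shape f i j k x = partial i (partial j (\<lambda>x. grad G f x $ k)) x
     + (\<Sum>m\<in>UNIV. partial i (Gam k j m) x * grad G f x $ m)
     + (\<Sum>m\<in>UNIV. Gam k j m x * shape f m i x)
     - (\<Sum>l\<in>UNIV. (\<Sum>m\<in>UNIV. Gam k j m x * Gam m i l x) * grad G f x $ l)
     + (\<Sum>m\<in>UNIV. Gam k i m x * shape f m j x)
     - (\<Sum>m\<in>UNIV. Gam m i j x * shape f k m x)"
proof -
  note sg = smooth_grad[OF f]
  note d = sm_diff[OF sg x] sm_diff[OF smooth_Gam x] sm_diff[OF smooth_partial[OF sg] x]
    sm_diff[OF smooth_on_mult[OF open_U smooth_Gam sg] x]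
    sm_diff[OF smooth_on_sum[OF open_U smooth_on_mult[OF open_U smooth_Gam sg]] x]
  have "partial i (shape f k j) x
      = partial i (\<lambda>x. partial j (\<lambda>x. grad G f x $ k) x + (\<Sum>m\<in>UNIV. Gam k j m x * grad G f x $ m)) x"
    unfolding partial_eq_dir[of i] by (rule dir_cong_open[OF open_U x]) (rule shape_eq[OF f])
  also have "\<dots> = partial i (partial j (\<lambda>x. grad G f x $ k)) x
      + (\<Sum>m\<in>UNIV. partial i (Gam k j m) x * grad G f x $ m + Gam k j m x * partial i (\<lambda>x. grad G f x $ m) x)"
    unfolding partial_eq_dir[of i] by (simp add: dir_add dir_sum dir_mult d)
  also have "(\<Sum>m\<in>UNIV. partial i (Gam k j m) x * grad G f x $ m + Gam k j m x * partial i (\<lambda>x. grad G f x $ m) x)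
      = (\<Sum>m\<in>UNIV. partial i (Gam k j m) x * grad G f x $ m) + (\<Sum>m\<in>UNIV. Gam k j m x * shape f m i x)
       - (\<Sum>m\<in>UNIV. \<Sum>l\<in>UNIV. Gam k j m x * Gam m i l x * grad G f x $ l)"
    unfolding partial_grad[OF assms] by (simp add: algebra_simps sum_distrib_left sum.distrib sum_subtractf)
  also have "(\<Sum>m\<in>UNIV. \<Sum>l\<in>UNIV. Gam k j m x * Gam m i l x * grad G f x $ l)
      = (\<Sum>l\<in>UNIV. (\<Sum>m\<in>UNIV. Gam k j m x * Gam m i l x) * grad G f x $ l)"
    by (subst sum.swap) (simp add: sum_distrib_right)
  finally show ?thesis unfolding cov_shape_def by simp
qed

text \<open>In the expansion the second derivatives of \<nabla>f are symmetric in i and j, the two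
  products of \<open>Gam k\<close> with \<open>shape\<close> trade places, and the last sum is
  symmetric because the connection is torsion-free. The remaining terms in \<partial>\<Gamma> and
  \<Gamma>\<Gamma> are the curvature.\<close>

lemma ricci_identity:
  assumes f: "smooth_on U f" and x: "x \<in> U"
  shows "cov_shape f i j k x - cov_shape f j i k x = (\<Sum>l\<in>UNIV. riemann G k l i j x * grad G f x $ l)"
proof -
  have "(\<Sum>l\<in>UNIV. riemann G k l i j x * grad G f x $ l) =
      (\<Sum>m\<in>UNIV. partial i (Gam k j m) x * grad G f x $ m) - (\<Sum>m\<in>UNIV. partial j (Gam k i m) x * grad G f x $ m)
      + (\<Sum>l\<in>UNIV. (\<Sum>m\<in>UNIV. Gam k i m x * Gam m j l x) * grad G f x $ l)
      - (\<Sum>l\<in>UNIV. (\<Sum>m\<in>UNIV. Gam k j m x * Gam m i l x) * grad G f x $ l)"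
    unfolding riemann_def by (simp add: algebra_simps sum.distrib sum_subtractf)
  moreover have "(\<Sum>m\<in>UNIV. Gam m i j x * shape f k m x) = (\<Sum>m\<in>UNIV. Gam m j i x * shape f k m x)"
    using Gam_commute[OF x, of _ i j] by simp
  ultimately show ?thesis unfolding cov_shape_expand[OF assms]
    using partial_commute[OF smooth_grad[OF f] x, of i j] by simp
qed

text \<open>Commuting the two outer derivatives puts the trace on the Hessian itself, where it
  yields \<Delta>f; the price is the contracted curvature, which is Ric.\<close>

lemma div_shape:
  assumes f: "smooth_on U f" and x: "x \<in> U"
  shows "(\<Sum>k\<in>UNIV. cov_shape f k j k x) = partial j (lap f) x + (\<Sum>l\<in>UNIV. ricci G j l x * grad G f x $ l)"
proof -
  have "(\<Sum>k\<in>UNIV. cov_shape f k j k x)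
      = (\<Sum>k\<in>UNIV. cov_shape f j k k x) + (\<Sum>k\<in>UNIV. \<Sum>l\<in>UNIV. riemann G k l k j x * grad G f x $ l)"
    using ricci_identity[OF assms, of _ j] by (simp add: sum.distrib[symmetric] algebra_simps)
  also have "(\<Sum>k\<in>UNIV. \<Sum>l\<in>UNIV. riemann G k l k j x * grad G f x $ l) = (\<Sum>l\<in>UNIV. ricci G j l x * grad G f x $ l)"
    by (subst sum.swap) (simp add: ricci_def sum_distrib_right)
  also have "(\<Sum>k\<in>UNIV. cov_shape f j k k x) = (\<Sum>k\<in>UNIV. partial j (shape f k k) x)
      + (\<Sum>k\<in>UNIV. \<Sum>m\<in>UNIV. Gam k j m x * shape f m k x) - (\<Sum>k\<in>UNIV. \<Sum>m\<in>UNIV. Gam m j k x * shape f k m x)"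
    by (simp add: cov_shape_def sum.distrib sum_subtractf)
  also have "(\<Sum>k\<in>UNIV. \<Sum>m\<in>UNIV. Gam k j m x * shape f m k x) = (\<Sum>k\<in>UNIV. \<Sum>m\<in>UNIV. Gam m j k x * shape f k m x)"
    by (rule sum.swap)
  also have "(\<Sum>k\<in>UNIV. partial j (shape f k k) x) = partial j (lap f) x"
    unfolding lap_def[abs_def] partial_eq_dir
    by (rule dir_sum[symmetric]) (rule sm_diff[OF smooth_shape[OF f] x])
  finally show ?thesis by simp
qed

text \<open>The divergence of \<nabla>s = 2 A \<nabla>f with A = \<open>shape f\<close>:
  differentiating A gives \<open>div_shape\<close>, differentiating \<nabla>f gives trace(A A) =
  |\<nabla>^2 f|^2. Normal coordinates are avoided; the Christoffel terms cancel explicitly.\<close>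

lemma bochner:
  assumes f: "smooth_on U f" and x: "x \<in> U"
  shows "lap (grad_sq G f) x = 2 * (\<Sum>k\<in>UNIV. \<Sum>j\<in>UNIV. shape f k j x * shape f j k x)
     + 2 * (\<Sum>j\<in>UNIV. grad G f x $ j * partial j (lap f) x)
     + 2 * (\<Sum>j\<in>UNIV. \<Sum>l\<in>UNIV. ricci G j l x * grad G f x $ j * grad G f x $ l)"
proof -
  let ?X = "\<lambda>k x. grad G f x $ k" and ?A = "shape f"
  note d = sm_diff[OF smooth_grad[OF f] x] sm_diff[OF smooth_shape[OF f] x]
    sm_diff[OF smooth_on_mult[OF open_U smooth_shape[OF f] smooth_grad[OF f]] x]
    sm_diff[OF smooth_on_sum[OF open_U smooth_on_mult[OF open_U smooth_shape[OF f] smooth_grad[OF f]]] x]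
  have dY: "partial k (\<lambda>x. grad G (grad_sq G f) x $ k) x
      = 2 * (\<Sum>j\<in>UNIV. partial k (?A k j) x * ?X j x + ?A k j x * partial k (?X j) x)" for k
  proof -
    have "partial k (\<lambda>x. grad G (grad_sq G f) x $ k) x = partial k (\<lambda>x. 2 * (\<Sum>j\<in>UNIV. ?A k j x * ?X j x)) x"
      unfolding partial_eq_dir[of k] by (rule dir_cong_open[OF open_U x]) (rule grad_grad_sq[OF f])
    also have "\<dots> = 2 * (\<Sum>j\<in>UNIV. partial k (?A k j) x * ?X j x + ?A k j x * partial k (?X j) x)"
      unfolding partial_eq_dir by (simp add: dir_cmult dir_sum dir_mult d)
    finally show ?thesis .
  qed
  have pA: "partial k (?A k j) x = cov_shape f k j k x - (\<Sum>m\<in>UNIV. Gam k k m x * ?A m j x)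
      + (\<Sum>m\<in>UNIV. Gam m k j x * ?A k m x)" for k j
    by (simp add: cov_shape_def)
  have "(\<Sum>k\<in>UNIV. \<Sum>j\<in>UNIV. partial k (?A k j) x * ?X j x + ?A k j x * partial k (?X j) x)
      = (\<Sum>k\<in>UNIV. \<Sum>j\<in>UNIV. cov_shape f k j k x * ?X j x)
      - (\<Sum>k\<in>UNIV. \<Sum>j\<in>UNIV. \<Sum>m\<in>UNIV. Gam k k m x * ?A m j x * ?X j x)
      + (\<Sum>k\<in>UNIV. \<Sum>j\<in>UNIV. \<Sum>m\<in>UNIV. Gam m k j x * ?A k m x * ?X j x)
      + (\<Sum>k\<in>UNIV. \<Sum>j\<in>UNIV. ?A k j x * ?A j k x)
      - (\<Sum>k\<in>UNIV. \<Sum>j\<in>UNIV. \<Sum>m\<in>UNIV. Gam j k m x * ?A k j x * ?X m x)"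
    unfolding partial_grad[OF assms] pA
    by (simp add: algebra_simps sum_distrib_left sum.distrib sum_subtractf)
  also have "(\<Sum>k\<in>UNIV. \<Sum>j\<in>UNIV. \<Sum>m\<in>UNIV. Gam m k j x * ?A k m x * ?X j x)
      = (\<Sum>k\<in>UNIV. \<Sum>j\<in>UNIV. \<Sum>m\<in>UNIV. Gam j k m x * ?A k j x * ?X m x)"
    by (rule sum.cong[OF refl], rule sum.swap)
  finally have 1: "(\<Sum>k\<in>UNIV. \<Sum>j\<in>UNIV. partial k (?A k j) x * ?X j x + ?A k j x * partial k (?X j) x)
      = (\<Sum>k\<in>UNIV. \<Sum>j\<in>UNIV. cov_shape f k j k x * ?X j x)
      - (\<Sum>k\<in>UNIV. \<Sum>j\<in>UNIV. \<Sum>m\<in>UNIV. Gam k k m x * ?A m j x * ?X j x)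
      + (\<Sum>k\<in>UNIV. \<Sum>j\<in>UNIV. ?A k j x * ?A j k x)" by simp
  \<comment> \<open>The Christoffel part of the divergence of \<nabla>s; it cancels the trace of
    \<Gamma> left over in fact 1.\<close>
  have 2: "(\<Sum>k\<in>UNIV. \<Sum>m\<in>UNIV. Gam k k m x * grad G (grad_sq G f) x $ m)
      = 2 * (\<Sum>k\<in>UNIV. \<Sum>j\<in>UNIV. \<Sum>m\<in>UNIV. Gam k k m x * ?A m j x * ?X j x)"
    unfolding grad_grad_sq[OF assms] sum.swap[of "\<lambda>j m. Gam k k m x * ?A m j x * ?X j x" for k]
    by (simp add: sum_distrib_left mult_ac)
  have "(\<Sum>k\<in>UNIV. \<Sum>j\<in>UNIV. cov_shape f k j k x * ?X j x) = (\<Sum>j\<in>UNIV. (\<Sum>k\<in>UNIV. cov_shape f k j k x) * ?X j x)"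
    by (subst sum.swap) (simp add: sum_distrib_right)
  also have "\<dots> = (\<Sum>j\<in>UNIV. grad G f x $ j * partial j (lap f) x)
     + (\<Sum>j\<in>UNIV. \<Sum>l\<in>UNIV. ricci G j l x * grad G f x $ j * grad G f x $ l)"
    unfolding div_shape[OF assms] by (simp add: algebra_simps sum.distrib sum_distrib_left sum_distrib_right)
  finally have 3: "(\<Sum>k\<in>UNIV. \<Sum>j\<in>UNIV. cov_shape f k j k x * ?X j x) = \<dots>" .
  have "lap (grad_sq G f) x = 2 * (\<Sum>k\<in>UNIV. \<Sum>j\<in>UNIV. partial k (?A k j) x * ?X j x + ?A k j x * partial k (?X j) x)
     + (\<Sum>k\<in>UNIV. \<Sum>m\<in>UNIV. Gam k k m x * grad G (grad_sq G f) x $ m)"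
    unfolding lap_eq_div[OF smooth_grad_sq[OF f] x] dY by (simp add: sum_distrib_left)
  then show ?thesis unfolding 1 2 3 by simp
qed

text \<open>The pairing of \<nabla>f and \<nabla>s, that is twice the Hessian of f on (\<nabla>f,
  \<nabla>f), hence the nonlinear part of L up to a factor.\<close>

definition speed :: "(real^'n \<Rightarrow> real) \<Rightarrow> real^'n \<Rightarrow> real" where
  "speed f x = (\<Sum>i\<in>UNIV. grad G f x $ i * partial i (grad_sq G f) x)"

lemma smooth_speed: "smooth_on U f \<Longrightarrow> smooth_on U (speed f)"
  unfolding speed_def[abs_def]
  by (intro smooth_on_sum[OF open_U] smooth_on_mult[OF open_U] smooth_grad smooth_partial smooth_grad_sq)

lemma speed_eq_hess:
  assumes f: "smooth_on U f" and x: "x \<in> U"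
  shows "speed f x = 2 * (\<Sum>i\<in>UNIV. \<Sum>j\<in>UNIV. grad G f x $ i * grad G f x $ j * hess G i j f x)"
  unfolding speed_def partial_grad_sq[OF assms] hess_commute[OF f x, of _ i for i]
  by (simp add: sum_distrib_left mult_ac)

text \<open>Differentiating the pairing of \<nabla>f and \<nabla>s along \<nabla>f also hits the
  first factor, and the covariant derivative of \<nabla>f along itself is \<nabla>s/2.\<close>

lemma hess_grad_sq_grad_grad:
  assumes f: "smooth_on U f" and x: "x \<in> U"
  shows "(\<Sum>i\<in>UNIV. \<Sum>j\<in>UNIV. grad G f x $ i * grad G f x $ j * hess G i j (grad_sq G f) x)
    = (\<Sum>j\<in>UNIV. grad G f x $ j * partial j (speed f) x) - grad_sq G (grad_sq G f) x / 2"
proof -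
  let ?X = "\<lambda>k x. grad G f x $ k" and ?A = "shape f" and ?s = "grad_sq G f"
  note ss = smooth_grad_sq[OF f]
  note d = sm_diff[OF smooth_grad[OF f] x] sm_diff[OF smooth_partial[OF ss] x]
    sm_diff[OF smooth_on_mult[OF open_U smooth_grad[OF f] smooth_partial[OF ss]] x]
  have "partial j (speed f) x = (\<Sum>i\<in>UNIV. partial j (?X i) x * partial i ?s x + ?X i x * partial j (partial i ?s) x)" for j
    unfolding speed_def[abs_def] partial_eq_dir[of j] by (simp add: dir_sum dir_mult d)
  also have "\<And>j. \<dots> j = (\<Sum>i\<in>UNIV. ?A i j x * partial i ?s x)
      - (\<Sum>i\<in>UNIV. \<Sum>m\<in>UNIV. Gam i j m x * ?X m x * partial i ?s x)
      + (\<Sum>i\<in>UNIV. ?X i x * hess G i j ?s x)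
      + (\<Sum>i\<in>UNIV. \<Sum>m\<in>UNIV. Gam m j i x * ?X i x * partial m ?s x)"
    unfolding partial_grad[OF assms] partial_partial hess_commute[OF ss x, of j for j]
    by (simp add: algebra_simps sum_distrib_left sum_distrib_right sum.distrib sum_subtractf)
  finally have "partial j (speed f) x = (\<Sum>i\<in>UNIV. ?A i j x * partial i ?s x) + (\<Sum>i\<in>UNIV. ?X i x * hess G i j ?s x)" for j
    using sum.swap[of "\<lambda>i m. Gam i j m x * ?X m x * partial i ?s x" UNIV UNIV] by simp
  then have "(\<Sum>j\<in>UNIV. ?X j x * partial j (speed f) x)
      = (\<Sum>j\<in>UNIV. \<Sum>i\<in>UNIV. ?A i j x * ?X j x * partial i ?s x) + (\<Sum>j\<in>UNIV. \<Sum>i\<in>UNIV. ?X i x * ?X j x * hess G i j ?s x)"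
    by (simp add: algebra_simps sum_distrib_left sum.distrib)
  also have "(\<Sum>j\<in>UNIV. \<Sum>i\<in>UNIV. ?A i j x * ?X j x * partial i ?s x) = grad_sq G ?s x / 2"
    unfolding grad_sq_eq[OF x] grad_grad_sq[OF assms]
    by (subst sum.swap) (simp add: sum_distrib_left sum_distrib_right sum_divide_distrib mult_ac)
  also have "(\<Sum>j\<in>UNIV. \<Sum>i\<in>UNIV. ?X i x * ?X j x * hess G i j ?s x) = (\<Sum>i\<in>UNIV. \<Sum>j\<in>UNIV. ?X i x * ?X j x * hess G i j ?s x)"
    by (rule sum.swap)
  finally show ?thesis by simp
qed

lemma grad_sq_nonneg: "x \<in> U \<Longrightarrow> 0 \<le> grad_sq G f x"
  unfolding grad_sq_def using pos[of x "grad G f x"] by (cases "grad G f x = 0") auto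

lemma L_op_expand:
  "L_op p \<epsilon> G f \<phi> x = (\<Sum>i\<in>UNIV. \<Sum>j\<in>UNIV. ginv i j x * hess G i j \<phi> x) + (p - 2) / (grad_sq G f x + \<epsilon>\<^sup>2) *
      (\<Sum>i\<in>UNIV. \<Sum>j\<in>UNIV. grad G f x $ i * grad G f x $ j * hess G i j \<phi> x)"
  by (simp add: L_op_def a_coeff_def algebra_simps sum.distrib sum_distrib_left)

lemma L_op_eq:
  assumes "smooth_on U \<phi>" "x \<in> U"
  shows "L_op p \<epsilon> G f \<phi> x = lap \<phi> x + (p - 2) / (grad_sq G f x + \<epsilon>\<^sup>2) *
      (\<Sum>i\<in>UNIV. \<Sum>j\<in>UNIV. grad G f x $ i * grad G f x $ j * hess G i j \<phi> x)"
  using hess_commute[OF assms] by (simp add: L_op_expand lap_def shape_def)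

end

section \<open>The pointwise inequality\<close>

text \<open>Gram-Schmidt for the form B by induction over the set of indices treated so far; values
  of E at other indices are arbitrary.\<close>

lemma orthonormal_frame_extends:
  fixes B :: "real^'n::finite^'n"
  assumes sym: "transpose B = B" and pos: "\<And>\<xi>. \<xi> \<noteq> 0 \<Longrightarrow> \<xi> \<bullet> (B *v \<xi>) > 0"
    and e: "e \<bullet> (B *v e) = 1"
  obtains E :: "'n \<Rightarrow> real^'n" where "E i0 = e" "\<And>a b. E a \<bullet> (B *v E b) = (if a = b then 1 else 0)"
proof -
  have swap: "\<xi> \<bullet> (B *v \<eta>) = \<eta> \<bullet> (B *v \<xi>)" for \<xi> \<eta>
    by (metis dot_lmul_matrix inner_commute sym transpose_matrix_vector)
  have "\<exists>E::'n \<Rightarrow> real^'n. E i0 = e \<and>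
      (\<forall>a\<in>insert i0 S. \<forall>b\<in>insert i0 S. E a \<bullet> (B *v E b) = (if a = b then 1 else 0))" if "finite S" for S
    using that
  proof (induction S rule: finite_induct)
    case empty
    then show ?case using e by (intro exI[of _ "\<lambda>_. e"]) simp
  next
    case (insert j S)
    then obtain E :: "'n \<Rightarrow> real^'n" where E: "E i0 = e"
      "\<And>a b. a \<in> insert i0 S \<Longrightarrow> b \<in> insert i0 S \<Longrightarrow> E a \<bullet> (B *v E b) = (if a = b then 1 else 0)" by blast
    show ?case
    proof (cases "j = i0")
      case True
      then show ?thesis using E by (intro exI[of _ E]) simp
    next
      case False
      let ?T = "insert i0 S"
      have j: "j \<notin> ?T" using False insert by auto
      \<comment> \<open>Fewer than n vectors B E_a leave room for a nonzero y orthogonal to them in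
        the Euclidean sense, which means B-orthogonal to every E_a.\<close>
      have "dim ((\<lambda>a. B *v E a) ` ?T) \<le> card ((\<lambda>a. B *v E a) ` ?T)"
        by (rule dim_le_card') (use insert in auto)
      also have "\<dots> \<le> card ?T" by (rule card_image_le) (use insert in auto)
      also have "\<dots> < CARD('n)" using j by (intro psubset_card_mono) auto
      finally have "dim ((\<lambda>a. B *v E a) ` ?T) < DIM(real^'n)" by simp
      then obtain y where y: "y \<noteq> 0" "\<And>z. z \<in> span ((\<lambda>a. B *v E a) ` ?T) \<Longrightarrow> orthogonal y z"
        using orthogonal_to_subspace_exists by metis
      define r where "r = sqrt (y \<bullet> (B *v y))"
      define z where "z = (1 / r) *\<^sub>R y"
      have r: "r > 0" "r * r = y \<bullet> (B *v y)" using pos[OF y(1)] by (auto simp: r_def)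
      have zz: "z \<bullet> (B *v z) = 1"
        using r(1) by (simp add: z_def matrix_vector_mult_scaleR r(2)[symmetric])
      have zE: "z \<bullet> (B *v E a) = 0" if "a \<in> ?T" for a
        using y(2)[OF span_base[OF imageI[OF that, of "\<lambda>a. B *v E a"]]] by (simp add: z_def orthogonal_def)
      have Ez: "E a \<bullet> (B *v z) = 0" if "a \<in> ?T" for a
        using zE[OF that] swap[of "E a" z] by simp
      have "\<forall>a\<in>insert i0 (insert j S). \<forall>b\<in>insert i0 (insert j S).
          (E(j := z)) a \<bullet> (B *v (E(j := z)) b) = (if a = b then 1 else 0)"
        using E(2) zz zE Ez j by auto
      then show ?thesis using E(1) False by (intro exI[of _ "E(j := z)"]) simp
    qed
  qed
  from this[of UNIV] show thesis using that by auto
qed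

text \<open>If F has the columns E_a, orthonormality reads F^T B F = 1. A one-sided inverse of a
  square matrix is two-sided, so F F^T inverts B.\<close>

lemma matrix_inv_of_frame:
  fixes B :: "real^'n::finite^'n" and E :: "'n \<Rightarrow> real^'n"
  assumes "invertible B" and E: "\<And>a b. E a \<bullet> (B *v E b) = (if a = b then 1 else 0)"
  shows "matrix_inv B $ k $ l = (\<Sum>a\<in>UNIV. E a $ k * E a $ l)"
proof -
  define F where "F = (\<chi> k a. E a $ k)"
  have "(transpose F ** (B ** F)) $ a $ b = (mat 1 :: real^'n^'n) $ a $ b" for a b
    using E[of a b]
    by (simp add: matrix_matrix_mult_def transpose_def F_def inner_vec_def matrix_vector_mult_def mat_def)
  then have "transpose F ** B ** F = mat 1" by (simp add: vec_eq_iff matrix_mul_assoc)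
  then have "F ** (transpose F ** B) = mat 1" by (simp add: matrix_left_right_inverse)
  then have "F ** transpose F ** B ** matrix_inv B = matrix_inv B" by (simp add: matrix_mul_assoc)
  then have "F ** transpose F = matrix_inv B"
    using matrix_inv_inverse(1)[OF assms(1)] by (simp add: matrix_mul_assoc[symmetric])
  then have "matrix_inv B $ k $ l = (F ** transpose F) $ k $ l" by simp
  then show ?thesis by (simp add: matrix_matrix_mult_def transpose_def F_def)
qed

lemma (in local_metric) adapted_frame:
  assumes x: "x \<in> U"
  shows "\<exists>(E :: 'n \<Rightarrow> real^'n) i0. grad G f x = sqrt (grad_sq G f x) *\<^sub>R E i0 \<and>
    (\<forall>k l. ginv k l x = (\<Sum>a\<in>UNIV. E a $ k * E a $ l))"
proof -
  \<comment> \<open>Where the gradient vanishes any direction serves, since the factor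
    \<open>sqrt (grad_sq G f x)\<close> is 0; \<open>undefined\<close> is just some index.\<close>
  define y where "y = (if grad G f x = 0 then axis undefined 1 else grad G f x)"
  have "y \<noteq> 0" by (auto simp: y_def axis_eq_0_iff)
  then have py: "y \<bullet> (G x *v y) > 0" using pos[OF x] by blast
  define e where "e = (1 / sqrt (y \<bullet> (G x *v y))) *\<^sub>R y"
  have "e \<bullet> (G x *v e) = 1"
    using py by (simp add: e_def matrix_vector_mult_scaleR)
  then obtain E :: "'n \<Rightarrow> real^'n" where E: "E undefined = e"
    "\<And>a b. E a \<bullet> (G x *v E b) = (if a = b then 1 else 0)"
    using orthonormal_frame_extends[OF sym[OF x] pos[OF x]] by metis
  show ?thesis
  proof (intro exI conjI allI)
    show "grad G f x = sqrt (grad_sq G f x) *\<^sub>R E undefined"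
    proof (cases "grad G f x = 0")
      case True
      then show ?thesis by (simp add: grad_sq_def)
    next
      case False
      then show ?thesis using py by (simp add: E(1) e_def grad_sq_def y_def)
    qed
    show "ginv k l x = (\<Sum>a\<in>UNIV. E a $ k * E a $ l)" for k l
      by (rule matrix_inv_of_frame[OF invertible_G[OF x] E(2)])
  qed
qed

text \<open>The choice of \<open>K\<close> and \<open>\<delta>\<close> is exactly what makes the weighted Cauchy-Schwarz constant below
  equal to the one of the limiting case \<open>\<theta> = 1\<close>. Here \<open>\<theta> = s / \<sigma>\<close>, and \<open>\<alpha>\<close>, \<open>\<beta>\<close> are
  \<open>h'(s)\<close>, \<open>2 s h''(s)\<close>.\<close>

lemma weights:
  fixes n :: nat and p \<theta> :: real
  assumes p: "1 < p" and n: "n \<ge> 1" and \<theta>: "0 \<le> \<theta>" "\<theta> < 1"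
  defines "q \<equiv> (1 - \<theta>) powr ((p - 1) / 4)"
  defines "\<alpha> \<equiv> (p - 1) + K_const n p * q"
  defines "\<beta> \<equiv> - 2 * K_const n p * ((p - 1) / 4) * q * \<theta>"
  shows "\<alpha> > 0" "\<alpha> + \<beta> > 0" "0 \<le> 2 * \<alpha> + \<alpha> * ((p - 2) * \<theta>) + \<beta>"
    "1 + (p - 2) * \<theta> > 0"
    "(1 + (p - 2) * \<theta>) / (\<alpha> + \<beta>) + (real n - 1) / \<alpha> \<le> (real n + p - 2) / (p - 1)"
proof -
  have c: "(p - 2) * \<theta> > -1"
  proof -
    have "(2 - p) * \<theta> \<le> \<theta>" using p \<theta> mult_right_mono[of "2 - p" 1 \<theta>] by simp
    then show ?thesis using \<theta> by (simp add: algebra_simps)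
  qed
  then show w: "1 + (p - 2) * \<theta> > 0" by simp
  have q: "q > 0" using \<theta> by (simp add: q_def)
  have N: "real n + p - 2 > 0" using p n by simp
  have K0: "K_const n p \<ge> 0" using p N by (simp add: K_const_def)
  have *: "\<alpha> > 0 \<and> \<alpha> + \<beta> > 0 \<and> 0 \<le> 2 * \<alpha> + \<alpha> * ((p - 2) * \<theta>) + \<beta> \<and>
    (1 + (p - 2) * \<theta>) / (\<alpha> + \<beta>) + (real n - 1) / \<alpha> \<le> (real n + p - 2) / (p - 1)"
  proof (cases "p \<ge> 2")
    case True
    \<comment> \<open>For p \<ge> 2 one has \<alpha> = p - 1 and \<beta> = 0, and the last
      inequality reduces to (p-2) \<theta> \<le> p - 2.\<close>
    then have K: "K_const n p = 0" by (simp add: K_const_def)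
    have "(p - 2) * \<theta> \<le> p - 2" using True \<theta> mult_left_mono[of \<theta> 1 "p - 2"] by simp
    moreover have "0 \<le> 2 * (p - 1) + (p - 1) * ((p - 2) * \<theta>)" using True \<theta> by simp
    ultimately show ?thesis using p
      by (simp add: \<alpha>_def \<beta>_def K add_divide_distrib[symmetric] divide_right_mono)
  next
    case False
    define b where "b = 2 - p"
    define K where "K = K_const n p"
    have b: "0 < b" "b < 1" "p = 2 - b" using False p by (auto simp: b_def)
    \<comment> \<open>The denominator of K is n - b, so multiplying by n - b removes the
      dimension.\<close>
    have KN: "K * (real n - b) = 2 * (p - 1) * b"
    proof -
      have "K * (real n + p - 2) = 2 * (p - 1) * (2 - p)"
        using N False by (simp add: K_def K_const_def)
      moreover have "real n - b = real n + p - 2" by (simp add: b_def)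
      ultimately show ?thesis by (simp only: b_def[symmetric])
    qed
    have Kq: "K * q \<ge> 0" using K0 q by (simp add: K_def)
    \<comment> \<open>d = 2 \<delta> \<theta> is the share of the gain K q that the second
      derivative of h takes back: \<alpha> + \<beta> = (p - 1) + K q (1 - d). It is at most 1/2
      because p < 2.\<close>
    define d where "d = (p - 1) / 2 * \<theta>"
    have d: "0 \<le> d" "d \<le> 1/2"
      using p b \<theta> mult_mono[of "(p - 1) / 2" "1/2" \<theta> 1] by (auto simp: d_def)
    have \<beta>: "\<beta> = - (K * q * d)" by (simp add: \<beta>_def d_def K_def)
    have \<alpha>: "\<alpha> = (p - 1) + K * q" by (simp add: \<alpha>_def K_def)
    have \<alpha>0: "\<alpha> > 0" using p Kq by (simp add: \<alpha>)
    have \<beta>d: "K * q * d \<le> K * q * (1/2)" using Kq d by (intro mult_left_mono) auto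
    have \<alpha>\<beta>: "\<alpha> + \<beta> > 0" using p Kq \<beta>d by (simp add: \<alpha> \<beta>)
    have \<beta>0: "\<beta> \<le> 0" using Kq d by (simp add: \<beta>)
    have "\<alpha> * ((p - 2) * \<theta>) \<ge> \<alpha> * (-1)" using \<alpha>0 c by (intro mult_left_mono) auto
    then have third: "0 \<le> 2 * \<alpha> + \<alpha> * ((p - 2) * \<theta>) + \<beta>" using \<alpha>\<beta> by simp
    \<comment> \<open>The exponent \<delta> is below 1 and the base lies in (0, 1], so q dominates
      the deficit factor 1 - \<theta>.\<close>
    have "(1 - \<theta>) powr 1 \<le> q" unfolding q_def
      using \<theta> p b by (intro powr_mono') auto
    then have "1 - \<theta> \<le> q" using \<theta> by simp
    also have "q \<le> q * (2 * (1 - d))" using q d by simp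
    finally have "2 * (p - 1) * b * (1 - \<theta>) \<le> 2 * (p - 1) * b * (q * (2 * (1 - d)))"
      using b p by (intro mult_left_mono) auto
    also have "\<dots> = 2 * (real n - b) * (K * q * (1 - d))"
      unfolding KN[symmetric] by (simp add: algebra_simps)
    finally have "(p - 1) * (real n - b * \<theta>) \<le> (real n - b) * (\<alpha> + \<beta>)"
      by (simp add: \<alpha> \<beta> b(3) algebra_simps)
    then have 1: "(real n - b * \<theta>) / (\<alpha> + \<beta>) \<le> (real n + p - 2) / (p - 1)"
    proof -
      have "real n + p - 2 = real n - b" by (simp add: b_def)
      moreover have "(p - 1) * (real n - b * \<theta>) / (\<alpha> + \<beta>) \<le> real n - b"
        using \<alpha>\<beta> \<open>(p - 1) * (real n - b * \<theta>) \<le> _\<close> by (simp add: pos_divide_le_eq)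
      ultimately show ?thesis using p by (simp add: pos_le_divide_eq mult.commute)
    qed
    \<comment> \<open>As \<beta> \<le> 0, both fractions may be put over \<alpha> + \<beta>; their
      numerators add up to n - b \<theta>.\<close>
    have "(real n - 1) / \<alpha> \<le> (real n - 1) / (\<alpha> + \<beta>)"
      using n \<alpha>0 \<alpha>\<beta> \<beta>0 by (intro divide_left_mono) auto
    then have "(1 + (p - 2) * \<theta>) / (\<alpha> + \<beta>) + (real n - 1) / \<alpha> \<le> (real n - b * \<theta>) / (\<alpha> + \<beta>)"
      by (simp add: b(3) add_divide_distrib[symmetric] diff_divide_distrib[symmetric] algebra_simps)
        (simp add: add_divide_distrib diff_divide_distrib)
    with 1 \<alpha>0 \<alpha>\<beta> third show ?thesis by linarith
  qed
  then show "\<alpha> > 0" "\<alpha> + \<beta> > 0" "0 \<le> 2 * \<alpha> + \<alpha> * ((p - 2) * \<theta>) + \<beta>"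
    "(1 + (p - 2) * \<theta>) / (\<alpha> + \<beta>) + (real n - 1) / \<alpha> \<le> (real n + p - 2) / (p - 1)" by auto
qed

text \<open>Here H stands for the Hessian in an adapted frame, i for the gradient direction and c
  for (p-2) \<theta>. Off-diagonal entries may be discarded: those in row and column i carry the
  nonnegative weight 2 \<alpha> + \<alpha> c + \<beta>, the others \<alpha>. On the diagonal this is
  Cauchy-Schwarz with weight (\<alpha> + \<beta>)(1 + c) on \<open>H i i\<close> and \<alpha> on the
  other n - 1 entries.\<close>

lemma symmetric_matrix_inequality:
  fixes H :: "'n::finite \<Rightarrow> 'n \<Rightarrow> real" and \<alpha> \<beta> c N :: real
  assumes sym: "\<And>a b. H a b = H b a"
    and w: "\<alpha> > 0" "\<alpha> + \<beta> > 0" "0 \<le> 2 * \<alpha> + \<alpha> * c + \<beta>" "1 + c > 0"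
      "(1 + c) / (\<alpha> + \<beta>) + (real CARD('n) - 1) / \<alpha> \<le> N"
  shows "((\<Sum>a\<in>UNIV. H a a) + c * H i i)\<^sup>2 \<le>
    N * (\<alpha> * ((\<Sum>a\<in>UNIV. \<Sum>b\<in>UNIV. (H a b)\<^sup>2) + c * (\<Sum>a\<in>UNIV. (H i a)\<^sup>2))
      + \<beta> * ((\<Sum>a\<in>UNIV. (H i a)\<^sup>2) + c * (H i i)\<^sup>2))"
proof -
  define I where "I = UNIV - {i}"
  have split: "(\<Sum>a\<in>UNIV. F a) = F i + (\<Sum>a\<in>I. F a)" for F :: "'n \<Rightarrow> real"
    unfolding I_def by (rule sum.remove) auto
  have cI: "real (card I) = real CARD('n) - 1"
    by (simp add: I_def card_Diff_singleton of_nat_diff Suc_leI)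
  define R where "R = (\<Sum>a\<in>I. (H i a)\<^sup>2)"
  define D where "D = (\<Sum>a\<in>I. (H a a)\<^sup>2)"
  have R0: "R \<ge> 0" by (simp add: R_def sum_nonneg)
  have D0: "D \<ge> 0" by (simp add: D_def sum_nonneg)
  have "(H a a)\<^sup>2 \<le> (\<Sum>b\<in>I. (H a b)\<^sup>2)" if "a \<in> I" for a
    by (rule member_le_sum) (use that in \<open>auto simp: I_def\<close>)
  then have "D \<le> (\<Sum>a\<in>I. \<Sum>b\<in>I. (H a b)\<^sup>2)" unfolding D_def by (rule sum_mono)
  moreover have "(\<Sum>a\<in>UNIV. \<Sum>b\<in>UNIV. (H a b)\<^sup>2) = (H i i)\<^sup>2 + R + (\<Sum>a\<in>I. (H i a)\<^sup>2 + (\<Sum>b\<in>I. (H a b)\<^sup>2))"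
    unfolding split R_def by (simp, rule sum.cong[OF refl], subst sym, rule refl)
  ultimately have HH: "(H i i)\<^sup>2 + 2 * R + D \<le> (\<Sum>a\<in>UNIV. \<Sum>b\<in>UNIV. (H a b)\<^sup>2)"
    by (simp add: sum.distrib R_def)
  have Ri: "(\<Sum>a\<in>UNIV. (H i a)\<^sup>2) = (H i i)\<^sup>2 + R" unfolding split R_def ..
  define T where "T = (\<Sum>a\<in>I. H a a)"
  define k where "k = real CARD('n) - 1"
  have "T\<^sup>2 \<le> (\<Sum>a\<in>I. 1\<^sup>2) * D"
    using Cauchy_Schwarz_ineq_sum[of "\<lambda>_. 1" "\<lambda>a. H a a" I] by (simp add: T_def D_def)
  then have T: "T\<^sup>2 \<le> k * D" using cI by (simp add: k_def)
  have k0: "k \<ge> 0" using cI by (simp add: k_def flip: cI)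
  define y where "y = H i i"
  have "((1 + c) * y + T)\<^sup>2 \<le> ((1 + c) / (\<alpha> + \<beta>) + k / \<alpha>) * ((\<alpha> + \<beta>) * (1 + c) * y\<^sup>2 + \<alpha> * D)"
  proof -
    \<comment> \<open>The ratio for which Young's inequality for 2 y T produces exactly the two
      cross terms of the product on the right.\<close>
    define \<rho> where "\<rho> = \<alpha> / (\<alpha> + \<beta>)"
    have \<rho>: "\<rho> > 0" using w by (simp add: \<rho>_def)
    have "2 * y * T \<le> \<rho> * D + k / \<rho> * y\<^sup>2"
    proof (cases "k = 0")
      case True
      then have "T = 0" using T by simp
      then show ?thesis using \<rho> D0 k0 by simp
    next
      case False
      then have kp: "k > 0" using k0 by simp
      have "0 \<le> (k * y - \<rho> * T)\<^sup>2" by simp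
      then have "2 * k * \<rho> * y * T \<le> k\<^sup>2 * y\<^sup>2 + \<rho>\<^sup>2 * T\<^sup>2" by (simp add: power2_eq_square algebra_simps)
      also have "\<dots> \<le> k\<^sup>2 * y\<^sup>2 + \<rho>\<^sup>2 * (k * D)" using T by (intro add_left_mono mult_left_mono) auto
      also have "\<dots> = (k * \<rho>) * (\<rho> * D + k / \<rho> * y\<^sup>2)"
        using \<rho> by (simp add: power2_eq_square field_simps)
      finally have "(k * \<rho>) * (2 * y * T) \<le> (k * \<rho>) * (\<rho> * D + k / \<rho> * y\<^sup>2)"
        by (simp add: mult_ac)
      then show ?thesis using kp \<rho> by (simp add: mult_le_cancel_left_pos)
    qed
    then have "(1 + c) * (2 * y * T) \<le> (1 + c) * (\<rho> * D + k / \<rho> * y\<^sup>2)"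
      using w by (intro mult_left_mono) auto
    then have "((1 + c) * y + T)\<^sup>2 \<le> ((1 + c) * y)\<^sup>2 + (1 + c) * (\<rho> * D + k / \<rho> * y\<^sup>2) + k * D"
      using T by (simp add: power2_sum algebra_simps)
    also have "\<dots> = ((1 + c) / (\<alpha> + \<beta>) + k / \<alpha>) * ((\<alpha> + \<beta>) * (1 + c) * y\<^sup>2 + \<alpha> * D)"
    proof -
      have "((1 + c) / g + k / \<alpha>) * (g * (1 + c) * y\<^sup>2 + \<alpha> * D) =
        ((1 + c) * y)\<^sup>2 + (1 + c) * (\<alpha> / g * D + k / (\<alpha> / g) * y\<^sup>2) + k * D" if "g \<noteq> 0" for g
        using w(1) that by (simp add: power2_eq_square divide_simps) (simp add: algebra_simps)
      then show ?thesis using w(2) unfolding \<rho>_def by simp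
    qed
    finally show ?thesis .
  qed
  also have "\<dots> \<le> N * ((\<alpha> + \<beta>) * (1 + c) * y\<^sup>2 + \<alpha> * D)"
    using w D0 by (intro mult_right_mono) (auto simp: k_def)
  also have "\<dots> \<le> N * (\<alpha> * ((\<Sum>a\<in>UNIV. \<Sum>b\<in>UNIV. (H a b)\<^sup>2) + c * (\<Sum>a\<in>UNIV. (H i a)\<^sup>2))
      + \<beta> * ((\<Sum>a\<in>UNIV. (H i a)\<^sup>2) + c * (H i i)\<^sup>2))"
  proof (rule mult_left_mono)
    have "\<alpha> * (y\<^sup>2 + 2 * R + D) \<le> \<alpha> * (\<Sum>a\<in>UNIV. \<Sum>b\<in>UNIV. (H a b)\<^sup>2)"
      using HH w(1) by (simp add: y_def)
    moreover have "0 \<le> (2 * \<alpha> + \<alpha> * c + \<beta>) * R" using w(3) R0 by simp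
    ultimately show "(\<alpha> + \<beta>) * (1 + c) * y\<^sup>2 + \<alpha> * D \<le> \<alpha> * ((\<Sum>a\<in>UNIV. \<Sum>b\<in>UNIV. (H a b)\<^sup>2) + c * (\<Sum>a\<in>UNIV. (H i a)\<^sup>2))
      + \<beta> * ((\<Sum>a\<in>UNIV. (H i a)\<^sup>2) + c * (H i i)\<^sup>2)"
      unfolding Ri y_def[symmetric] by (simp add: algebra_simps)
    have "0 \<le> (1 + c) / (\<alpha> + \<beta>)" "0 \<le> k / \<alpha>" using w(1,2,4) k0 by simp_all
    then show "0 \<le> N" using w(5) by (simp add: k_def)
  qed
  finally show ?thesis unfolding split by (simp add: y_def T_def algebra_simps)
qed

context local_metric
begin

text \<open>In an adapted frame the coefficients of L are diagonal, with eigenvalue 1 + (p-2)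
  \<theta> in the gradient direction and 1 otherwise.\<close>

lemma elliptic_nonpos:
  assumes x: "x \<in> U" and p: "1 < p" and \<epsilon>: "0 < \<epsilon>"
    and B: "\<And>\<xi>::real^'n. (\<Sum>i\<in>UNIV. \<Sum>j\<in>UNIV. \<xi> $ i * \<xi> $ j * B i j) \<le> 0"
  shows "(\<Sum>i\<in>UNIV. \<Sum>j\<in>UNIV. ginv i j x * B i j) + (p - 2) / (grad_sq G f x + \<epsilon>\<^sup>2) *
      (\<Sum>i\<in>UNIV. \<Sum>j\<in>UNIV. grad G f x $ i * grad G f x $ j * B i j) \<le> 0"
proof -
  obtain E :: "'n \<Rightarrow> real^'n" and i0 where E: "grad G f x = sqrt (grad_sq G f x) *\<^sub>R E i0"
    "\<And>k l. ginv k l x = (\<Sum>a\<in>UNIV. E a $ k * E a $ l)"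
    using adapted_frame[OF x, of f] by blast
  define b where "b a = (\<Sum>i\<in>UNIV. \<Sum>j\<in>UNIV. E a $ i * E a $ j * B i j)" for a
  have b: "b a \<le> 0" for a using B[of "E a"] by (simp add: b_def)
  define s where "s = grad_sq G f x"
  have s: "s \<ge> 0" using grad_sq_nonneg[OF x] by (simp add: s_def)
  have "(\<Sum>i\<in>UNIV. \<Sum>j\<in>UNIV. ginv i j x * B i j) = (\<Sum>i\<in>UNIV. \<Sum>j\<in>UNIV. \<Sum>a\<in>UNIV. E a $ i * E a $ j * B i j)"
    by (simp add: E(2) sum_distrib_right)
  also have "\<dots> = (\<Sum>i\<in>UNIV. \<Sum>a\<in>UNIV. \<Sum>j\<in>UNIV. E a $ i * E a $ j * B i j)"
    by (rule sum.cong[OF refl]) (rule sum.swap)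
  also have "\<dots> = (\<Sum>a\<in>UNIV. b a)"
    unfolding b_def by (rule sum.swap)
  finally have 1: "(\<Sum>i\<in>UNIV. \<Sum>j\<in>UNIV. ginv i j x * B i j) = (\<Sum>a\<in>UNIV. b a)" .
  also have "\<dots> \<le> (\<Sum>a\<in>{i0}. b a)"
    using b sum_mono2[of UNIV "{i0}" "\<lambda>a. - b a"] by (simp add: sum_negf)
  finally have 2: "(\<Sum>i\<in>UNIV. \<Sum>j\<in>UNIV. ginv i j x * B i j) \<le> b i0" by simp
  have 3: "(\<Sum>i\<in>UNIV. \<Sum>j\<in>UNIV. grad G f x $ i * grad G f x $ j * B i j) = s * b i0"
  proof -
    have "grad G f x $ i * grad G f x $ j * B i j
        = (sqrt s * sqrt s) * (E i0 $ i * E i0 $ j * B i j)" for i j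
      unfolding E(1) s_def[symmetric] by (simp only: vector_scaleR_component real_scaleR_def mult_ac)
    then have "grad G f x $ i * grad G f x $ j * B i j = s * (E i0 $ i * E i0 $ j * B i j)" for i j
      using s by simp
    then show ?thesis by (simp only: b_def sum_distrib_left)
  qed
  define \<theta> where "\<theta> = s / (s + \<epsilon>\<^sup>2)"
  have "0 < s + \<epsilon>\<^sup>2" using s \<epsilon> by (simp add: add_nonneg_pos)
  then have "0 \<le> \<theta>" "\<theta> < 1" using s \<epsilon> by (auto simp: \<theta>_def)
  \<comment> \<open>The positivity of 1 + (p-2) \<theta> does not involve n, so the instance n = 1
    serves in every dimension.\<close>
  from weights(4)[OF p _ this, of 1] have "b i0 * (1 + (p - 2) * \<theta>) \<le> 0"
    using b[of i0] by (intro mult_nonpos_nonneg) auto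
  then have "b i0 + (p - 2) / (s + \<epsilon>\<^sup>2) * (s * b i0) \<le> 0" by (simp add: \<theta>_def algebra_simps)
  then show ?thesis using 2 unfolding 3 s_def[symmetric] by linarith
qed

text \<open>In the adapted frame every invariant is a polynomial in the Hessian entries: L f = tr H
  + (p-2) \<theta> H_00, |\<nabla>s|^2 is 4 s times the square sum of row 0, and
  \<open>speed\<close> is 2 s H_00, where 0 is the gradient direction. This reduces the claim to
  \<open>symmetric_matrix_inequality\<close>.\<close>

lemma reaction_bound:
  fixes p \<epsilon> :: real
  assumes f: "smooth_on U f" and x: "x \<in> U" and p: "1 < p" and \<epsilon>: "0 < \<epsilon>"
  defines "s \<equiv> grad_sq G f x"
  defines "q \<equiv> (\<epsilon>\<^sup>2 / (s + \<epsilon>\<^sup>2)) powr ((p - 1) / 4)"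
  defines "h' \<equiv> (p - 1) + K_const CARD('n) p * q"
  defines "h'' \<equiv> - K_const CARD('n) p * ((p - 1) / 4) * q / (s + \<epsilon>\<^sup>2)"
  shows "(L_op p \<epsilon> G f f x)\<^sup>2 \<le> a_const CARD('n) p *
     (h' * (2 * (\<Sum>k\<in>UNIV. \<Sum>j\<in>UNIV. shape f k j x * shape f j k x)
        + (p - 2) * grad_sq G (grad_sq G f) x / (2 * (s + \<epsilon>\<^sup>2)))
      + h'' * (grad_sq G (grad_sq G f) x + (p - 2) * (speed f x)\<^sup>2 / (s + \<epsilon>\<^sup>2)))" and "h' > 0"
proof -
  obtain E :: "'n \<Rightarrow> real^'n" and i0 where E: "grad G f x = sqrt s *\<^sub>R E i0"
    "\<And>k l. ginv k l x = (\<Sum>a\<in>UNIV. E a $ k * E a $ l)"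
    using adapted_frame[OF x, of f] unfolding s_def by blast
  have s: "s \<ge> 0" using grad_sq_nonneg[OF x] by (simp add: s_def)
  define \<sigma> where "\<sigma> = s + \<epsilon>\<^sup>2"
  have \<sigma>: "\<sigma> > 0" using s \<epsilon> by (simp add: add_nonneg_pos \<sigma>_def)
  define F where "F = (\<chi> k a. E a $ k)"
  define Hm where "Hm = (\<chi> k l. hess G k l f x)"
  define Hf where "Hf = transpose F ** Hm ** F"
  define H where "H a b = Hf $ a $ b" for a b
  have "transpose Hm = Hm" using hess_commute[OF f x] by (simp add: Hm_def transpose_def vec_eq_iff)
  then have "transpose Hf = Hf" by (simp add: Hf_def matrix_transpose_mul matrix_mul_assoc)
  then have Hsym: "H a b = H b a" for a b
    unfolding H_def by (metis transpose_def vec_lambda_beta)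
  have H: "H a b = (\<Sum>k\<in>UNIV. (\<Sum>l\<in>UNIV. E a $ l * hess G l k f x) * E b $ k)" for a b
    by (simp add: H_def Hf_def matrix_matrix_mult_def transpose_def F_def Hm_def)
  \<comment> \<open>A is the inverse metric times the Hessian. Moving the first F to the end under
    the trace turns A into \<open>Hf\<close>, so A and A A have the same traces as \<open>Hf\<close>
    and \<open>Hf ** Hf\<close>.\<close>
  define A where "A = F ** transpose F ** Hm"
  have A: "shape f k j x = A $ k $ j" for k j
    by (simp add: A_def matrix_matrix_mult_def F_def transpose_def Hm_def shape_def E(2))
  have trA: "lap f x = (\<Sum>a\<in>UNIV. H a a)"
  proof -
    have "lap f x = trace A" by (simp add: lap_def A trace_def)
    also have "\<dots> = trace Hf" unfolding A_def Hf_def matrix_mul_assoc[symmetric]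
      by (subst trace_mul_sym) (simp add: matrix_mul_assoc)
    finally show ?thesis by (simp add: trace_def H_def)
  qed
  have trAA: "(\<Sum>k\<in>UNIV. \<Sum>j\<in>UNIV. shape f k j x * shape f j k x) = (\<Sum>a\<in>UNIV. \<Sum>b\<in>UNIV. (H a b)\<^sup>2)"
  proof -
    have "(\<Sum>k\<in>UNIV. \<Sum>j\<in>UNIV. shape f k j x * shape f j k x) = trace (A ** A)"
      by (simp add: A trace_def matrix_matrix_mult_def)
    also have "\<dots> = trace (F ** (transpose F ** Hm ** F ** transpose F ** Hm))"
      by (simp add: A_def matrix_mul_assoc)
    also have "\<dots> = trace (Hf ** Hf)"
      by (subst trace_mul_sym) (simp add: Hf_def matrix_mul_assoc)
    also have "\<dots> = (\<Sum>a\<in>UNIV. \<Sum>b\<in>UNIV. H a b * H b a)" by (simp add: trace_def matrix_matrix_mult_def H_def)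
    finally show ?thesis using Hsym by (simp add: power2_eq_square)
  qed
  define ds where "ds j = partial j (grad_sq G f) x" for j
  have Eds: "(\<Sum>j\<in>UNIV. E a $ j * ds j) = 2 * sqrt s * H i0 a" for a
    unfolding ds_def partial_grad_sq[OF f x] H
    by (simp add: E(1) sum_distrib_left sum_distrib_right mult_ac)
  have gs: "grad_sq G (grad_sq G f) x = 4 * s * (\<Sum>a\<in>UNIV. (H i0 a)\<^sup>2)"
  proof -
    have "grad_sq G (grad_sq G f) x = (\<Sum>k\<in>UNIV. \<Sum>l\<in>UNIV. \<Sum>a\<in>UNIV. (E a $ l * ds l) * (E a $ k * ds k))"
      by (simp add: grad_sq_eq[OF x] grad_nth ds_def E(2) sum_distrib_left sum_distrib_right mult_ac)
    also have "\<dots> = (\<Sum>k\<in>UNIV. \<Sum>a\<in>UNIV. \<Sum>l\<in>UNIV. (E a $ l * ds l) * (E a $ k * ds k))"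
      by (rule sum.cong[OF refl]) (rule sum.swap)
    also have "\<dots> = (\<Sum>a\<in>UNIV. \<Sum>k\<in>UNIV. \<Sum>l\<in>UNIV. (E a $ l * ds l) * (E a $ k * ds k))"
      by (rule sum.swap)
    also have "\<dots> = (\<Sum>a\<in>UNIV. (2 * sqrt s * H i0 a)\<^sup>2)"
      unfolding Eds[symmetric] power2_eq_square by (simp add: sum_distrib_left sum_distrib_right)
    finally show ?thesis using s by (simp add: power_mult_distrib sum_distrib_left)
  qed
  have Q: "speed f x = 2 * s * H i0 i0"
  proof -
    have "speed f x = sqrt s * (\<Sum>j\<in>UNIV. E i0 $ j * ds j)"
      by (simp add: speed_def ds_def E(1) sum_distrib_left mult_ac)
    then show ?thesis unfolding Eds using s by simp
  qed
  define \<theta> where "\<theta> = s / \<sigma>"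
  have \<theta>: "0 \<le> \<theta>" "\<theta> < 1" using s \<epsilon> \<sigma> by (auto simp: \<theta>_def) (simp add: \<sigma>_def)
  have q: "q = (1 - \<theta>) powr ((p - 1) / 4)"
  proof -
    have "\<epsilon>\<^sup>2 / (s + \<epsilon>\<^sup>2) = 1 - \<theta>" using \<sigma> by (simp add: \<theta>_def \<sigma>_def field_simps)
    then show ?thesis by (simp add: q_def)
  qed
  \<comment> \<open>This is 2 s h'': the invariants next to h'' carry the factors 4 s and 4 s^2, and
    half of the bracket is needed.\<close>
  define \<beta> where "\<beta> = - 2 * K_const CARD('n) p * ((p - 1) / 4) * q * \<theta>"
  have \<beta>: "2 * s * h'' = \<beta>" 
    unfolding h''_def \<beta>_def \<theta>_def \<sigma>_def[symmetric] using \<sigma> by (simp add: field_simps)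
  note ww = weights[OF p _ \<theta>, of "CARD('n)", folded q, folded h'_def, folded \<beta>_def]
  show "h' > 0" using ww(1) by (simp add: Suc_leI)
  have L: "L_op p \<epsilon> G f f x = (\<Sum>a\<in>UNIV. H a a) + (p - 2) * \<theta> * H i0 i0"
  proof -
    have "(\<Sum>i\<in>UNIV. \<Sum>j\<in>UNIV. grad G f x $ i * grad G f x $ j * hess G i j f x) = s * H i0 i0"
      using speed_eq_hess[OF f x] Q by simp
    then show ?thesis unfolding L_op_eq[OF f x] trA s_def[symmetric] \<sigma>_def[symmetric] by (simp add: \<theta>_def)
  qed
  have "(L_op p \<epsilon> G f f x)\<^sup>2 \<le> (real CARD('n) + p - 2) / (p - 1) *
     (h' * ((\<Sum>a\<in>UNIV. \<Sum>b\<in>UNIV. (H a b)\<^sup>2) + (p - 2) * \<theta> * (\<Sum>a\<in>UNIV. (H i0 a)\<^sup>2))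
      + \<beta> * ((\<Sum>a\<in>UNIV. (H i0 a)\<^sup>2) + (p - 2) * \<theta> * (H i0 i0)\<^sup>2))"
    unfolding L by (rule symmetric_matrix_inequality[OF Hsym]) (use ww in \<open>simp_all add: Suc_leI\<close>)
  \<comment> \<open>The constant of the matrix inequality is 2 a; its factor 2 is absorbed by the
    bracket, which is twice the quadratic form in H.\<close>
  also have "(real CARD('n) + p - 2) / (p - 1) = 2 * a_const CARD('n) p"
    using p by (simp add: a_const_def field_simps)
  also have "(p - 2) * \<theta> * (\<Sum>a\<in>UNIV. (H i0 a)\<^sup>2) = (p - 2) * grad_sq G (grad_sq G f) x / (4 * \<sigma>)"
    by (simp add: gs \<theta>_def)
  also have "\<beta> * ((\<Sum>a\<in>UNIV. (H i0 a)\<^sup>2) + (p - 2) * \<theta> * (H i0 i0)\<^sup>2)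
      = h'' * (grad_sq G (grad_sq G f) x + (p - 2) * (speed f x)\<^sup>2 / \<sigma>) / 2"
    unfolding gs Q \<beta>[symmetric] \<theta>_def using \<sigma> by (simp add: power2_eq_square field_simps)
  also have aux: "2 * a * (h * (S + P / (4 * \<sigma>)) + X * Z / 2) = a * (h * (2 * S + P / (2 * \<sigma>)) + X * Z)"
    for a h S P X Z :: real using \<sigma> by (simp add: field_simps)
  finally show "(L_op p \<epsilon> G f f x)\<^sup>2 \<le> a_const CARD('n) p *
     (h' * (2 * (\<Sum>k\<in>UNIV. \<Sum>j\<in>UNIV. shape f k j x * shape f j k x)
        + (p - 2) * grad_sq G (grad_sq G f) x / (2 * (s + \<epsilon>\<^sup>2)))
      + h'' * (grad_sq G (grad_sq G f) x + (p - 2) * (speed f x)\<^sup>2 / (s + \<epsilon>\<^sup>2)))"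
    unfolding trAA \<sigma>_def[symmetric] aux .
qed

end

section \<open>The function \<open>h\<close>\<close>

text \<open>For negative \<open>s\<close> the integral in \<open>h_fun\<close> is \<open>0\<close>, so \<open>h_fun\<close> need not be differentiable at \<open>0\<close>;
  \<open>h_prim\<close> is its smooth continuation to \<open>s > -\<epsilon>\<^sup>2\<close>. The denominator vanishes only for \<open>p = 5\<close>,
  where \<open>K = 0\<close>.\<close>

definition h_prim :: "nat \<Rightarrow> real \<Rightarrow> real \<Rightarrow> real \<Rightarrow> real" where
  "h_prim n p \<epsilon> s = (p - 1) * s + K_const n p / (1 - (p - 1) / 4) * (\<epsilon>\<^sup>2) powr ((p - 1) / 4) *
     ((s + \<epsilon>\<^sup>2) powr (1 - (p - 1) / 4) - (\<epsilon>\<^sup>2) powr (1 - (p - 1) / 4))"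

definition h_deriv :: "nat \<Rightarrow> real \<Rightarrow> real \<Rightarrow> real \<Rightarrow> real" where
  "h_deriv n p \<epsilon> s = (p - 1) + K_const n p * (\<epsilon>\<^sup>2 / (s + \<epsilon>\<^sup>2)) powr ((p - 1) / 4)"

lemma powr_quotient:
  fixes \<delta> \<epsilon> s :: real
  assumes "0 < s + \<epsilon>\<^sup>2"
  shows "(\<epsilon>\<^sup>2 / (s + \<epsilon>\<^sup>2)) powr \<delta> = (\<epsilon>\<^sup>2) powr \<delta> * (s + \<epsilon>\<^sup>2) powr - \<delta>"
  using powr_divide[of "\<epsilon>\<^sup>2" "s + \<epsilon>\<^sup>2" \<delta>] assms by (simp add: powr_minus divide_inverse)

lemma primitive_of_powr:
  fixes \<delta> \<epsilon> s :: real
  assumes "\<delta> \<noteq> 1" "0 < \<epsilon>" "0 < s + \<epsilon>\<^sup>2"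
  shows "((\<lambda>s. (\<epsilon>\<^sup>2) powr \<delta> / (1 - \<delta>) * (s + \<epsilon>\<^sup>2) powr (1 - \<delta>)) has_real_derivative
    (\<epsilon>\<^sup>2 / (s + \<epsilon>\<^sup>2)) powr \<delta>) (at s)"
  using assms powr_quotient[OF assms(3), of \<delta>] by (auto intro!: derivative_eq_intros)

lemma K_const_cases: "K_const n p = 0 \<or> (p - 1) / 4 \<noteq> 1"
  by (auto simp: K_const_def)

lemma h_prim_deriv:
  assumes "0 < \<epsilon>" "0 < s + \<epsilon>\<^sup>2"
  shows "(h_prim n p \<epsilon> has_real_derivative h_deriv n p \<epsilon> s) (at s)"
proof (cases "K_const n p = 0")
  case True
  then show ?thesis by (auto intro!: derivative_eq_intros simp: h_prim_def[abs_def] h_deriv_def)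
next
  case False
  define \<delta> where "\<delta> = (p - 1) / 4"
  have "\<delta> \<noteq> 1" using K_const_cases[of n p] False by (simp add: \<delta>_def)
  note d = primitive_of_powr[OF this assms]
  have "h_prim n p \<epsilon> = (\<lambda>s. (p - 1) * s + K_const n p *
      ((\<epsilon>\<^sup>2) powr \<delta> / (1 - \<delta>) * (s + \<epsilon>\<^sup>2) powr (1 - \<delta>) - (\<epsilon>\<^sup>2) powr \<delta> / (1 - \<delta>) * (\<epsilon>\<^sup>2) powr (1 - \<delta>)))"
    by (rule ext) (simp add: h_prim_def \<delta>_def[symmetric] right_diff_distrib)
  moreover have "((\<lambda>s. (p - 1) * s + K_const n p *
      ((\<epsilon>\<^sup>2) powr \<delta> / (1 - \<delta>) * (s + \<epsilon>\<^sup>2) powr (1 - \<delta>) - (\<epsilon>\<^sup>2) powr \<delta> / (1 - \<delta>) * (\<epsilon>\<^sup>2) powr (1 - \<delta>)))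
      has_real_derivative (p - 1) * 1 + K_const n p * ((\<epsilon>\<^sup>2 / (s + \<epsilon>\<^sup>2)) powr \<delta> - 0)) (at s)"
    by (intro DERIV_add DERIV_cmult DERIV_diff DERIV_const DERIV_ident d)
  ultimately show ?thesis by (simp add: h_deriv_def \<delta>_def)
qed

lemma h_deriv_deriv:
  assumes "0 < \<epsilon>" "0 < s + \<epsilon>\<^sup>2"
  shows "(h_deriv n p \<epsilon> has_real_derivative
    - K_const n p * ((p - 1) / 4) * (\<epsilon>\<^sup>2 / (s + \<epsilon>\<^sup>2)) powr ((p - 1) / 4) / (s + \<epsilon>\<^sup>2)) (at s)"
proof -
  define \<delta> where "\<delta> = (p - 1) / 4"
  have e: "\<epsilon>\<^sup>2 > 0" using assms by simp
  have "((\<lambda>s. (p - 1) + K_const n p * ((\<epsilon>\<^sup>2) powr \<delta> * (s + \<epsilon>\<^sup>2) powr - \<delta>)) has_real_derivative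
     K_const n p * ((\<epsilon>\<^sup>2) powr \<delta> * (- \<delta> * (s + \<epsilon>\<^sup>2) powr (- \<delta> - 1)))) (at s)"
    using assms by (auto intro!: derivative_eq_intros)
  then have "(h_deriv n p \<epsilon> has_real_derivative
     K_const n p * ((\<epsilon>\<^sup>2) powr \<delta> * (- \<delta> * (s + \<epsilon>\<^sup>2) powr (- \<delta> - 1)))) (at s)"
  proof (rule has_field_derivative_transform_within_open)
    show "open {- \<epsilon>\<^sup>2<..}" "s \<in> {- \<epsilon>\<^sup>2<..}" using assms by auto
    show "(p - 1) + K_const n p * ((\<epsilon>\<^sup>2) powr \<delta> * (x + \<epsilon>\<^sup>2) powr - \<delta>) = h_deriv n p \<epsilon> x"
      if "x \<in> {- \<epsilon>\<^sup>2<..}" for x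
      using that by (simp add: h_deriv_def \<delta>_def[symmetric] powr_quotient)
  qed
  moreover have "(s + \<epsilon>\<^sup>2) powr (- \<delta> - 1) = (s + \<epsilon>\<^sup>2) powr - \<delta> / (s + \<epsilon>\<^sup>2)"
    using assms by (simp add: powr_diff)
  ultimately show ?thesis
    using powr_quotient[OF assms(2), of \<delta>] unfolding \<delta>_def[symmetric] by (simp add: mult_ac)
qed

lemma h_fun_eq_h_prim:
  assumes "0 < \<epsilon>" "0 \<le> s"
  shows "h_fun n p \<epsilon> s = h_prim n p \<epsilon> s"
proof (cases "K_const n p = 0")
  case True
  then show ?thesis by (simp add: h_fun_def h_prim_def)
next
  case False
  define \<delta> where "\<delta> = (p - 1) / 4"
  have "\<delta> \<noteq> 1" using K_const_cases[of n p] False by (simp add: \<delta>_def)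
  have "((\<lambda>\<tau>. (\<epsilon>\<^sup>2 / (\<tau> + \<epsilon>\<^sup>2)) powr \<delta>) has_integral
    ((\<epsilon>\<^sup>2) powr \<delta> / (1 - \<delta>) * (s + \<epsilon>\<^sup>2) powr (1 - \<delta>) - (\<epsilon>\<^sup>2) powr \<delta> / (1 - \<delta>) * (0 + \<epsilon>\<^sup>2) powr (1 - \<delta>))) {0..s}"
  proof (rule fundamental_theorem_of_calculus[OF assms(2)])
    fix x assume "x \<in> {0..s}"
    then have "0 < x + \<epsilon>\<^sup>2" using assms by (simp add: add_nonneg_pos)
    then show "((\<lambda>s. (\<epsilon>\<^sup>2) powr \<delta> / (1 - \<delta>) * (s + \<epsilon>\<^sup>2) powr (1 - \<delta>)) has_vector_derivative
        (\<epsilon>\<^sup>2 / (x + \<epsilon>\<^sup>2)) powr \<delta>) (at x within {0..s})"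
      using has_field_derivative_at_within[OF primitive_of_powr[OF \<open>\<delta> \<noteq> 1\<close> assms(1)]]
      by (simp add: has_real_derivative_iff_has_vector_derivative)
  qed
  then show ?thesis
    unfolding h_fun_def h_prim_def \<delta>_def[symmetric]
    by (simp add: integral_unique algebra_simps diff_divide_distrib)
qed

lemma smooth_on_h_prim:
  assumes "open S" "smooth_on S f" "0 < \<epsilon>" "\<And>x. x \<in> S \<Longrightarrow> 0 \<le> f x"
  shows "smooth_on S (\<lambda>x. h_prim n p \<epsilon> (f x))"
  unfolding h_prim_def using assms(3,4)
  by (intro smooth_on_add smooth_on_mult smooth_on_diff smooth_on_powr smooth_on_const assms(1,2))
    (auto simp: add_nonneg_pos)

section \<open>Maxima\<close>

text \<open>Both conditions are tests along the line x + \<tau> w. A positive second derivative at a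
  critical point would make f increase just to the right of it.\<close>

lemma smooth_max_conditions:
  fixes f :: "'a::real_normed_vector \<Rightarrow> real"
  assumes "open S" "smooth_on S f" "x \<in> S" "\<And>y. y \<in> S \<Longrightarrow> f y \<le> f x"
  shows "dir w f x = 0" "dir w (dir w f) x \<le> 0"
proof -
  have "\<forall>\<^sub>F \<tau> in nhds 0. x + \<tau> *\<^sub>R w \<in> S"
  proof -
    have "isCont (\<lambda>\<tau>::real. x + \<tau> *\<^sub>R w) 0" by (intro continuous_intros)
    then have "((\<lambda>\<tau>::real. x + \<tau> *\<^sub>R w) \<longlongrightarrow> x) (nhds 0)"
      using tendsto_at_iff_tendsto_nhds[of "\<lambda>\<tau>::real. x + \<tau> *\<^sub>R w" 0] by (simp add: isCont_def)
    then show ?thesis using topological_tendstoD assms(1,3) by blast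
  qed
  then obtain r where r: "r > 0" "\<And>\<tau>. \<bar>\<tau>\<bar> < r \<Longrightarrow> x + \<tau> *\<^sub>R w \<in> S"
    unfolding eventually_nhds_metric by (auto simp: dist_real_def)
  have d1: "((\<lambda>\<tau>. f (x + \<tau> *\<^sub>R w)) has_real_derivative dir w f (x + \<tau> *\<^sub>R w)) (at \<tau>)" if "\<bar>\<tau>\<bar> < r" for \<tau>
    by (rule has_real_derivative_along_line) (rule smooth_on_differentiable[OF assms(2) r(2)[OF that]])
  show d0: "dir w f x = 0"
    using DERIV_local_max[of "\<lambda>\<tau>. f (x + \<tau> *\<^sub>R w)" "dir w f x" 0 r] d1[of 0] r assms(4) by auto
  show "dir w (dir w f) x \<le> 0"
  proof (rule ccontr)
    assume "\<not> ?thesis"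
    moreover have "((\<lambda>\<tau>. dir w f (x + \<tau> *\<^sub>R w)) has_real_derivative dir w (dir w f) x) (at 0)"
      using has_real_derivative_along_line[of "dir w f" x 0 w]
        smooth_on_differentiable[OF smooth_on_dir[OF assms(2)] assms(3)] by simp
    ultimately obtain d where d: "d > 0" "\<And>h. 0 < h \<Longrightarrow> h < d \<Longrightarrow> dir w f x < dir w f (x + h *\<^sub>R w)"
      using DERIV_pos_inc_right[of "\<lambda>\<tau>. dir w f (x + \<tau> *\<^sub>R w)" "dir w (dir w f) x" 0] by auto
    define e where "e = min d r / 2"
    have e: "0 < e" "e < d" "e < r" using d r by (auto simp: e_def)
    obtain \<xi> where \<xi>: "0 < \<xi>" "\<xi> < e" "f (x + e *\<^sub>R w) - f (x + 0 *\<^sub>R w) = (e - 0) * dir w f (x + \<xi> *\<^sub>R w)"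
      using MVT2[of 0 e "\<lambda>\<tau>. f (x + \<tau> *\<^sub>R w)" "\<lambda>\<tau>. dir w f (x + \<tau> *\<^sub>R w)"] e d1 by auto
    have "dir w f (x + \<xi> *\<^sub>R w) > 0" using d(2)[of \<xi>] \<xi> e d0 by simp
    then have "f (x + e *\<^sub>R w) > f x" using \<xi>(3) e(1) by (simp add: algebra_simps)
    moreover have "f (x + e *\<^sub>R w) \<le> f x" using assms(4) r(2)[of e] e by simp
    ultimately show False by simp
  qed
qed

text \<open>One-sided, because a maximum at the final time T can be compared with earlier times
  only.\<close>

lemma left_max_deriv_nonneg:
  assumes d: "(\<psi> has_real_derivative D) (at t)" and "e > 0"
    and max: "\<And>\<tau>. t - e < \<tau> \<Longrightarrow> \<tau> \<le> t \<Longrightarrow> \<psi> \<tau> \<le> \<psi> t"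
  shows "D \<ge> 0"
proof (rule ccontr)
  assume "\<not> ?thesis"
  then obtain \<eta> where \<eta>: "\<eta> > 0" "\<And>h. 0 < h \<Longrightarrow> h < \<eta> \<Longrightarrow> \<psi> t < \<psi> (t - h)"
    using DERIV_neg_dec_left[OF d] by auto
  define h where "h = min \<eta> e / 2"
  have "0 < h" "h < \<eta>" "h < e" using \<eta>(1) \<open>e > 0\<close> by (auto simp: h_def)
  then show False using max[of "t - h"] \<eta>(2)[of h] by simp
qed

section \<open>Differentiation in time\<close>

text \<open>The equation is not part of the locale: V is a smooth extension beyond [0, T] and solves
  it only inside.\<close>

locale evolving_function = local_metric U G
  for U :: "(real^'n::finite) set" and G :: "real^'n \<Rightarrow> real^'n^'n" +
  fixes J :: "real set" and V :: "real \<times> (real^'n) \<Rightarrow> real"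
  assumes open_J: "open J" and smooth_V: "smooth_on (J \<times> U) V"
begin

lemma open_JU: "open (J \<times> U)"
  using open_J open_U by (rule open_Times)

text \<open>Space derivatives at fixed time become directional derivatives on the product, so that
  exchanging them with time derivatives is an instance of \<open>dir_commute\<close>.\<close>

lemma slice:
  fixes F :: "real \<times> (real^'n) \<Rightarrow> real"
  assumes "smooth_on (J \<times> U) F" "t \<in> J"
  shows "smooth_on U (\<lambda>x. F (t, x))"
    and "x \<in> U \<Longrightarrow> dir w (\<lambda>x. F (t, x)) x = dir (0, w) F (t, x)"
proof -
  have L: "bounded_linear (\<lambda>x :: real^'n. (0 :: real, x))"
    by (intro bounded_linear_Pair bounded_linear_zero bounded_linear_ident)
  show "smooth_on U (\<lambda>x. F (t, x))"
    using smooth_on_affine_compose(1)[OF open_U L assms(1), of "(t, 0)"] assms(2) by simp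
  show "x \<in> U \<Longrightarrow> dir w (\<lambda>x. F (t, x)) x = dir (0, w) F (t, x)"
    using smooth_on_affine_compose(2)[OF open_U L assms(1), of "(t, 0)" x w] assms(2) by simp
qed

lemma time_derivative:
  fixes F :: "real \<times> (real^'n) \<Rightarrow> real"
  assumes "smooth_on (J \<times> U) F" "t \<in> J" "x \<in> U"
  shows "((\<lambda>\<tau>. F (\<tau>, x)) has_real_derivative dir (1, 0) F (t, x)) (at t)"
  using has_real_derivative_along_line[of F "(0, x)" t "(1, 0)"]
    smooth_on_differentiable[OF assms(1)] assms(2,3) by simp

lemma time_derivative_partial:
  fixes F :: "real \<times> (real^'n) \<Rightarrow> real"
  assumes F: "smooth_on (J \<times> U) F" and t: "t \<in> J" and x: "x \<in> U"
  shows "((\<lambda>\<tau>. partial i (\<lambda>x. F (\<tau>, x)) x) has_real_derivative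
    partial i (\<lambda>x. dir (1, 0) F (t, x)) x) (at t)"
proof -
  let ?e = "(0, axis i 1) :: real \<times> (real^'n)"
  have "((\<lambda>\<tau>. dir ?e F (\<tau>, x)) has_real_derivative dir (1, 0) (dir ?e F) (t, x)) (at t)"
    by (rule time_derivative[OF smooth_on_dir[OF F] t x])
  then have "((\<lambda>\<tau>. partial i (\<lambda>x. F (\<tau>, x)) x) has_real_derivative dir (1, 0) (dir ?e F) (t, x)) (at t)"
    by (rule has_field_derivative_transform_within_open[OF _ open_J t])
      (simp add: partial_eq_dir slice(2)[OF F _ x])
  moreover have "dir (1, 0) (dir ?e F) (t, x) = partial i (\<lambda>x. dir (1, 0) F (t, x)) x"
    using dir_commute[OF open_JU F, of "(t, x)"] t x
    by (simp add: partial_eq_dir slice(2)[OF smooth_on_dir[OF F] t x])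
  ultimately show ?thesis by simp
qed

lemma time_derivative_partial2:
  fixes F :: "real \<times> (real^'n) \<Rightarrow> real"
  assumes F: "smooth_on (J \<times> U) F" and t: "t \<in> J" and x: "x \<in> U"
  shows "((\<lambda>\<tau>. partial i (partial j (\<lambda>x. F (\<tau>, x))) x) has_real_derivative
    partial i (partial j (\<lambda>x. dir (1, 0) F (t, x))) x) (at t)"
proof -
  let ?e = "(0, axis j 1) :: real \<times> (real^'n)"
  have eq: "partial i (partial j (\<lambda>x. H (\<tau>, x))) x = partial i (\<lambda>x. dir ?e H (\<tau>, x)) x"
    if "\<tau> \<in> J" "smooth_on (J \<times> U) H" for \<tau> and H :: "real \<times> (real^'n) \<Rightarrow> real"
    unfolding partial_eq_dir by (rule dir_cong_open[OF open_U x]) (rule slice(2)[OF that(2,1)])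
  have "((\<lambda>\<tau>. partial i (partial j (\<lambda>x. F (\<tau>, x))) x) has_real_derivative
      partial i (\<lambda>x. dir (1, 0) (dir ?e F) (t, x)) x) (at t)"
    by (rule has_field_derivative_transform_within_open[OF time_derivative_partial[OF smooth_on_dir[OF F] t x] open_J t])
      (rule eq[OF _ F, symmetric])
  moreover have "partial i (\<lambda>x. dir (1, 0) (dir ?e F) (t, x)) x = partial i (\<lambda>x. dir ?e (dir (1, 0) F) (t, x)) x"
    unfolding partial_eq_dir[of i]
    by (rule dir_cong_open[OF open_U x]) (use dir_commute[OF open_JU F] t in auto)
  ultimately show ?thesis using eq[OF t smooth_on_dir[OF F], of "(1, 0)"] by simp
qed

context
  fixes t x
  assumes t: "t \<in> J" and x: "x \<in> U"
begin

abbreviation (input) "V_at \<equiv> \<lambda>x. V (t, x)"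
abbreviation (input) "Vt_at \<equiv> \<lambda>x. dir (1, 0) V (t, x)"

lemma smooth_V_at: "smooth_on U V_at"
  by (rule slice(1)[OF smooth_V t])

lemma smooth_Vt_at: "smooth_on U Vt_at"
  by (rule slice(1)[OF smooth_on_dir[OF smooth_V] t])

lemma time_derivative_hess:
  "((\<lambda>\<tau>. hess G i j (\<lambda>x. V (\<tau>, x)) x) has_real_derivative hess G i j Vt_at x) (at t)"
  unfolding hess_def
  by (intro DERIV_diff DERIV_sum DERIV_cmult time_derivative_partial time_derivative_partial2 smooth_V t x)

lemma time_derivative_grad:
  "((\<lambda>\<tau>. grad G (\<lambda>x. V (\<tau>, x)) x $ k) has_real_derivative grad G Vt_at x $ k) (at t)"
  unfolding grad_nth
  by (intro DERIV_sum DERIV_cmult time_derivative_partial smooth_V t x)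

lemma time_derivative_lap:
  "((\<lambda>\<tau>. lap (\<lambda>x. V (\<tau>, x)) x) has_real_derivative lap Vt_at x) (at t)"
  unfolding lap_def shape_def
  by (intro DERIV_sum DERIV_cmult time_derivative_hess)

lemma grad_partial_swap:
  "(\<Sum>k\<in>UNIV. grad G \<phi> x $ k * partial k \<psi> x) = (\<Sum>k\<in>UNIV. grad G \<psi> x $ k * partial k \<phi> x)"
  using sum_grad_mult_swap[OF x, of "\<lambda>l. partial l \<phi> x" \<psi>] by (simp add: grad_nth)

lemma time_derivative_grad_sq:
  "((\<lambda>\<tau>. grad_sq G (\<lambda>x. V (\<tau>, x)) x) has_real_derivative
     2 * (\<Sum>k\<in>UNIV. grad G V_at x $ k * partial k Vt_at x)) (at t)"
proof -
  have "((\<lambda>\<tau>. grad_sq G (\<lambda>x. V (\<tau>, x)) x) has_real_derivative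
     (\<Sum>k\<in>UNIV. grad G Vt_at x $ k * partial k V_at x + partial k Vt_at x * grad G V_at x $ k)) (at t)"
    unfolding grad_sq_eq[OF x]
    by (intro DERIV_sum DERIV_mult time_derivative_grad time_derivative_partial smooth_V t x)
  then show ?thesis
    using grad_partial_swap[of Vt_at V_at] by (simp add: sum.distrib mult.commute[of "partial _ Vt_at x"])
qed

text \<open>By symmetry of the Hessian, the derivatives of the two gradient factors agree; together
  they pair the time derivative of \<nabla>V with 2 \<nabla>^2 V(\<nabla>V, .), which is ds.\<close>

lemma time_derivative_hess_grad_grad:
  "((\<lambda>\<tau>. \<Sum>i\<in>UNIV. \<Sum>j\<in>UNIV. grad G (\<lambda>x. V (\<tau>, x)) x $ i * grad G (\<lambda>x. V (\<tau>, x)) x $ j * hess G i j (\<lambda>x. V (\<tau>, x)) x)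
    has_real_derivative (\<Sum>i\<in>UNIV. \<Sum>j\<in>UNIV. grad G V_at x $ i * grad G V_at x $ j * hess G i j Vt_at x)
      + (\<Sum>i\<in>UNIV. grad G (grad_sq G V_at) x $ i * partial i Vt_at x)) (at t)"
proof -
  let ?X = "\<lambda>i. grad G V_at x $ i" and ?Y = "\<lambda>i. grad G Vt_at x $ i" and ?H = "\<lambda>i j. hess G i j V_at x"
  have d: "((\<lambda>\<tau>. \<Sum>i\<in>UNIV. \<Sum>j\<in>UNIV. grad G (\<lambda>x. V (\<tau>, x)) x $ i * grad G (\<lambda>x. V (\<tau>, x)) x $ j * hess G i j (\<lambda>x. V (\<tau>, x)) x)
    has_real_derivative (\<Sum>i\<in>UNIV. \<Sum>j\<in>UNIV. (?Y i * ?X j + ?Y j * ?X i) * ?H i j + hess G i j Vt_at x * (?X i * ?X j))) (at t)"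
    by (intro DERIV_sum DERIV_mult time_derivative_grad time_derivative_hess)
  have "(\<Sum>i\<in>UNIV. \<Sum>j\<in>UNIV. ?Y i * ?X j * ?H i j) = (\<Sum>i\<in>UNIV. \<Sum>j\<in>UNIV. ?Y j * ?X i * ?H i j)"
    by (subst sum.swap) (simp add: hess_commute[OF smooth_V_at x, of _ j for j])
  then have "(\<Sum>i\<in>UNIV. \<Sum>j\<in>UNIV. (?Y i * ?X j + ?Y j * ?X i) * ?H i j)
      = 2 * (\<Sum>i\<in>UNIV. \<Sum>j\<in>UNIV. ?Y j * ?X i * ?H i j)"
    by (simp add: distrib_right sum.distrib)
  also have "\<dots> = (\<Sum>j\<in>UNIV. ?Y j * partial j (grad_sq G V_at) x)"
    unfolding partial_grad_sq[OF smooth_V_at x]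
    by (subst sum.swap) (simp add: sum_distrib_left mult_ac)
  finally have "(\<Sum>i\<in>UNIV. \<Sum>j\<in>UNIV. (?Y i * ?X j + ?Y j * ?X i) * ?H i j)
      = (\<Sum>i\<in>UNIV. grad G (grad_sq G V_at) x $ i * partial i Vt_at x)"
    using grad_partial_swap[of Vt_at "grad_sq G V_at"] by simp
  then show ?thesis using d by (simp add: sum.distrib mult_ac add.commute)
qed

text \<open>The metric is static, so L applied to V_t is corrected only by the time derivative of
  the coefficients: of \<nabla>V \<nabla>V in the first fraction, of 1/\<sigma> in the
  second.\<close>

lemma time_derivative_L_op:
  fixes p \<epsilon> :: real
  assumes \<epsilon>: "0 < \<epsilon>"
  defines "\<sigma> \<equiv> grad_sq G V_at x + \<epsilon>\<^sup>2"
  shows "((\<lambda>\<tau>. L_op p \<epsilon> G (\<lambda>x. V (\<tau>, x)) (\<lambda>x. V (\<tau>, x)) x) has_real_derivative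
    L_op p \<epsilon> G V_at Vt_at x + (p - 2) * ((\<Sum>i\<in>UNIV. grad G (grad_sq G V_at) x $ i * partial i Vt_at x) / \<sigma>
      - speed V_at x * (\<Sum>i\<in>UNIV. grad G V_at x $ i * partial i Vt_at x) / \<sigma>\<^sup>2)) (at t)"
proof -
  let ?HXX = "\<lambda>\<phi> \<psi>. \<Sum>i\<in>UNIV. \<Sum>j\<in>UNIV. grad G \<phi> x $ i * grad G \<phi> x $ j * hess G i j \<psi> x"
  have \<sigma>: "\<sigma> > 0" using grad_sq_nonneg[OF x, of V_at] \<epsilon> by (simp add: \<sigma>_def add_nonneg_pos)
  define R where "R = (\<Sum>i\<in>UNIV. grad G (grad_sq G V_at) x $ i * partial i Vt_at x)"
  define P where "P = (\<Sum>i\<in>UNIV. grad G V_at x $ i * partial i Vt_at x)"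
  have "((\<lambda>\<tau>. c / (grad_sq G (\<lambda>x. V (\<tau>, x)) x + \<epsilon>\<^sup>2)) has_real_derivative
      - c * (2 * P) / \<sigma>\<^sup>2) (at t)" for c
    unfolding \<sigma>_def P_def using \<sigma>[unfolded \<sigma>_def]
    by (auto intro!: derivative_eq_intros time_derivative_grad_sq simp: power2_eq_square)
  note dquot = this[of "p - 2"]
  have "((\<lambda>\<tau>. lap (\<lambda>x. V (\<tau>, x)) x + (p - 2) / (grad_sq G (\<lambda>x. V (\<tau>, x)) x + \<epsilon>\<^sup>2) *
      ?HXX (\<lambda>x. V (\<tau>, x)) (\<lambda>x. V (\<tau>, x))) has_real_derivative
      lap Vt_at x + (- (p - 2) * (2 * P) / \<sigma>\<^sup>2 * ?HXX V_at V_at + (?HXX V_at Vt_at + R) * ((p - 2) / \<sigma>))) (at t)"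
    unfolding \<sigma>_def R_def
    by (intro DERIV_add DERIV_mult dquot[unfolded \<sigma>_def] time_derivative_lap time_derivative_hess_grad_grad)
  then have "((\<lambda>\<tau>. L_op p \<epsilon> G (\<lambda>x. V (\<tau>, x)) (\<lambda>x. V (\<tau>, x)) x) has_real_derivative
      lap Vt_at x + (- (p - 2) * (2 * P) / \<sigma>\<^sup>2 * ?HXX V_at V_at + (?HXX V_at Vt_at + R) * ((p - 2) / \<sigma>))) (at t)"
    by (rule has_field_derivative_transform_within_open[OF _ open_J t])
      (simp add: L_op_eq[OF slice(1)[OF smooth_V] x])
  moreover have "?HXX V_at V_at = speed V_at x / 2" using speed_eq_hess[OF smooth_V_at x] by simp
  moreover have "l + (- (p - 2) * (2 * P) / \<sigma>\<^sup>2 * (S / 2) + (H + R) * ((p - 2) / \<sigma>))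
      = l + (p - 2) / \<sigma> * H + (p - 2) * (R / \<sigma> - S * P / \<sigma>\<^sup>2)" for l S H :: real
    using \<sigma> by (simp add: power2_eq_square divide_simps) (simp add: algebra_simps)
  ultimately show ?thesis
    unfolding L_op_eq[OF smooth_Vt_at x] \<sigma>_def[symmetric] R_def[symmetric] P_def[symmetric]
    by (simp add: add.assoc)
qed

end

end

section \<open>The maximum principle in a chart\<close>

context local_metric
begin

text \<open>Meant for V_t = h(s) - W. As x is critical for W, W contributes only L W there. The
  derivative of h is needed nearby, the second one only at x.\<close>

lemma L_op_composition:
  assumes f: "smooth_on U f" and x: "x \<in> U" and W: "smooth_on U W" "\<And>i. partial i W x = 0"
    and h: "\<And>y. y \<in> U \<Longrightarrow> (h has_real_derivative h' (grad_sq G f y)) (at (grad_sq G f y))"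
    and h': "(h' has_real_derivative h'') (at (grad_sq G f x))"
  shows "L_op p \<epsilon> G f (\<lambda>y. h (grad_sq G f y) - W y) x
    = h' (grad_sq G f x) * L_op p \<epsilon> G f (grad_sq G f) x
      + h'' * (grad_sq G (grad_sq G f) x + (p - 2) * (speed f x)\<^sup>2 / (grad_sq G f x + \<epsilon>\<^sup>2))
      - L_op p \<epsilon> G f W x"
    and "partial i (\<lambda>y. h (grad_sq G f y) - W y) x = h' (grad_sq G f x) * partial i (grad_sq G f) x"
proof -
  let ?s = "grad_sq G f" and ?X = "\<lambda>i. grad G f x $ i"
  note ss = smooth_grad_sq[OF f]
  have dh: "(\<lambda>y. h (?s y)) differentiable (at y)" if "y \<in> U" for y
    using has_derivative_compose[OF has_derivative_dir[OF sm_diff[OF ss that]]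
        has_field_derivative_imp_has_derivative[OF h[OF that]]] unfolding differentiable_def by blast
  have dh': "(\<lambda>y. h' (?s y)) differentiable (at x)"
    using has_derivative_compose[OF has_derivative_dir[OF sm_diff[OF ss x]]
        has_field_derivative_imp_has_derivative[OF h']] unfolding differentiable_def by blast
  have d1: "partial j (\<lambda>y. h (?s y) - W y) y = h' (?s y) * partial j ?s y - partial j W y" if "y \<in> U" for j y
    unfolding partial_eq_dir
    by (simp add: dir_diff dh sm_diff W(1) that dir_compose_real[OF sm_diff[OF ss that] h[OF that]])
  show "partial i (\<lambda>y. h (?s y) - W y) x = h' (?s x) * partial i ?s x"
    using d1[OF x] W(2) by simp
  have d2: "partial i (partial j (\<lambda>y. h (?s y) - W y)) x
      = h'' * partial i ?s x * partial j ?s x + h' (?s x) * partial i (partial j ?s) x - partial i (partial j W) x" for i j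
  proof -
    have "partial i (partial j (\<lambda>y. h (?s y) - W y)) x = partial i (\<lambda>y. h' (?s y) * partial j ?s y - partial j W y) x"
      unfolding partial_eq_dir[of i] by (rule dir_cong_open[OF open_U x d1])
    also have "\<dots> = h'' * partial i ?s x * partial j ?s x + h' (?s x) * partial i (partial j ?s) x - partial i (partial j W) x"
      unfolding partial_eq_dir[of i]
      by (simp add: dir_diff dir_mult differentiable_mult dh' sm_diff[OF smooth_partial[OF ss] x]
          sm_diff[OF smooth_partial[OF W(1)] x] dir_compose_real[OF sm_diff[OF ss x] h'])
    finally show ?thesis .
  qed
  have hs: "hess G i j (\<lambda>y. h (?s y) - W y) x
      = h' (?s x) * hess G i j ?s x + h'' * (partial i ?s x * partial j ?s x) - hess G i j W x" for i j
    unfolding hess_def d2 d1[OF x] W(2)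
    by (simp add: algebra_simps sum_distrib_left sum_subtractf)
  have g: "(\<Sum>i\<in>UNIV. \<Sum>j\<in>UNIV. ginv i j x * (partial i ?s x * partial j ?s x)) = grad_sq G ?s x"
    by (simp add: grad_sq_eq[OF x] grad_nth sum_distrib_right sum_distrib_left mult_ac)
  have Q: "(\<Sum>i\<in>UNIV. \<Sum>j\<in>UNIV. ?X i * ?X j * (partial i ?s x * partial j ?s x)) = (speed f x)\<^sup>2"
    by (simp add: speed_def power2_eq_square sum_product mult_ac)
  have expand: "(\<Sum>i\<in>UNIV. \<Sum>j\<in>UNIV. c i j * hess G i j (\<lambda>y. h (?s y) - W y) x)
     = h' (?s x) * (\<Sum>i\<in>UNIV. \<Sum>j\<in>UNIV. c i j * hess G i j ?s x)
      + h'' * (\<Sum>i\<in>UNIV. \<Sum>j\<in>UNIV. c i j * (partial i ?s x * partial j ?s x))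
      - (\<Sum>i\<in>UNIV. \<Sum>j\<in>UNIV. c i j * hess G i j W x)" for c :: "'n \<Rightarrow> 'n \<Rightarrow> real"
    unfolding hs by (simp add: algebra_simps sum_distrib_left sum_subtractf sum.distrib)
  show "L_op p \<epsilon> G f (\<lambda>y. h (?s y) - W y) x
    = h' (?s x) * L_op p \<epsilon> G f ?s x
      + h'' * (grad_sq G ?s x + (p - 2) * (speed f x)\<^sup>2 / (?s x + \<epsilon>\<^sup>2))
      - L_op p \<epsilon> G f W x"
    unfolding L_op_expand expand g Q by (simp add: algebra_simps)
qed

text \<open>\<open>crit\<close> expresses the pairing of \<nabla>f with \<nabla>\<Delta>f in
  Bochner's formula through the derivative of \<open>speed f\<close> along \<nabla>f. That
  derivative then cancels the one from \<open>hess_grad_sq_grad_grad\<close>, so no third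
  derivatives of f remain.\<close>

lemma L_op_grad_sq:
  fixes p \<epsilon> :: real
  assumes f: "smooth_on U f" and x: "x \<in> U" and \<epsilon>: "0 < \<epsilon>"
    and crit: "\<And>j. partial j (L_op p \<epsilon> G f f) x = 0"
  defines "\<sigma> \<equiv> grad_sq G f x + \<epsilon>\<^sup>2"
  shows "L_op p \<epsilon> G f (grad_sq G f) x
    = 2 * (\<Sum>k\<in>UNIV. \<Sum>j\<in>UNIV. shape f k j x * shape f j k x)
      + 2 * (\<Sum>j\<in>UNIV. \<Sum>l\<in>UNIV. ricci G j l x * grad G f x $ j * grad G f x $ l)
      + (p - 2) * ((speed f x)\<^sup>2 / \<sigma>\<^sup>2 - grad_sq G (grad_sq G f) x / (2 * \<sigma>))"
proof -
  let ?X = "\<lambda>i. grad G f x $ i" and ?s = "grad_sq G f"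
  have \<sigma>: "\<sigma> > 0" using grad_sq_nonneg[OF x, of f] \<epsilon> by (simp add: \<sigma>_def add_nonneg_pos)
  have "((\<lambda>s. c / (s + \<epsilon>\<^sup>2)) has_real_derivative - c / \<sigma>\<^sup>2) (at (?s x))" for c
    using \<sigma> unfolding \<sigma>_def by (auto intro!: derivative_eq_intros simp: power2_eq_square)
  note deriv = this
  \<comment> \<open>Half of p - 2, because \<open>speed\<close> is twice the Hessian on (\<nabla>f,
    \<nabla>f).\<close>
  define c where "c = (p - 2) / 2"
  note dquot = deriv[of c]
  have diffq: "(\<lambda>y. c / (?s y + \<epsilon>\<^sup>2)) differentiable (at x)"
    using has_derivative_compose[OF has_derivative_dir[OF sm_diff[OF smooth_grad_sq[OF f] x]]
        has_field_derivative_imp_has_derivative[OF dquot]] unfolding differentiable_def by blast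
  have "partial j (L_op p \<epsilon> G f f) x = partial j (\<lambda>y. lap f y + c / (?s y + \<epsilon>\<^sup>2) * speed f y) x" for j
    unfolding partial_eq_dir
  proof (rule dir_cong_open[OF open_U x])
    fix y assume y: "y \<in> U"
    have "b / d * S = b / 2 / d * (2 * S)" for b d S :: real by simp
    then show "L_op p \<epsilon> G f f y = lap f y + c / (?s y + \<epsilon>\<^sup>2) * speed f y"
      unfolding L_op_eq[OF f y] c_def speed_eq_hess[OF f y] by (intro arg_cong2[where f = "(+)"] refl)
  qed
  also have "\<And>j. \<dots> j = partial j (lap f) x + (- c / \<sigma>\<^sup>2 * partial j ?s x * speed f x
      + c / \<sigma> * partial j (speed f) x)"
    unfolding partial_eq_dir
    by (simp del: times_divide_eq_left add: dir_add dir_mult differentiable_mult diffq sm_diff[OF smooth_lap[OF f] x]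
        sm_diff[OF smooth_speed[OF f] x] dir_compose_real[OF sm_diff[OF smooth_grad_sq[OF f] x] dquot] \<sigma>_def)
  finally have crit0: "(\<Sum>j\<in>UNIV. ?X j * (partial j (lap f) x + (- c / \<sigma>\<^sup>2 * partial j ?s x * speed f x
      + c / \<sigma> * partial j (speed f) x))) = 0" using crit by simp
  have gen: "(\<Sum>j\<in>UNIV. ?X j * (partial j (lap f) x + (b * partial j ?s x * c + d * partial j (speed f) x)))
     = (\<Sum>j\<in>UNIV. ?X j * partial j (lap f) x) + b * c * speed f x + d * (\<Sum>j\<in>UNIV. ?X j * partial j (speed f) x)"
    for b c d by (simp add: speed_def algebra_simps sum.distrib sum_distrib_left)
  have lapX: "(\<Sum>j\<in>UNIV. ?X j * partial j (lap f) x)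
      = (p - 2) / 2 * (speed f x)\<^sup>2 / \<sigma>\<^sup>2 - (p - 2) / 2 / \<sigma> * (\<Sum>j\<in>UNIV. ?X j * partial j (speed f) x)"
    using crit0 unfolding gen by (simp add: power2_eq_square c_def)
  show ?thesis
    unfolding L_op_eq[OF smooth_grad_sq[OF f] x] bochner[OF f x] hess_grad_sq_grad_grad[OF f x] lapX \<sigma>_def[symmetric]
    by (simp add: algebra_simps diff_divide_distrib add_divide_distrib)
qed

end

context evolving_function
begin

text \<open>Times stop at \<open>t\<^sub>0\<close>, since for \<open>t\<^sub>0 = T\<close> the later
  part of J belongs to the arbitrary extension. The time derivative of L V is computed from V
  itself; the equation on the slice \<open>t\<^sub>0\<close> then replaces V_t by h(s) - W near the
  maximum.\<close>

lemma local_maximum_bound: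
  fixes p \<epsilon> t\<^sub>0 :: real
  assumes p: "1 < p" and \<epsilon>: "0 < \<epsilon>" and t0: "t\<^sub>0 \<in> J" "0 < t\<^sub>0" and x0: "x\<^sub>0 \<in> U"
    and eq: "\<And>t x. t \<in> J \<Longrightarrow> 0 \<le> t \<Longrightarrow> t \<le> t\<^sub>0 \<Longrightarrow> x \<in> U \<Longrightarrow> dir (1, 0) V (t, x)
        = L_op p \<epsilon> G (\<lambda>x. V (t, x)) (\<lambda>x. V (t, x)) x + h_fun CARD('n) p \<epsilon> (grad_sq G (\<lambda>x. V (t, x)) x)"
    and ricci: "\<And>\<xi>::real^'n. (\<Sum>i\<in>UNIV. \<Sum>j\<in>UNIV. ricci G i j x\<^sub>0 * \<xi> $ i * \<xi> $ j) \<ge> 0"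
    and max: "\<And>t x. t \<in> J \<Longrightarrow> 0 \<le> t \<Longrightarrow> t \<le> t\<^sub>0 \<Longrightarrow> x \<in> U \<Longrightarrow>
        t * - L_op p \<epsilon> G (\<lambda>x. V (t, x)) (\<lambda>x. V (t, x)) x \<le> t\<^sub>0 * - L_op p \<epsilon> G (\<lambda>x. V (t\<^sub>0, x)) (\<lambda>x. V (t\<^sub>0, x)) x\<^sub>0"
  shows "t\<^sub>0 * - L_op p \<epsilon> G (\<lambda>x. V (t\<^sub>0, x)) (\<lambda>x. V (t\<^sub>0, x)) x\<^sub>0 \<le> a_const CARD('n) p"
proof -
  let ?f = "\<lambda>x. V (t\<^sub>0, x)" and ?fd = "\<lambda>x. dir (1, 0) V (t\<^sub>0, x)"
  let ?s = "grad_sq G ?f" and ?n = "CARD('n)"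
  note f = smooth_V_at[OF t0(1) x0] and fd = smooth_Vt_at[OF t0(1) x0]
  define \<sigma> where "\<sigma> = ?s x\<^sub>0 + \<epsilon>\<^sup>2"
  have spos: "0 < ?s x + \<epsilon>\<^sup>2" if "x \<in> U" for x
    using grad_sq_nonneg[OF that, of ?f] \<epsilon> by (simp add: add_nonneg_pos)
  have \<sigma>: "\<sigma> > 0" using spos[OF x0] by (simp add: \<sigma>_def)
  define h' where "h' = h_deriv ?n p \<epsilon> (?s x\<^sub>0)"
  define h'' where "h'' = - K_const ?n p * ((p - 1) / 4) * (\<epsilon>\<^sup>2 / \<sigma>) powr ((p - 1) / 4) / \<sigma>"
  \<comment> \<open>\<open>h_prim\<close> instead of \<open>h_fun\<close> keeps W smooth at zeros of
    the gradient, where s = 0.\<close>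
  define W where "W x = h_prim ?n p \<epsilon> (?s x) - ?fd x" for x
  define \<phi> where "\<phi> = L_op p \<epsilon> G ?f ?f x\<^sub>0"
  have W: "smooth_on U W" unfolding W_def[abs_def]
    by (intro smooth_on_diff[OF open_U] smooth_on_h_prim[OF open_U] smooth_grad_sq f fd \<epsilon> grad_sq_nonneg)
  have WL: "W x = - L_op p \<epsilon> G ?f ?f x" if "x \<in> U" for x
    using eq[OF t0(1) _ _ that] t0(2) h_fun_eq_h_prim[OF \<epsilon> grad_sq_nonneg[OF that, of ?f], of ?n p]
    by (simp add: W_def)
  have "W x \<le> W x\<^sub>0" if "x \<in> U" for x
    using max[OF t0(1) _ _ that] t0(2) WL[OF that] WL[OF x0] by (simp add: mult_le_cancel_left_pos)
  note mx = smooth_max_conditions[OF open_U W x0 this]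
  have pW: "partial i W x\<^sub>0 = 0" for i
    using mx(1) by (simp add: partial_eq_dir)
  \<comment> \<open>At a critical point the Christoffel term of the Hessian vanishes, so the second
    derivative test in coordinates controls the covariant Hessian.\<close>
  have hessW: "(\<Sum>i\<in>UNIV. \<Sum>j\<in>UNIV. \<xi> $ i * \<xi> $ j * hess G i j W x\<^sub>0) \<le> 0" for \<xi> :: "real^'n"
  proof -
    have "dir \<xi> (dir \<xi> W) x\<^sub>0 = dir \<xi> (\<lambda>x. \<Sum>j\<in>UNIV. \<xi> $ j * partial j W x) x\<^sub>0"
      by (rule dir_cong_open[OF open_U x0]) (rule dir_eq_sum_partial[OF sm_diff[OF W]])
    also have "\<dots> = (\<Sum>j\<in>UNIV. \<xi> $ j * dir \<xi> (partial j W) x\<^sub>0)"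
      using sm_diff[OF smooth_partial[OF W] x0] by (simp add: dir_sum dir_cmult)
    also have "\<dots> = (\<Sum>j\<in>UNIV. \<Sum>i\<in>UNIV. \<xi> $ i * \<xi> $ j * partial i (partial j W) x\<^sub>0)"
      using sm_diff[OF smooth_partial[OF W] x0]
      by (simp add: dir_eq_sum_partial sum_distrib_left mult_ac)
    also have "\<dots> = (\<Sum>i\<in>UNIV. \<Sum>j\<in>UNIV. \<xi> $ i * \<xi> $ j * hess G i j W x\<^sub>0)"
      by (subst sum.swap) (simp add: hess_def pW)
    finally show ?thesis using mx(2)[of \<xi>] by simp
  qed
  have LW: "L_op p \<epsilon> G ?f W x\<^sub>0 \<le> 0"
    unfolding L_op_expand by (rule elliptic_nonpos[OF x0 p \<epsilon> hessW])
  have crit: "partial j (L_op p \<epsilon> G ?f ?f) x\<^sub>0 = 0" for j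
  proof -
    have "partial j (L_op p \<epsilon> G ?f ?f) x\<^sub>0 = partial j (\<lambda>x. (-1) * W x) x\<^sub>0"
      unfolding partial_eq_dir by (rule dir_cong_open[OF open_U x0]) (simp add: WL)
    also have "\<dots> = - partial j W x\<^sub>0"
      unfolding partial_eq_dir using dir_cmult[OF sm_diff[OF W x0], of _ "-1"] by simp
    finally show ?thesis by (simp add: pW)
  qed
  have hp: "(h_prim ?n p \<epsilon> has_real_derivative h_deriv ?n p \<epsilon> (?s y)) (at (?s y))" if "y \<in> U" for y
    by (rule h_prim_deriv[OF \<epsilon> spos[OF that]])
  have hpp: "(h_deriv ?n p \<epsilon> has_real_derivative h'') (at (?s x\<^sub>0))"
    unfolding h''_def \<sigma>_def by (rule h_deriv_deriv[OF \<epsilon> spos[OF x0]])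
  have fdW: "?fd = (\<lambda>y. h_prim ?n p \<epsilon> (?s y) - W y)" by (simp add: W_def)
  note comp = L_op_composition[OF f x0 W pW hp hpp, folded fdW h'_def \<sigma>_def]
  define A where "A = (\<Sum>k\<in>UNIV. \<Sum>j\<in>UNIV. shape ?f k j x\<^sub>0 * shape ?f j k x\<^sub>0)"
  define Rc where "Rc = (\<Sum>j\<in>UNIV. \<Sum>l\<in>UNIV. ricci G j l x\<^sub>0 * grad G ?f x\<^sub>0 $ j * grad G ?f x\<^sub>0 $ l)"
  define N where "N = grad_sq G ?s x\<^sub>0"
  define Q where "Q = speed ?f x\<^sub>0"
  have Rc: "Rc \<ge> 0" unfolding Rc_def by (rule ricci)
  have Ls: "L_op p \<epsilon> G ?f ?s x\<^sub>0 = 2 * A + 2 * Rc + (p - 2) * (Q\<^sup>2 / \<sigma>\<^sup>2 - N / (2 * \<sigma>))"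
    unfolding A_def Rc_def N_def Q_def \<sigma>_def by (rule L_op_grad_sq[OF f x0 \<epsilon> crit])
  have Lfd: "L_op p \<epsilon> G ?f ?fd x\<^sub>0 = h' * L_op p \<epsilon> G ?f ?s x\<^sub>0 + h'' * (N + (p - 2) * Q\<^sup>2 / \<sigma>) - L_op p \<epsilon> G ?f W x\<^sub>0"
    using comp(1)[of p \<epsilon>] by (simp add: N_def Q_def \<sigma>_def)
  have gfd: "(\<Sum>i\<in>UNIV. grad G ?s x\<^sub>0 $ i * partial i ?fd x\<^sub>0) = h' * N"
  proof -
    have "(\<Sum>i\<in>UNIV. grad G ?s x\<^sub>0 $ i * partial i ?fd x\<^sub>0) = (\<Sum>i\<in>UNIV. grad G ?s x\<^sub>0 $ i * (h' * partial i ?s x\<^sub>0))"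
      by (simp only: comp(2))
    then show ?thesis by (simp add: N_def grad_sq_eq[OF x0, of ?s] sum_distrib_left mult_ac)
  qed
  have Xfd: "(\<Sum>i\<in>UNIV. grad G ?f x\<^sub>0 $ i * partial i ?fd x\<^sub>0) = h' * Q"
  proof -
    have "(\<Sum>i\<in>UNIV. grad G ?f x\<^sub>0 $ i * partial i ?fd x\<^sub>0) = (\<Sum>i\<in>UNIV. grad G ?f x\<^sub>0 $ i * (h' * partial i ?s x\<^sub>0))"
      by (simp only: comp(2))
    then show ?thesis by (simp add: Q_def speed_def sum_distrib_left mult_ac)
  qed
  define D where "D = L_op p \<epsilon> G ?f ?fd x\<^sub>0 + (p - 2) * (h' * N / \<sigma> - Q * (h' * Q) / \<sigma>\<^sup>2)"
  have dL: "((\<lambda>\<tau>. L_op p \<epsilon> G (\<lambda>x. V (\<tau>, x)) (\<lambda>x. V (\<tau>, x)) x\<^sub>0) has_real_derivative D) (at t\<^sub>0)"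
    using time_derivative_L_op[OF t0(1) x0 \<epsilon>, of p] unfolding gfd Xfd D_def \<sigma>_def Q_def .
  have "((\<lambda>\<tau>. \<tau> * - L_op p \<epsilon> G (\<lambda>x. V (\<tau>, x)) (\<lambda>x. V (\<tau>, x)) x\<^sub>0) has_real_derivative
      1 * - \<phi> + - D * t\<^sub>0) (at t\<^sub>0)"
    unfolding \<phi>_def by (intro DERIV_mult DERIV_ident DERIV_minus dL)
  moreover obtain e where e: "e > 0" "\<And>\<tau>. \<bar>\<tau> - t\<^sub>0\<bar> < e \<Longrightarrow> \<tau> \<in> J"
    using open_J t0(1) unfolding open_dist dist_real_def by blast
  \<comment> \<open>Within this radius the times compared stay in J and above 0.\<close>
  have "min e t\<^sub>0 > 0" using e t0 by simp
  ultimately have "0 \<le> 1 * - \<phi> + - D * t\<^sub>0"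
    by (rule left_max_deriv_nonneg) (rule max, use e t0 x0 in auto)
  then have tD: "t\<^sub>0 * D \<le> - \<phi>" by (simp add: mult.commute)
  \<comment> \<open>The terms with Q^2/\<sigma>^2 from the coefficients and from L s cancel, and
    -N/(2 \<sigma>) + N/\<sigma> turns into +N/(2 \<sigma>), the sign that
    \<open>reaction_bound\<close> needs.\<close>
  have "D = h' * (2 * A + (p - 2) * N / (2 * \<sigma>)) + h'' * (N + (p - 2) * Q\<^sup>2 / \<sigma>) + 2 * h' * Rc - L_op p \<epsilon> G ?f W x\<^sub>0"
  proof -
    have "(p - 2) * (h' * N / \<sigma> - Q * (h' * Q) / \<sigma>\<^sup>2) + h' * ((p - 2) * (Q\<^sup>2 / \<sigma>\<^sup>2 - N / (2 * \<sigma>))) = h' * ((p - 2) * N / (2 * \<sigma>))"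
      using \<sigma> by (simp add: power2_eq_square field_simps)
    then show ?thesis unfolding D_def Lfd Ls by (simp add: algebra_simps)
  qed
  moreover have "h' > 0" and rb: "\<phi>\<^sup>2 \<le> a_const ?n p * (h' * (2 * A + (p - 2) * N / (2 * \<sigma>)) + h'' * (N + (p - 2) * Q\<^sup>2 / \<sigma>))"
    using reaction_bound[OF f x0 p \<epsilon>]
    unfolding h'_def h_deriv_def h''_def \<phi>_def A_def N_def Q_def \<sigma>_def by auto
  moreover have "h' * Rc \<ge> 0" using \<open>h' > 0\<close> Rc by simp
  ultimately have "h' * (2 * A + (p - 2) * N / (2 * \<sigma>)) + h'' * (N + (p - 2) * Q\<^sup>2 / \<sigma>) \<le> D" using LW by linarith
  moreover have a: "a_const ?n p > 0" 
  proof -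
    have "real ?n \<ge> 1" by (simp add: Suc_leI)
    then have "0 < real ?n + p - 2" using p by linarith
    moreover have "0 < 2 * (p - 1)" using p by simp
    ultimately show ?thesis unfolding a_const_def by (rule divide_pos_pos)
  qed
  ultimately have "\<phi>\<^sup>2 \<le> a_const ?n p * D"
    using rb mult_left_mono[of _ D "a_const ?n p"] by (meson less_imp_le order_trans)
  \<comment> \<open>Chaining \<phi>^2 \<le> a D with \<open>t\<^sub>0 * D \<le> - \<phi>\<close>
    leaves one factor -\<phi> to divide by when it is positive.\<close>
  then have "t\<^sub>0 * \<phi>\<^sup>2 \<le> t\<^sub>0 * (a_const ?n p * D)" using t0(2) by simp
  also have "\<dots> = a_const ?n p * (t\<^sub>0 * D)" by simp
  also have "\<dots> \<le> a_const ?n p * - \<phi>" using tD a by (intro mult_left_mono) auto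
  finally have main: "t\<^sub>0 * (- \<phi>) * (- \<phi>) \<le> a_const ?n p * (- \<phi>)" by (simp add: power2_eq_square)
  show ?thesis
  proof (cases "- \<phi> > 0")
    case True
    then show ?thesis using main unfolding \<phi>_def[symmetric] by (simp only: mult_le_cancel_right_pos)
  next
    case False
    then have "t\<^sub>0 * - \<phi> \<le> 0" using t0(2) by (simp add: mult_nonneg_nonneg)
    then show ?thesis using a unfolding \<phi>_def[symmetric] by linarith
  qed
qed

end

section \<open>Passing between charts\<close>

lemma Ck_on_local:
  assumes "\<And>x. x \<in> S \<Longrightarrow> \<exists>U. open U \<and> x \<in> U \<and> Ck_on k U f"
  shows "Ck_on k S f"
  using assms
proof (induction k arbitrary: f)
  case 0
  have "isCont f x" if x: "x \<in> S" for x
  proof -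
    obtain U where "open U" "x \<in> U" "continuous_on U f" using 0[OF x] by auto
    then show ?thesis using continuous_on_eq_continuous_at by blast
  qed
  then show ?case by (simp add: continuous_at_imp_continuous_on)
next
  case (Suc k)
  have "f differentiable (at x)" if "x \<in> S" for x
    using Suc.prems[OF that] by auto
  moreover have "Ck_on k S (\<lambda>x. frechet_derivative f (at x) w)" for w
    by (rule Suc.IH) (use Suc.prems in fastforce)
  ultimately show ?case by simp
qed

text \<open>Around a point of an open set a local extension coincides with f itself, and
  \<open>Ck_on\<close> is a local property.\<close>

lemma smooth_map_on_open:
  assumes "open S" "smooth_map_on S f"
  shows "smooth_on S f"
  unfolding smooth_on_def
proof (intro allI Ck_on_local)
  fix k x assume "x \<in> S"
  then obtain U f' where U: "open U" "x \<in> U" "\<And>k. Ck_on k U f'" "\<And>y. y \<in> S \<inter> U \<Longrightarrow> f' y = f y"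
    using assms(2) unfolding smooth_map_on_def by metis
  have "Ck_on k (S \<inter> U) f"
    by (rule Ck_on_cong[OF open_Int[OF assms(1) U(1)] U(4)]) (use Ck_on_subset[OF U(3)] in auto)
  then show "\<exists>U. open U \<and> x \<in> U \<and> Ck_on k U f"
    using U(1,2) \<open>x \<in> S\<close> assms(1) by (intro exI[of _ "S \<inter> U"]) auto
qed

lemma partial_cong_open:
  fixes f f' :: "real^'n::finite \<Rightarrow> real"
  assumes "open B" "x \<in> B" "\<And>y. y \<in> B \<Longrightarrow> f y = f' y"
  shows "partial i f x = partial i f' x"
  unfolding partial_eq_dir using assms by (rule dir_cong_open)

text \<open>Only the germ of f at x matters; the solution agrees with its extension V just on a
  small coordinate neighbourhood.\<close>

lemma geometry_cong_open:
  fixes f f' :: "real^'n::finite \<Rightarrow> real"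
  assumes B: "open B" "x \<in> B" "\<And>y. y \<in> B \<Longrightarrow> f y = f' y"
  shows "grad G f x = grad G f' x" "grad_sq G f x = grad_sq G f' x" "L_op p \<epsilon> G f f x = L_op p \<epsilon> G f' f' x"
proof -
  have p: "partial i f y = partial i f' y" if "y \<in> B" for i y
    by (rule partial_cong_open[OF B(1) that B(3)])
  then have h: "hess G i j f x = hess G i j f' x" for i j
    using partial_cong_open[OF B(1,2), of "partial j f" "partial j f'" i] B(2) by (simp add: hess_def)
  show g: "grad G f x = grad G f' x" using p[OF B(2)] by (simp add: grad_def)
  then show "grad_sq G f x = grad_sq G f' x" by (simp add: grad_sq_def)
  then show "L_op p \<epsilon> G f f x = L_op p \<epsilon> G f' f' x" by (simp add: L_op_def a_coeff_def g h)
qed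

text \<open>With B the Jacobian, df pulls back by B^T and the metric by B^T Gd B. Comparing the
  equations that characterize the two gradients shows that B maps one to the other, without
  transforming the inverse matrices.\<close>

lemma grad_sq_change_of_coordinates:
  fixes Gc Gd :: "real^'n::finite \<Rightarrow> real^'n^'n" and f :: "real^'n \<Rightarrow> real"
  assumes Gc: "invertible (Gc x)" and Gd: "invertible (Gd (\<tau> x))"
    and tr: "Gc x = transpose (jacobian \<tau> (at x)) ** Gd (\<tau> x) ** jacobian \<tau> (at x)"
    and \<tau>: "\<tau> differentiable (at x)" and f: "f differentiable (at (\<tau> x))"
  shows "grad_sq Gc (f \<circ> \<tau>) x = grad_sq Gd f (\<tau> x)"
proof -
  define B where "B = jacobian \<tau> (at x)"
  define \<alpha> where "\<alpha> = (\<chi> i. partial i f (\<tau> x))"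
  have grad_inner: "G y *v grad G \<phi> y = (\<chi> i. partial i \<phi> y)"
    "grad_sq G \<phi> y = grad G \<phi> y \<bullet> (\<chi> i. partial i \<phi> y)"
    if "invertible (G y)" for G :: "real^'n \<Rightarrow> real^'n^'n" and \<phi> y
  proof -
    have "grad G \<phi> y = matrix_inv (G y) *v (\<chi> i. partial i \<phi> y)"
      by (simp add: grad_def matrix_vector_mult_def)
    then show "G y *v grad G \<phi> y = (\<chi> i. partial i \<phi> y)"
      using matrix_inv_inverse(1)[OF that] by (simp add: matrix_vector_mul_assoc)
    then show "grad_sq G \<phi> y = grad G \<phi> y \<bullet> (\<chi> i. partial i \<phi> y)" by (simp add: grad_sq_def)
  qed
  have "(\<tau> has_derivative (\<lambda>w. B *v w)) (at x)"
    using \<tau> unfolding B_def jacobian_works .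
  from has_derivative_compose[OF this has_derivative_dir[OF f]]
  have "((f \<circ> \<tau>) has_derivative (\<lambda>w. dir (B *v w) f (\<tau> x))) (at x)" by (simp add: o_def)
  then have "partial i (f \<circ> \<tau>) x = dir (B *v axis i 1) f (\<tau> x)" for i
    unfolding partial_eq_dir by (rule dir_eqI)
  then have "partial i (f \<circ> \<tau>) x = (\<Sum>k\<in>UNIV. B $ k $ i * partial k f (\<tau> x))" for i
    by (simp add: dir_eq_sum_partial[OF f] matrix_vector_mult_basis column_def)
  then have \<alpha>c: "(\<chi> i. partial i (f \<circ> \<tau>) x) = transpose B *v \<alpha>"
    by (simp add: vec_eq_iff \<alpha>_def matrix_vector_mult_def transpose_def)
  \<comment> \<open>The Jacobian is invertible because it is a factor of the invertible matrix
    \<open>Gc x\<close>.\<close>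
  have "det B \<noteq> 0"
    using Gc unfolding tr invertible_det_nz B_def[symmetric] by (simp add: det_mul)
  then have inj: "transpose B *v a = transpose B *v b \<Longrightarrow> a = b" for a b
    by (metis det_transpose invertible_det_nz matrix_inv_inverse(2) matrix_vector_mul_assoc matrix_vector_mul_lid)
  let ?Xc = "grad Gc (f \<circ> \<tau>) x" and ?Xd = "grad Gd f (\<tau> x)"
  have "transpose B *v (Gd (\<tau> x) *v (B *v ?Xc)) = transpose B *v \<alpha>"
    using grad_inner(1)[of Gc x "f \<circ> \<tau>", OF Gc] unfolding \<alpha>c tr B_def[symmetric]
    by (simp add: matrix_vector_mul_assoc matrix_mul_assoc)
  then have "Gd (\<tau> x) *v (B *v ?Xc) = Gd (\<tau> x) *v ?Xd"
    using inj grad_inner(1)[of Gd "\<tau> x" f, OF Gd] unfolding \<alpha>_def by metis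
  moreover have "matrix_inv (Gd (\<tau> x)) *v (Gd (\<tau> x) *v a) = a" for a
    using matrix_inv_inverse(2)[OF Gd] by (simp add: matrix_vector_mul_assoc)
  ultimately have BX: "B *v ?Xc = ?Xd" by metis
  have "grad_sq Gc (f \<circ> \<tau>) x = ?Xc \<bullet> (transpose B *v \<alpha>)"
    using grad_inner(2)[of Gc x, OF Gc] \<alpha>c by simp
  also have "\<dots> = (B *v ?Xc) \<bullet> \<alpha>"
    by (metis dot_lmul_matrix inner_commute transpose_matrix_vector transpose_transpose)
  also have "\<dots> = grad_sq Gd f (\<tau> x)"
    using grad_inner(2)[of Gd "\<tau> x" f, OF Gd] by (simp add: BX \<alpha>_def)
  finally show ?thesis .
qed

context smooth_manifold
begin

lemma chart_dom_subset: "c \<in> A \<Longrightarrow> chart_dom c \<subseteq> M"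
  using charts_cover by blast

lemma param_coord: "c \<in> A \<Longrightarrow> m \<in> chart_dom c \<Longrightarrow> param c (coord c m) = m"
  using chart_homeomorphism homeomorphism_apply1 by blast

lemma coord_param: "c \<in> A \<Longrightarrow> x \<in> coord c ` chart_dom c \<Longrightarrow> coord c (param c x) = x"
  using chart_homeomorphism homeomorphism_apply2 by blast

lemma param_in: "c \<in> A \<Longrightarrow> x \<in> coord c ` chart_dom c \<Longrightarrow> param c x \<in> chart_dom c"
  by (metis imageE param_coord)

lemma open_overlap:
  assumes "c \<in> A" "d \<in> A"
  shows "open (coord c ` (chart_dom c \<inter> chart_dom d))"
proof -
  obtain O' where "open O'" "chart_dom d = M \<inter> O'"
    using chart_open[OF assms(2)] unfolding openin_open by blast
  then have "openin (top_of_set (chart_dom c)) (chart_dom c \<inter> chart_dom d)"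
    using chart_dom_subset[OF assms(1)] unfolding openin_open by blast
  then show ?thesis
    using homeomorphism_imp_open_map[OF chart_homeomorphism[OF assms(1)]]
      chart_image_open[OF assms(1)] openin_open_trans by blast
qed

end

context riemannian_manifold
begin

lemma chart_metric: "c \<in> A \<Longrightarrow> local_metric (coord c ` chart_dom c) (g c)"
  by unfold_locales
    (simp_all add: chart_image_open metric_sym metric_pos smooth_map_on_open[OF chart_image_open metric_smooth])

lemma grad_sq_at_independent:
  assumes c: "c \<in> A" and d: "d \<in> A" and m: "m \<in> chart_dom c" "m \<in> chart_dom d"
    and f: "(f \<circ> param d) differentiable (at (coord d m))"
  shows "grad_sq_at g c f m = grad_sq_at g d f m"
proof -
  let ?S = "coord c ` (chart_dom c \<inter> chart_dom d)" and ?\<tau> = "transition c d"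
  have S: "open ?S" by (rule open_overlap[OF c d])
  have x: "coord c m \<in> ?S" using m by blast
  have \<tau>x: "?\<tau> (coord c m) = coord d m" using param_coord[OF c m(1)] by (simp add: transition_def)
  have "grad_sq (g c) (f \<circ> param c) (coord c m) = grad_sq (g c) (f \<circ> param d \<circ> ?\<tau>) (coord c m)"
  proof (rule geometry_cong_open(2)[OF S x])
    fix y assume "y \<in> ?S"
    then show "(f \<circ> param c) y = (f \<circ> param d \<circ> ?\<tau>) y"
      using param_coord[OF c] param_coord[OF d] by (auto simp: transition_def)
  qed
  also have "\<dots> = grad_sq (g d) (f \<circ> param d) (?\<tau> (coord c m))"
  proof (rule grad_sq_change_of_coordinates)
    show "invertible (g c (coord c m))" "invertible (g d (?\<tau> (coord c m)))"
      using local_metric.invertible_G[OF chart_metric[OF c]] local_metric.invertible_G[OF chart_metric[OF d]] m \<tau>x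
      by auto
    show "g c (coord c m) = transpose (jacobian ?\<tau> (at (coord c m))) ** g d (?\<tau> (coord c m)) ** jacobian ?\<tau> (at (coord c m))"
      by (rule metric_transform[OF c d x])
    show "?\<tau> differentiable (at (coord c m))"
      by (rule smooth_on_differentiable[OF smooth_map_on_open[OF S transition_smooth[OF c d]] x])
    show "(f \<circ> param d) differentiable (at (?\<tau> (coord c m)))" using f \<tau>x by simp
  qed
  finally show ?thesis by (simp add: grad_sq_at_def \<tau>x)
qed

text \<open>At the end points of \<open>[0, T]\<close> the time interval \<open>J\<close> sticks out of \<open>[0, T]\<close>, where \<open>V\<close> is an
  arbitrary smooth extension of the solution.\<close>

lemma local_extension:
  assumes v: "smooth_on_spacetime A T v" and c: "c \<in> A" and m: "m \<in> chart_dom c" and t: "t \<in> {0..T}"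
  shows "\<exists>J B V. evolving_function B (g c) J V \<and> t \<in> J \<and> coord c m \<in> B \<and> B \<subseteq> coord c ` chart_dom c \<and>
    (\<forall>\<tau> x. \<tau> \<in> J \<longrightarrow> \<tau> \<in> {0..T} \<longrightarrow> x \<in> B \<longrightarrow> V (\<tau>, x) = v \<tau> (param c x))"
proof -
  let ?D = "coord c ` chart_dom c"
  have "smooth_map_on ({0..T} \<times> ?D) (\<lambda>(t, x). v t (param c x))"
    using v c unfolding smooth_on_spacetime_def by blast
  moreover have "(t, coord c m) \<in> {0..T} \<times> ?D" using t m by blast
  ultimately obtain \<Omega> V where \<Omega>: "open \<Omega>" "(t, coord c m) \<in> \<Omega>" "\<And>k. Ck_on k \<Omega> V"
    "\<And>y. y \<in> ({0..T} \<times> ?D) \<inter> \<Omega> \<Longrightarrow> V y = (\<lambda>(t, x). v t (param c x)) y"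
    unfolding smooth_map_on_def by metis
  obtain J B' where JB: "open J" "open B'" "t \<in> J" "coord c m \<in> B'" "J \<times> B' \<subseteq> \<Omega>"
    using open_prod_elim[OF \<Omega>(1,2)] by (metis mem_Sigma_iff)
  define B where "B = B' \<inter> ?D"
  interpret local_metric ?D "g c" by (rule chart_metric[OF c])
  show ?thesis
  proof (intro exI conjI allI impI)
    have "smooth_on \<Omega> V" using \<Omega>(3) by (simp add: smooth_on_def)
    then have "smooth_on (J \<times> B) V" by (rule smooth_on_subset) (use JB(5) in \<open>auto simp: B_def\<close>)
    moreover have "open B" using JB(2) open_U by (simp add: B_def open_Int)
    moreover have "smooth_on B (g c)" by (rule smooth_on_subset[OF smooth_G]) (simp add: B_def)
    ultimately show "evolving_function B (g c) J V"
      by unfold_locales (use JB(1) sym pos in \<open>auto simp: B_def\<close>)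
    show "coord c m \<in> B" using JB(4) m by (simp add: B_def)
    show "V (\<tau>, x) = v \<tau> (param c x)" if "\<tau> \<in> J" "\<tau> \<in> {0..T}" "x \<in> B" for \<tau> x
    proof -
      have "(\<tau>, x) \<in> ({0..T} \<times> ?D) \<inter> \<Omega>" using that JB(5) by (auto simp: B_def)
      from \<Omega>(4)[OF this] show ?thesis by simp
    qed
  qed (use JB(3) in \<open>auto simp: B_def\<close>)
qed

end

section \<open>The solution expressed by its local extension\<close>

context evolving_function
begin

lemma extension_formulas:
  fixes v :: "real \<Rightarrow> 'm \<Rightarrow> real" and P :: "real^'n \<Rightarrow> 'm"
  assumes V: "\<And>\<tau> x. \<tau> \<in> J \<Longrightarrow> \<tau> \<in> {0..T} \<Longrightarrow> x \<in> U \<Longrightarrow> V (\<tau>, x) = v \<tau> (P x)"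
    and T: "0 < T" and t: "t \<in> J" "t \<in> {0..T}" and x: "x \<in> U"
  shows "((\<lambda>\<tau>. v \<tau> (P x)) has_vector_derivative dir (1, 0) V (t, x)) (at t within {0..T})"
    and "time_deriv T v t (P x) = dir (1, 0) V (t, x)"
    and "grad_sq G (v t \<circ> P) x = grad_sq G (\<lambda>x. V (t, x)) x"
    and "L_op p \<epsilon> G (v t \<circ> P) (v t \<circ> P) x = L_op p \<epsilon> G (\<lambda>x. V (t, x)) (\<lambda>x. V (t, x)) x"
    and "(v t \<circ> P) differentiable (at x)"
proof -
  obtain e where e: "e > 0" "\<And>\<tau>. dist \<tau> t < e \<Longrightarrow> \<tau> \<in> J"
    using open_J t(1) unfolding open_dist by blast
  have "((\<lambda>\<tau>. v \<tau> (P x)) has_field_derivative dir (1, 0) V (t, x)) (at t within {0..T})"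
    by (rule has_field_derivative_transform_within[OF has_field_derivative_at_within[OF time_derivative[OF smooth_V t(1) x]] e(1) t(2)])
      (use V e x in auto)
  then show d: "((\<lambda>\<tau>. v \<tau> (P x)) has_vector_derivative dir (1, 0) V (t, x)) (at t within {0..T})"
    by (simp add: has_real_derivative_iff_has_vector_derivative)
  \<comment> \<open>0 < T makes the derivative within \<open>{0..T}\<close> unique, also at the end
    points.\<close>
  show "time_deriv T v t (P x) = dir (1, 0) V (t, x)"
    unfolding time_deriv_def by (rule vector_derivative_within_closed_interval[OF T t(2) d])
  have eq: "(v t \<circ> P) y = V (t, y)" if "y \<in> U" for y using V[OF t that] by simp
  show "grad_sq G (v t \<circ> P) x = grad_sq G (\<lambda>x. V (t, x)) x"
    "L_op p \<epsilon> G (v t \<circ> P) (v t \<circ> P) x = L_op p \<epsilon> G (\<lambda>x. V (t, x)) (\<lambda>x. V (t, x)) x"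
    using geometry_cong_open(2,3)[OF open_U x, of "v t \<circ> P" "\<lambda>x. V (t, x)"] eq by auto
  show "(v t \<circ> P) differentiable (at x)"
    by (rule differentiable_cong_open[OF open_U x eq[symmetric]])
      (simp_all add: sm_diff[OF slice(1)[OF smooth_V t(1)] x])
qed

text \<open>Compactness needs continuity jointly in time and space; for this, slice derivatives are
  rewritten as directional derivatives of V on the product.\<close>

lemma continuous_on_w:
  assumes "0 < \<epsilon>"
  shows "continuous_on (J \<times> U) (\<lambda>z. h_prim n p \<epsilon> (grad_sq G (\<lambda>x. V (fst z, x)) (snd z)) - dir (1, 0) V z)"
proof -
  let ?e = "\<lambda>i. (0, axis i 1) :: real \<times> (real^'n)"
  have D: "continuous_on (J \<times> U) (dir w V)" for w
    by (rule smooth_on_continuous[OF smooth_on_dir[OF smooth_V]])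
  have "continuous_on (J \<times> U) (\<lambda>z. ginv k l (snd z))" for k l
    by (rule continuous_on_compose2[OF smooth_on_continuous[OF smooth_ginv]]) (auto intro: continuous_intros)
  then have "continuous_on (J \<times> U) (\<lambda>z. \<Sum>k\<in>UNIV. (\<Sum>l\<in>UNIV. ginv k l (snd z) * dir (?e l) V z) * dir (?e k) V z)"
    by (intro continuous_on_sum continuous_on_mult D)
  moreover have eq: "(\<Sum>k\<in>UNIV. (\<Sum>l\<in>UNIV. ginv k l (snd z) * dir (?e l) V z) * dir (?e k) V z)
      = grad_sq G (\<lambda>x. V (fst z, x)) (snd z)" if "z \<in> J \<times> U" for z
  proof -
    have z: "fst z \<in> J" "snd z \<in> U" using that by auto
    show ?thesis
      by (simp add: grad_sq_eq[OF z(2)] grad_nth partial_eq_dir slice(2)[OF smooth_V z])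
  qed
  ultimately have s: "continuous_on (J \<times> U) (\<lambda>z. grad_sq G (\<lambda>x. V (fst z, x)) (snd z))"
    by (rule continuous_on_eq)
  have "isCont (h_prim n p \<epsilon>) y" if "y \<ge> 0" for y
    using DERIV_isCont[OF h_prim_deriv[OF assms]] that assms by (simp add: add_nonneg_pos)
  then have "continuous_on {0..} (h_prim n p \<epsilon>)" by (simp add: continuous_at_imp_continuous_on)
  then have "continuous_on (J \<times> U) (\<lambda>z. h_prim n p \<epsilon> (grad_sq G (\<lambda>x. V (fst z, x)) (snd z)))"
    by (rule continuous_on_compose2[OF _ s]) (use grad_sq_nonneg in auto)
  then show ?thesis by (intro continuous_on_diff D)
qed

end

section \<open>The theorem\<close>

text \<open>K and the integrand are nonnegative. Dropping the integral is what turns the bound for w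
  into the gradient estimate for u.\<close>

lemma h_fun_ge:
  assumes "1 < p" "n \<ge> 1" "0 \<le> s"
  shows "(p - 1) * s \<le> h_fun n p \<epsilon> s"
proof -
  \<comment> \<open>Without integrability the integral defaults to 0, so the sign holds in either
    case.\<close>
  have "0 \<le> integral {0..s} (\<lambda>\<tau>. (\<epsilon>\<^sup>2 / (\<tau> + \<epsilon>\<^sup>2)) powr ((p - 1) / 4))"
    by (cases "(\<lambda>\<tau>. (\<epsilon>\<^sup>2 / (\<tau> + \<epsilon>\<^sup>2)) powr ((p - 1) / 4)) integrable_on {0..s}")
      (auto intro: integral_nonneg simp: not_integrable_integral)
  moreover have "K_const n p \<ge> 0" using assms by (simp add: K_const_def)
  ultimately show ?thesis by (simp add: h_fun_def)
qed

lemma (in closed_riemannian_manifold) F_fun_nonpos: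
  fixes v :: "real \<Rightarrow> 'a \<Rightarrow> real" and p \<epsilon> T :: real
  assumes p: "1 < p" and ric: "nonneg_ricci A g" and \<epsilon>: "0 < \<epsilon>" and T: "0 < T"
    and sol: "smooth_solution p \<epsilon> A g T v"
    and c: "c \<in> A" and m: "m \<in> chart_dom c" and t: "t \<in> {0..T}"
  shows "F_fun p \<epsilon> g T v c t m \<le> 0"
proof -
  have sm: "smooth_on_spacetime A T v" using sol by (simp add: smooth_solution_def)
  have pde: "time_deriv T v t m = L_at p \<epsilon> g c (v t) (v t) m + h_fun CARD('b) p \<epsilon> (grad_sq_at g c (v t) m)"
    if "c \<in> A" "m \<in> chart_dom c" "t \<in> {0..T}" for c m t
    using sol that by (simp add: smooth_solution_def)
  have indep: "F_fun p \<epsilon> g T v c t m = F_fun p \<epsilon> g T v d t m"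
    if "c \<in> A" "d \<in> A" "m \<in> chart_dom c" "m \<in> chart_dom d" "t \<in> {0..T}" for c d m t
  proof -
    note ass = that
    obtain J B V where *: "evolving_function B (g d) J V" "t \<in> J" "coord d m \<in> B" "B \<subseteq> coord d ` chart_dom d"
      "\<And>\<tau> x. \<tau> \<in> J \<Longrightarrow> \<tau> \<in> {0..T} \<Longrightarrow> x \<in> B \<Longrightarrow> V (\<tau>, x) = v \<tau> (param d x)"
      using local_extension[OF sm ass(2,4,5)] by blast
    have "(v t \<circ> param d) differentiable (at (coord d m))"
      by (rule evolving_function.extension_formulas(5)[where v = v and P = "param d" and T = T,
            OF *(1) *(5) T *(2) that(5) *(3)])
    from grad_sq_at_independent[OF that(1-4) this] show ?thesis by (simp add: F_fun_def w_fun_def)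
  qed
  \<comment> \<open>Choosing one chart per point makes F a function \<Phi> on [0, T] x M;
    \<open>indep\<close> lets any other chart be used to evaluate it, which gives continuity
    although the choice is arbitrary.\<close>
  define ch where "ch m = (SOME c. c \<in> A \<and> m \<in> chart_dom c)" for m
  have ch: "ch m \<in> A \<and> m \<in> chart_dom (ch m)" if "m \<in> M" for m
    unfolding ch_def by (rule someI_ex) (use that charts_cover in blast)
  define \<Phi> where "\<Phi> z = F_fun p \<epsilon> g T v (ch (snd z)) (fst z) (snd z)" for z
  have \<Phi>: "\<Phi> (t, m) = F_fun p \<epsilon> g T v c t m" if "c \<in> A" "m \<in> chart_dom c" "t \<in> {0..T}" for c t m
  proof -
    have "m \<in> M" using that(1,2) chart_dom_subset by blast
    from ch[OF this] show ?thesis unfolding \<Phi>_def fst_conv snd_conv using that by (intro indep) auto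
  qed
  have cont: "continuous_on ({0..T} \<times> M) \<Phi>"
    unfolding continuous_on_eq_continuous_within
  proof safe
    fix t m assume t: "t \<in> {0..T}" and "m \<in> M"
    then obtain c where c: "c \<in> A" "m \<in> chart_dom c" using charts_cover by blast
    obtain J B V where *: "evolving_function B (g c) J V" "t \<in> J" "coord c m \<in> B" "B \<subseteq> coord c ` chart_dom c"
      "\<And>\<tau> x. \<tau> \<in> J \<Longrightarrow> \<tau> \<in> {0..T} \<Longrightarrow> x \<in> B \<Longrightarrow> V (\<tau>, x) = v \<tau> (param c x)"
      using local_extension[OF sm c t] by blast
    interpret E: evolving_function B "g c" J V by (rule *(1))
    have cc: "continuous_on (chart_dom c) (coord c)"
      using chart_homeomorphism[OF c(1)] homeomorphism_def by blast
    have "openin (top_of_set (chart_dom c)) (chart_dom c \<inter> coord c -` B)"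
      by (rule continuous_openin_preimage_gen[OF cc E.open_U])
    then have "openin (top_of_set M) (chart_dom c \<inter> coord c -` B)"
      using chart_open[OF c(1)] openin_trans by blast
    then obtain N where N: "open N" "chart_dom c \<inter> coord c -` B = M \<inter> N" unfolding openin_open by blast
    \<comment> \<open>A relative neighbourhood of (t, m) on which \<Phi> is given by V in the single
      chart c.\<close>
    let ?N = "({0..T} \<inter> J) \<times> (M \<inter> N)"
    have Nc: "m' \<in> chart_dom c" "coord c m' \<in> B" if "m' \<in> M \<inter> N" for m' using that N(2) by blast+
    have "continuous_on ?N (\<lambda>z. (fst z, coord c (snd z)))"
      by (intro continuous_on_Pair continuous_on_fst continuous_on_id continuous_on_compose2[OF cc] continuous_on_snd)
        (use Nc in auto)
    from continuous_on_compose2[OF E.continuous_on_w[OF \<epsilon>, of "CARD('b)" p] this]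
    have "continuous_on ?N (\<lambda>z. h_prim CARD('b) p \<epsilon> (grad_sq (g c) (\<lambda>x. V (fst z, x)) (coord c (snd z)))
        - dir (1, 0) V (fst z, coord c (snd z)))" using Nc by (auto simp: image_subset_iff)
    then have "continuous_on ?N (\<lambda>z. fst z * (h_prim CARD('b) p \<epsilon> (grad_sq (g c) (\<lambda>x. V (fst z, x)) (coord c (snd z)))
        - dir (1, 0) V (fst z, coord c (snd z))) - a_const CARD('b) p)"
      by (rule continuous_on_diff[OF continuous_on_mult[OF continuous_on_fst[OF continuous_on_id]] continuous_on_const])
    then have "continuous_on ?N \<Phi>"
    proof (rule continuous_on_eq)
      fix z assume "z \<in> ?N"
      then obtain \<tau> m' where z: "z = (\<tau>, m')" "\<tau> \<in> {0..T}" "\<tau> \<in> J" "m' \<in> M \<inter> N" by auto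
      note m' = Nc[OF z(4)]
      note ef = E.extension_formulas[where v = v and P = "param c" and T = T, OF *(5) T z(3,2) m'(2), unfolded param_coord[OF c(1) m'(1)]]
      have "h_prim CARD('b) p \<epsilon> (grad_sq (g c) (\<lambda>x. V (\<tau>, x)) (coord c m')) = h_fun CARD('b) p \<epsilon> (grad_sq_at g c (v \<tau>) m')"
        by (simp only: grad_sq_at_def ef(3) h_fun_eq_h_prim[OF \<epsilon> E.grad_sq_nonneg[OF m'(2)]])
      then show "fst z * (h_prim CARD('b) p \<epsilon> (grad_sq (g c) (\<lambda>x. V (fst z, x)) (coord c (snd z)))
        - dir (1, 0) V (fst z, coord c (snd z))) - a_const CARD('b) p = \<Phi> z"
        using ef(2) by (simp add: z(1) \<Phi>[OF c(1) m'(1) z(2)] F_fun_def w_fun_def)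
    qed
    moreover have "m \<in> M \<inter> N" using N(2) c(2) *(3) by blast
    ultimately have "continuous (at (t, m) within ?N) \<Phi>"
      using t *(2) by (simp add: continuous_on_eq_continuous_within)
    moreover have "at (t, m) within ?N = at (t, m) within {0..T} \<times> M"
      by (rule at_within_nhd[of _ "J \<times> N"])
        (use N(1) E.open_J *(2) \<open>m \<in> M \<inter> N\<close> in \<open>auto simp: open_Times\<close>)
    ultimately show "continuous (at (t, m) within {0..T} \<times> M) \<Phi>" by simp
  qed
  have mM: "m \<in> M" using m c chart_dom_subset by blast
  then have "{0..T} \<times> M \<noteq> {}" using t by blast
  then obtain z where z: "z \<in> {0..T} \<times> M" "\<And>y. y \<in> {0..T} \<times> M \<Longrightarrow> \<Phi> y \<le> \<Phi> z"
    using continuous_attains_sup[OF compact_Times[OF compact_Icc compact_manifold] _ cont] by blast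
  obtain t0 m0 where z0: "z = (t0, m0)" "t0 \<in> {0..T}" "m0 \<in> M" using z(1) by auto
  obtain c0 where c0: "c0 \<in> A" "m0 \<in> chart_dom c0" using z0(3) charts_cover by blast
  have FL: "F_fun p \<epsilon> g T v c \<tau> m = \<tau> * - L_at p \<epsilon> g c (v \<tau>) (v \<tau>) m - a_const CARD('b) p"
    if "c \<in> A" "m \<in> chart_dom c" "\<tau> \<in> {0..T}" for c m \<tau>
    using pde[OF that] by (simp add: F_fun_def w_fun_def)
  have "\<Phi> z \<le> 0"
  proof (cases "t0 = 0")
    case True
    have "real CARD('b) \<ge> 1" by (simp add: Suc_leI)
    then have "0 \<le> real CARD('b) + p - 2" using p by linarith
    then have "a_const CARD('b) p \<ge> 0" unfolding a_const_def using p by simp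
    then show ?thesis using \<Phi>[OF c0 z0(2)] by (simp add: z0(1) F_fun_def True)
  next
    case False
    then have t0: "0 < t0" using z0(2) by simp
    obtain J B V where *: "evolving_function B (g c0) J V" "t0 \<in> J" "coord c0 m0 \<in> B" "B \<subseteq> coord c0 ` chart_dom c0"
      "\<And>\<tau> x. \<tau> \<in> J \<Longrightarrow> \<tau> \<in> {0..T} \<Longrightarrow> x \<in> B \<Longrightarrow> V (\<tau>, x) = v \<tau> (param c0 x)"
      using local_extension[OF sm c0 z0(2)] by blast
    interpret E: evolving_function B "g c0" J V by (rule *(1))
    have Lat: "L_at p \<epsilon> g c0 (v \<tau>) (v \<tau>) (param c0 x) = L_op p \<epsilon> (g c0) (\<lambda>x. V (\<tau>, x)) (\<lambda>x. V (\<tau>, x)) x"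
      if "\<tau> \<in> J" "\<tau> \<in> {0..T}" "x \<in> B" for \<tau> x
      using E.extension_formulas(4)[where v = v and P = "param c0" and T = T, OF *(5) T that] coord_param[OF c0(1)] *(4) that(3)
      by (auto simp: L_at_def)
    have "t0 * - L_op p \<epsilon> (g c0) (\<lambda>x. V (t0, x)) (\<lambda>x. V (t0, x)) (coord c0 m0) \<le> a_const CARD('b) p"
    proof (rule E.local_maximum_bound[OF p \<epsilon> *(2) t0 *(3)])
      fix \<tau> x assume \<tau>: "\<tau> \<in> J" "0 \<le> \<tau>" "\<tau> \<le> t0" and x: "x \<in> B"
      then have \<tau>T: "\<tau> \<in> {0..T}" using z0(2) by simp
      have xm: "param c0 x \<in> chart_dom c0" "coord c0 (param c0 x) = x"
        using param_in[OF c0(1)] coord_param[OF c0(1)] *(4) x by auto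
      note ef = E.extension_formulas[where v = v and P = "param c0" and T = T, OF *(5) T \<tau>(1) \<tau>T x]
      show "dir (1, 0) V (\<tau>, x) = L_op p \<epsilon> (g c0) (\<lambda>x. V (\<tau>, x)) (\<lambda>x. V (\<tau>, x)) x
          + h_fun CARD('b) p \<epsilon> (grad_sq (g c0) (\<lambda>x. V (\<tau>, x)) x)"
        using pde[OF c0(1) xm(1) \<tau>T] ef(2,3) Lat[OF \<tau>(1) \<tau>T x] by (simp add: grad_sq_at_def xm(2))
      have "param c0 x \<in> M" using xm(1) chart_dom_subset[OF c0(1)] by blast
      then have "\<Phi> (\<tau>, param c0 x) \<le> \<Phi> (t0, m0)" using z(2)[of "(\<tau>, param c0 x)"] \<tau>T z0(1) by simp
      then show "\<tau> * - L_op p \<epsilon> (g c0) (\<lambda>x. V (\<tau>, x)) (\<lambda>x. V (\<tau>, x)) x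
          \<le> t0 * - L_op p \<epsilon> (g c0) (\<lambda>x. V (t0, x)) (\<lambda>x. V (t0, x)) (coord c0 m0)"
        using Lat[OF \<tau>(1) \<tau>T x] Lat[OF *(2) z0(2) *(3)]
        by (simp add: \<Phi>[OF c0(1) xm(1) \<tau>T] \<Phi>[OF c0 z0(2)] FL[OF c0(1) xm(1) \<tau>T] FL[OF c0 z0(2)] param_coord[OF c0])
    next
      fix \<xi> :: "real^'b"
      show "0 \<le> (\<Sum>i\<in>UNIV. \<Sum>j\<in>UNIV. ricci (g c0) i j (coord c0 m0) * \<xi> $ i * \<xi> $ j)"
        using ric c0 unfolding nonneg_ricci_def by blast
    qed
    then show ?thesis
      using Lat[OF *(2) z0(2) *(3)] by (simp add: z0(1) \<Phi>[OF c0 z0(2)] FL[OF c0 z0(2)] param_coord[OF c0])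
  qed
  then show ?thesis using z(2)[of "(t, m)"] \<Phi>[OF c m t] t mM by simp
qed

theorem theorem4p8:
  fixes M :: "'m::t2_space set"
    and A :: "('m, 'n::finite) chart set"
    and g :: "('m, 'n) chart \<Rightarrow> real^'n \<Rightarrow> real^'n^'n"
    and p \<epsilon> T :: real
    and u v :: "real \<Rightarrow> 'm \<Rightarrow> real"
  assumes "1 < p"
    and "closed_riemannian_manifold M A g"
    and "nonneg_ricci A g"
    and "0 < \<epsilon>"
    and "0 < T"
    and "smooth_solution p \<epsilon> A g T v"
    and "u = (\<lambda>t m. exp (v t m))"
  shows "(\<forall>c\<in>A. \<forall>m\<in>chart_dom c. \<forall>t\<in>{0..T}. F_fun p \<epsilon> g T v c t m \<le> 0) \<and>
    (\<forall>c\<in>A. \<forall>m\<in>chart_dom c. \<forall>t\<in>{0<..T}.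
       (p - 1) * grad_sq_at g c (u t) m / (u t m)\<^sup>2 - time_deriv T u t m / u t m
         \<le> (real CARD('n) + p - 2) / (2 * (p - 1) * t))"
proof (intro conjI ballI)
  interpret closed_riemannian_manifold M A g by (rule assms(2))
  show F: "F_fun p \<epsilon> g T v c t m \<le> 0" if "c \<in> A" "m \<in> chart_dom c" "t \<in> {0..T}" for c m t
    by (rule F_fun_nonpos[OF assms(1,3-6) that])
  have sm: "smooth_on_spacetime A T v" using assms(6) by (simp add: smooth_solution_def)
  fix c m t assume c: "c \<in> A" and m: "m \<in> chart_dom c"
  assume "t \<in> {0<..T}"
  then have t: "t \<in> {0..T}" "0 < t" by auto
  let ?x = "coord c m" and ?s = "grad_sq_at g c (v t) m"
  obtain J B V where *: "evolving_function B (g c) J V" "t \<in> J" "coord c m \<in> B" "B \<subseteq> coord c ` chart_dom c"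
    "\<And>\<tau> x. \<tau> \<in> J \<Longrightarrow> \<tau> \<in> {0..T} \<Longrightarrow> x \<in> B \<Longrightarrow> V (\<tau>, x) = v \<tau> (param c x)"
    using local_extension[OF sm c m t(1)] by blast
  interpret E: evolving_function B "g c" J V by (rule *(1))
  note ef = E.extension_formulas[where v = v and P = "param c" and T = T, OF *(5) assms(5) *(2) t(1) *(3), unfolded param_coord[OF c m]]
  have "((\<lambda>\<tau>. v \<tau> m) has_real_derivative time_deriv T v t m) (at t within {0..T})"
    using ef(1,2) by (simp add: has_real_derivative_iff_has_vector_derivative)
  then have "((\<lambda>\<tau>. u \<tau> m) has_real_derivative u t m * time_deriv T v t m) (at t within {0..T})"
    unfolding assms(7) by (rule DERIV_chain2[OF DERIV_exp])
  then have ut: "time_deriv T u t m = u t m * time_deriv T v t m"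
    unfolding time_deriv_def[of T u] has_real_derivative_iff_has_vector_derivative
    by (rule vector_derivative_within_closed_interval[OF assms(5) t(1)])
  have um: "u t m > 0" by (simp add: assms(7))
  have "partial i (u t \<circ> param c) ?x = u t m * partial i (v t \<circ> param c) ?x" for i
    using dir_compose_real[OF ef(5) DERIV_exp] param_coord[OF c m]
    by (simp add: partial_eq_dir assms(7) o_def)
  then have "grad (g c) (u t \<circ> param c) ?x = u t m *\<^sub>R grad (g c) (v t \<circ> param c) ?x"
    by (simp add: grad_def vec_eq_iff sum_distrib_left mult_ac)
  then have us: "grad_sq_at g c (u t) m = (u t m)\<^sup>2 * ?s"
    by (simp add: grad_sq_at_def grad_sq_def matrix_vector_mult_scaleR power2_eq_square)
  have s: "0 \<le> ?s" unfolding grad_sq_at_def ef(3) by (rule E.grad_sq_nonneg[OF *(3)])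
  have "(p - 1) * grad_sq_at g c (u t) m / (u t m)\<^sup>2 - time_deriv T u t m / u t m = (p - 1) * ?s - time_deriv T v t m"
    using um by (simp add: us ut)
  \<comment> \<open>After u = e^v has cancelled, only (p-1) s \<le> h(s) separates this from
    w.\<close>
  also have "\<dots> \<le> w_fun p \<epsilon> g T v c t m"
    using h_fun_ge[OF assms(1) _ s, of "CARD('n)" \<epsilon>] by (simp add: w_fun_def Suc_leI)
  also have "\<dots> \<le> a_const CARD('n) p / t"
    using F[OF c m t(1)] t(2) by (simp add: F_fun_def pos_le_divide_eq mult.commute)
  also have "\<dots> = (real CARD('n) + p - 2) / (2 * (p - 1) * t)"
    by (simp add: a_const_def)
  finally show "(p - 1) * grad_sq_at g c (u t) m / (u t m)\<^sup>2 - time_deriv T u t m / u t m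
         \<le> (real CARD('n) + p - 2) / (2 * (p - 1) * t)" .
qed

end
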